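(* There are non-trivial homomorphisms of (simple, admissible affine) vertex (super)algebras as follows. (1) $\Phi_1 : V_k(sl(2)) \rightarrow L^{Vir}(d_{p,p'},0)\otimes \Pi(0)$, whenever $k+2=\frac{p}{p'}$ with $p,p'\in\mathbb Z$, $p,p'\ge 2$, $\gcd(p,p')=1$. (2) $\Phi_2 : V_k(osp(1,2)) \rightarrow L^{ns}(c_{p,q},0)\otimes F\otimes \Pi^{1/2}(0)$, whenever $k+\frac32=\frac{p}{2q}$ with $p,q\in\mathbb Z$, $p,q\ge 2$, $\frac{p-q}{2}\in\mathbb Z$ and $\gcd(\frac{p-q}{2},q)=1$.
   Context: $V_k(\mathfrak g)$ is the simple quotient of the universal affine vertex (super)algebra $V^k(\mathfrak g)$ of level $k$. For $\mathfrak g=sl(2)$ the form is normalized by $(h,h)=2$. $osp(1,2)$ is the Lie superalgebra with even basis $e,f,h$, odd basis $x,y$, relations $[e,f]=h$, $[h,e]=2e$, $[h,f]=-2f$, $[h,x]=x$, $[e,x]=0$, $[f,x]=-y$, $[h,y]=-y$, $[e,y]=-x$, $[f,y]=0$, $\{x,x\}=2e$, $\{x,y\}=h$, $\{y,y\}=-2f$, and invariant form with non-trivial products $(e,f)=(f,e)=1$, $(h,h)=2$, $(x,y)=-(y,x)=2$. $d_{p,p'}=1-\frac{6(p-p')^2}{pp'}$ and $c_{p,q}=\frac32-\frac{3(p-q)^2}{pq}$. $L^{Vir}(c,0)$ is the simple Virasoro vertex algebra and $L^{ns}(c,0)$ the simple $N=1$ Neveu-Schwarz vertex superalgebra of central charge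 $c$. $F$ is the fermionic vertex superalgebra (central charge $1/2$) generated by one odd field $\Psi(z)=\sum_{m\in\mathbb Z}\Psi(m+\frac12)z^{-m-1}$ with $\{\Psi(r),\Psi(s)\}=\delta_{r+s,0}$. Let $L=\mathbb Zc+\mathbb Zd$ with $\langle c,c\rangle=\langle d,d\rangle=0$, $\langle c,d\rangle=2$, and let $M(1)$ be the rank two Heisenberg vertex algebra generated by the fields $c(z),d(z)$, with $[a(m),b(n)]=m\langle a,b\rangle\delta_{m+n,0}$. $\Pi(0)=M(1)\otimes\mathbb C[\mathbb Zc]$ and $\Pi^{1/2}(0)=M(1)\otimes\mathbb C[\mathbb Z\frac c2]$ are the lattice-type vertex algebras with the usual lattice vertex operators (trivial cocycle). *)

theory Defs
  imports Complex_Main "HOL-Library.Poly_Mapping"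
begin

section \<open>Vertex superalgebras\<close>

text \<open>
  \<open>nprod V a n b\<close> is the \<open>n\<close>-th product \<open>a\<^sub>(\<^sub>n\<^sub>) b\<close>, where
  \<open>Y(a,z) = \<Sum>\<^sub>n a\<^sub>(\<^sub>n\<^sub>) z\<^sup>-\<^sup>n\<^sup>-\<^sup>1\<close>.  \<open>part V False\<close> and \<open>part V True\<close> are the even and the odd
  part; parities are added with \<open>\<noteq>\<close>.  The underlying space is the whole type \<open>'v\<close>.
\<close>

record 'v vsa =
  scl :: "complex \<Rightarrow> 'v \<Rightarrow> 'v"
  vac :: 'v
  nprod :: "'v \<Rightarrow> int \<Rightarrow> 'v \<Rightarrow> 'v"
  part :: "bool \<Rightarrow> 'v set"

definition ksign :: "bool \<Rightarrow> bool \<Rightarrow> complex" where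
  "ksign p q = (if p \<and> q then - 1 else 1)"

text \<open>
  The Jacobi identity is stated in components (Borcherds identity).  By truncation both of its
  sides have only finitely many nonzero terms.  The translation operator is \<open>a \<mapsto> a\<^sub>(\<^sub>-\<^sub>2\<^sub>) vac\<close>.
\<close>

locale vertex_superalgebra = vector_space "scl V" for V :: "'v::ab_group_add vsa" +
  assumes part_subspace: "\<And>p. subspace (part V p)"
    and part_Int: "part V False \<inter> part V True = {0}"
    and part_sum: "\<And>v. \<exists>a \<in> part V False. \<exists>b \<in> part V True. v = a + b"
    and linear_right: "\<And>a n. Vector_Spaces.linear (scl V) (scl V) (nprod V a n)"
    and linear_left: "\<And>b n. Vector_Spaces.linear (scl V) (scl V) (\<lambda>a. nprod V a n b)"
    and parity: "\<And>a b n p q. a \<in> part V p \<Longrightarrow> b \<in> part V q \<Longrightarrow> nprod V a n b \<in> part V (p \<noteq> q)"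
    and vac_even: "vac V \<in> part V False"
    and vacuum: "\<And>a n. nprod V (vac V) n a = (if n = - 1 then a else 0)"
    and creation: "\<And>a. nprod V a (- 1) (vac V) = a"
      "\<And>a n. n \<ge> 0 \<Longrightarrow> nprod V a n (vac V) = 0"
    and truncation: "\<And>a b. \<exists>N. \<forall>n \<ge> N. nprod V a n b = 0"
    and borcherds: "\<And>a b c p q m n k. a \<in> part V p \<Longrightarrow> b \<in> part V q \<Longrightarrow>
      Sum_any (\<lambda>j::nat. scl V (of_int m gchoose j)
          (nprod V (nprod V a (n + int j) b) (m + k - int j) c)) =
      Sum_any (\<lambda>j::nat. scl V ((- 1) ^ j * (of_int n gchoose j))
          (nprod V a (m + n - int j) (nprod V b (k + int j) c)
           - scl V ((- 1) powi n * ksign p q)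
               (nprod V b (n + k - int j) (nprod V a (m + int j) c))))"

definition vsa_hom ::
    "'v::ab_group_add vsa \<Rightarrow> 'w::ab_group_add vsa \<Rightarrow> ('v \<Rightarrow> 'w) \<Rightarrow> bool" where
  "vsa_hom V W f \<longleftrightarrow>
     Vector_Spaces.linear (scl V) (scl W) f \<and>
     (\<forall>p. f ` part V p \<subseteq> part W p) \<and>
     f (vac V) = vac W \<and>
     (\<forall>a n b. f (nprod V a n b) = nprod W (f a) n (f b))"

text \<open>A homomorphism is trivial if its image lies in \<open>\<complex> vac\<close> (this includes the zero map).\<close>

definition nontrivial_hom :: "'w::ab_group_add vsa \<Rightarrow> ('v \<Rightarrow> 'w) \<Rightarrow> bool" where
  "nontrivial_hom W f \<longleftrightarrow> (\<exists>v. \<forall>z. f v \<noteq> scl W z (vac W))"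

text \<open>Ideals are two-sided and \<open>\<int>\<^sub>2\<close>-graded.\<close>

definition vsa_ideal :: "'v::ab_group_add vsa \<Rightarrow> 'v set \<Rightarrow> bool" where
  "vsa_ideal V I \<longleftrightarrow>
     module.subspace (scl V) I \<and>
     (\<forall>v \<in> I. \<exists>a \<in> I \<inter> part V False. \<exists>b \<in> I \<inter> part V True. v = a + b) \<and>
     (\<forall>a n. \<forall>b \<in> I. nprod V a n b \<in> I \<and> nprod V b n a \<in> I)"

definition simple_vsa :: "'v::ab_group_add vsa \<Rightarrow> bool" where
  "simple_vsa V \<longleftrightarrow> vertex_superalgebra V \<and> vac V \<noteq> 0 \<and>
     (\<forall>I. vsa_ideal V I \<longrightarrow> I = {0} \<or> I = UNIV)"

definition simple_quotient :: "'u::ab_group_add vsa \<Rightarrow> 'v::ab_group_add vsa \<Rightarrow> bool" where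
  "simple_quotient U V \<longleftrightarrow> simple_vsa V \<and> (\<exists>f. vsa_hom U V f \<and> surj f)"


section \<open>Spaces given by generators and relations\<close>

definition fscale :: "complex \<Rightarrow> ('i \<Rightarrow>\<^sub>0 complex) \<Rightarrow> 'i \<Rightarrow>\<^sub>0 complex" where
  "fscale z = Poly_Mapping.map ((*) z)"

lemma lookup_fscale: "Poly_Mapping.lookup (fscale z p) i = z * Poly_Mapping.lookup p i"
  by (simp add: fscale_def Poly_Mapping.map.rep_eq when_def)

interpretation free: vector_space fscale
  by unfold_locales
    (auto intro!: poly_mapping_eqI simp: lookup_fscale lookup_add algebra_simps)

definition lin_ext :: "(complex \<Rightarrow> 'v \<Rightarrow> 'v) \<Rightarrow> ('i \<Rightarrow> 'v) \<Rightarrow> ('i \<Rightarrow>\<^sub>0 complex) \<Rightarrow> 'v::ab_group_add"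
  where "lin_ext s f p = (\<Sum>i \<in> Poly_Mapping.keys p. s (Poly_Mapping.lookup p i) (f i))"

text \<open>The map \<open>f\<close> identifies the target with the free space on \<open>'i\<close> modulo the span of \<open>R\<close>.\<close>

definition presents ::
    "(complex \<Rightarrow> 'v \<Rightarrow> 'v) \<Rightarrow> ('i \<Rightarrow> 'v::ab_group_add) \<Rightarrow> ('i \<Rightarrow>\<^sub>0 complex) set \<Rightarrow> bool" where
  "presents s f R \<longleftrightarrow> surj (lin_ext s f) \<and> {p. lin_ext s f p = 0} = free.span R"


section \<open>Tensor products\<close>

definition tensor_relators ::
    "(complex \<Rightarrow> 'v \<Rightarrow> 'v) \<Rightarrow> (complex \<Rightarrow> 'w \<Rightarrow> 'w) \<Rightarrow>
     (('v::ab_group_add \<times> 'w::ab_group_add) \<Rightarrow>\<^sub>0 complex) set" where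
  "tensor_relators s t =
     {Poly_Mapping.single (a + a', b) 1 - Poly_Mapping.single (a, b) 1
        - Poly_Mapping.single (a', b) 1 | a a' b. True} \<union>
     {Poly_Mapping.single (a, b + b') 1 - Poly_Mapping.single (a, b) 1
        - Poly_Mapping.single (a, b') 1 | a b b'. True} \<union>
     {Poly_Mapping.single (s z a, b) 1 - Poly_Mapping.single (a, b) z | z a b. True} \<union>
     {Poly_Mapping.single (a, t z b) 1 - Poly_Mapping.single (a, b) z | z a b. True}"

text \<open>\<open>T\<close> is the tensor product \<open>V \<otimes> W\<close>, the elementary tensors being \<open>\<beta> a b\<close>.\<close>

definition tensor_vsa ::
    "'v::ab_group_add vsa \<Rightarrow> 'w::ab_group_add vsa \<Rightarrow> 't::ab_group_add vsa \<Rightarrow> bool" where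
  "tensor_vsa V W T \<longleftrightarrow> vertex_superalgebra T \<and>
     (\<exists>\<beta>. presents (scl T) (\<lambda>(a, b). \<beta> a b) (tensor_relators (scl V) (scl W)) \<and>
       vac T = \<beta> (vac V) (vac W) \<and>
       (\<forall>p q. \<forall>a \<in> part V p. \<forall>b \<in> part W q. \<beta> a b \<in> part T (p \<noteq> q)) \<and>
       (\<forall>p q n a b'. \<forall>b \<in> part W p. \<forall>a' \<in> part V q.
          nprod T (\<beta> a b) n (\<beta> a' b') =
          scl T (ksign p q)
            (Sum_any (\<lambda>i::int. \<beta> (nprod V a i a') (nprod W b (n - 1 - i) b')))))"


section \<open>Induced modules over Lie superalgebras of modes\<close>

text \<open>
  A mode \<open>(a, n)\<close> stands for \<open>a\<^sub>(\<^sub>n\<^sub>)\<close>, with \<open>a\<close> from a set of generating fields.  The super-bracket of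
  two modes is given by \<open>B\<close> as a combination of words of modes; the empty word carries the
  central term, the central element being already replaced by its value.

  The pair \<open>(w, j)\<close> stands for the word \<open>w\<close> applied to the \<open>j\<close>-th generating vector, on which the
  modes \<open>(a, n)\<close>, \<open>n \<ge> 0\<close>, act by the scalar \<open>\<chi> (a, n) j\<close>.  The relators present the direct sum
  over \<open>j\<close> of the modules induced from these characters.
\<close>

type_synonym 'g word = "('g \<times> int) list"

definition induced_relators ::
    "('g \<Rightarrow> bool) \<Rightarrow> ('g \<times> int \<Rightarrow> 'g \<times> int \<Rightarrow> 'g word \<Rightarrow>\<^sub>0 complex) \<Rightarrow>
     ('g \<times> int \<Rightarrow> 'j \<Rightarrow> complex) \<Rightarrow> (('g word \<times> 'j) \<Rightarrow>\<^sub>0 complex) set" where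
  "induced_relators par B \<chi> =
     {Poly_Mapping.single (u @ [x, y] @ v, j) 1
       - Poly_Mapping.single (u @ [y, x] @ v, j) (ksign (par (fst x)) (par (fst y)))
       - (\<Sum>w \<in> Poly_Mapping.keys (B x y).
            Poly_Mapping.single (u @ w @ v, j) (Poly_Mapping.lookup (B x y) w))
      | u x y v j. True} \<union>
     {Poly_Mapping.single (u @ [x], j) 1 - Poly_Mapping.single (u, j) (\<chi> x j)
      | u x j. snd x \<ge> 0}"

definition act :: "'v vsa \<Rightarrow> ('g \<Rightarrow> 'v) \<Rightarrow> 'g word \<Rightarrow> 'v \<Rightarrow> 'v" where
  "act V J w v = foldr (\<lambda>(a, n). nprod V (J a) n) w v"

text \<open>
  \<open>V\<close> is the vacuum module of the Lie superalgebra of modes, with its vertex superalgebra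
  structure \<open>Y(a\<^sub>(\<^sub>-\<^sub>1\<^sub>) vac, z) = \<Sum>\<^sub>n a\<^sub>(\<^sub>n\<^sub>) z\<^sup>-\<^sup>n\<^sup>-\<^sup>1\<close>; the state \<open>a\<^sub>(\<^sub>-\<^sub>1\<^sub>) vac\<close> is \<open>J a\<close>.
\<close>

definition vacuum_vsa ::
    "('g \<Rightarrow> bool) \<Rightarrow> ('g \<times> int \<Rightarrow> 'g \<times> int \<Rightarrow> 'g word \<Rightarrow>\<^sub>0 complex) \<Rightarrow>
     'v::ab_group_add vsa \<Rightarrow> bool" where
  "vacuum_vsa par B V \<longleftrightarrow> vertex_superalgebra V \<and>
     (\<exists>J. (\<forall>a. J a \<in> part V (par a)) \<and>
        presents (scl V) (\<lambda>(w, j::unit). act V J w (vac V)) (induced_relators par B (\<lambda>x j. 0)))"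


section \<open>Universal affine vertex superalgebras\<close>

text \<open>A Lie superalgebra with an invariant form, given on a homogeneous basis \<open>'g\<close>.\<close>

record 'g lie_super =
  odd_elt :: "'g \<Rightarrow> bool"
  bracket :: "'g \<Rightarrow> 'g \<Rightarrow> 'g \<Rightarrow>\<^sub>0 complex"
  form :: "'g \<Rightarrow> 'g \<Rightarrow> complex"

text \<open>\<open>[x(m), y(n)] = [x, y](m + n) + m (x, y) \<delta>\<^sub>m\<^sub>+\<^sub>n\<^sub>,\<^sub>0 k\<close>\<close>

fun affine_bracket ::
    "'g lie_super \<Rightarrow> complex \<Rightarrow> 'g \<times> int \<Rightarrow> 'g \<times> int \<Rightarrow> 'g word \<Rightarrow>\<^sub>0 complex" where
  "affine_bracket g k (x, m) (y, n) =
     (\<Sum>z \<in> Poly_Mapping.keys (bracket g x y).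
        Poly_Mapping.single [(z, m + n)] (Poly_Mapping.lookup (bracket g x y) z)) +
     Poly_Mapping.single [] (if m + n = 0 then of_int m * form g x y * k else 0)"

definition universal_affine ::
    "'g lie_super \<Rightarrow> complex \<Rightarrow> 'v::ab_group_add vsa \<Rightarrow> bool" where
  "universal_affine g k V \<longleftrightarrow> vacuum_vsa (odd_elt g) (affine_bracket g k) V"

datatype sl2_basis = sE | sF | sH

fun sl2_bracket :: "sl2_basis \<Rightarrow> sl2_basis \<Rightarrow> sl2_basis \<Rightarrow>\<^sub>0 complex" where
  "sl2_bracket sE sF = Poly_Mapping.single sH 1"
| "sl2_bracket sF sE = Poly_Mapping.single sH (- 1)"
| "sl2_bracket sH sE = Poly_Mapping.single sE 2"
| "sl2_bracket sE sH = Poly_Mapping.single sE (- 2)"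
| "sl2_bracket sH sF = Poly_Mapping.single sF (- 2)"
| "sl2_bracket sF sH = Poly_Mapping.single sF 2"
| "sl2_bracket _ _ = 0"

fun sl2_form :: "sl2_basis \<Rightarrow> sl2_basis \<Rightarrow> complex" where
  "sl2_form sE sF = 1"
| "sl2_form sF sE = 1"
| "sl2_form sH sH = 2"
| "sl2_form _ _ = 0"

definition sl2 :: "sl2_basis lie_super" where
  "sl2 = \<lparr>odd_elt = (\<lambda>_. False), bracket = sl2_bracket, form = sl2_form\<rparr>"

datatype osp_basis = oE | oF | oH | oX | oY

fun osp_odd :: "osp_basis \<Rightarrow> bool" where
  "osp_odd oX = True"
| "osp_odd oY = True"
| "osp_odd _ = False"

fun osp_bracket :: "osp_basis \<Rightarrow> osp_basis \<Rightarrow> osp_basis \<Rightarrow>\<^sub>0 complex" where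
  "osp_bracket oE oF = Poly_Mapping.single oH 1"
| "osp_bracket oF oE = Poly_Mapping.single oH (- 1)"
| "osp_bracket oH oE = Poly_Mapping.single oE 2"
| "osp_bracket oE oH = Poly_Mapping.single oE (- 2)"
| "osp_bracket oH oF = Poly_Mapping.single oF (- 2)"
| "osp_bracket oF oH = Poly_Mapping.single oF 2"
| "osp_bracket oH oX = Poly_Mapping.single oX 1"
| "osp_bracket oX oH = Poly_Mapping.single oX (- 1)"
| "osp_bracket oF oX = Poly_Mapping.single oY (- 1)"
| "osp_bracket oX oF = Poly_Mapping.single oY 1"
| "osp_bracket oH oY = Poly_Mapping.single oY (- 1)"
| "osp_bracket oY oH = Poly_Mapping.single oY 1"
| "osp_bracket oE oY = Poly_Mapping.single oX (- 1)"
| "osp_bracket oY oE = Poly_Mapping.single oX 1"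
| "osp_bracket oX oX = Poly_Mapping.single oE 2"
| "osp_bracket oX oY = Poly_Mapping.single oH 1"
| "osp_bracket oY oX = Poly_Mapping.single oH 1"
| "osp_bracket oY oY = Poly_Mapping.single oF (- 2)"
| "osp_bracket _ _ = 0"

fun osp_form :: "osp_basis \<Rightarrow> osp_basis \<Rightarrow> complex" where
  "osp_form oE oF = 1"
| "osp_form oF oE = 1"
| "osp_form oH oH = 2"
| "osp_form oX oY = 2"
| "osp_form oY oX = - 2"
| "osp_form _ _ = 0"

definition osp12 :: "osp_basis lie_super" where
  "osp12 = \<lparr>odd_elt = osp_odd, bracket = osp_bracket, form = osp_form\<rparr>"


section \<open>Universal Virasoro and Neveu-Schwarz vertex superalgebras\<close>

text \<open>
  \<open>L(n) = \<omega>\<^sub>(\<^sub>n\<^sub>+\<^sub>1\<^sub>)\<close>, so the annihilating modes \<open>\<omega>\<^sub>(\<^sub>n\<^sub>)\<close>, \<open>n \<ge> 0\<close>, are \<open>L(n)\<close>, \<open>n \<ge> -1\<close>.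
  The formula is \<open>[L(m), L(n)] = (m - n) L(m + n) + (m\<^sup>3 - m)/12 \<delta>\<^sub>m\<^sub>+\<^sub>n\<^sub>,\<^sub>0 c\<close>.
\<close>

definition L_bracket :: "'g \<Rightarrow> complex \<Rightarrow> int \<Rightarrow> int \<Rightarrow> 'g word \<Rightarrow>\<^sub>0 complex" where
  "L_bracket \<omega> c m n =
     Poly_Mapping.single [(\<omega>, m + n + 1)] (of_int (m - n)) +
     Poly_Mapping.single [] (if m + n = 0 then (of_int m ^ 3 - of_int m) / 12 * c else 0)"

fun virasoro_bracket :: "complex \<Rightarrow> unit \<times> int \<Rightarrow> unit \<times> int \<Rightarrow> unit word \<Rightarrow>\<^sub>0 complex" where
  "virasoro_bracket c (\<omega>, m) (\<omega>', n) = L_bracket \<omega> c (m - 1) (n - 1)"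

definition universal_virasoro :: "complex \<Rightarrow> 'v::ab_group_add vsa \<Rightarrow> bool" where
  "universal_virasoro c V \<longleftrightarrow> vacuum_vsa (\<lambda>_. False) (virasoro_bracket c) V"

datatype ns_field = Omega | Tau

fun ns_odd :: "ns_field \<Rightarrow> bool" where
  "ns_odd Omega = False"
| "ns_odd Tau = True"

text \<open>
  \<open>G(r) = \<tau>\<^sub>(\<^sub>r\<^sub>+\<^sub>1\<^sub>/\<^sub>2\<^sub>)\<close>, i.e. \<open>G(z) = \<Sum>\<^sub>r G(r) z\<^sup>-\<^sup>r\<^sup>-\<^sup>3\<^sup>/\<^sup>2\<close>.  The formulas are
  \<open>[L(m), G(r)] = (m/2 - r) G(m + r)\<close> and
  \<open>{G(r), G(s)} = 2 L(r + s) + c/3 (r\<^sup>2 - 1/4) \<delta>\<^sub>r\<^sub>+\<^sub>s\<^sub>,\<^sub>0\<close>,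
  applied to \<open>L(m - 1)\<close>, \<open>L(n - 1)\<close>, \<open>G(m - 1/2)\<close>, \<open>G(n - 1/2)\<close>.
\<close>

fun ns_bracket ::
    "complex \<Rightarrow> ns_field \<times> int \<Rightarrow> ns_field \<times> int \<Rightarrow> ns_field word \<Rightarrow>\<^sub>0 complex" where
  "ns_bracket c (Omega, m) (Omega, n) = L_bracket Omega c (m - 1) (n - 1)"
| "ns_bracket c (Omega, m) (Tau, n) =
     Poly_Mapping.single [(Tau, m + n - 1)] ((of_int m - 1) / 2 - (of_int n - 1 / 2))"
| "ns_bracket c (Tau, m) (Omega, n) =
     Poly_Mapping.single [(Tau, m + n - 1)] (- ((of_int n - 1) / 2 - (of_int m - 1 / 2)))"
| "ns_bracket c (Tau, m) (Tau, n) =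
     Poly_Mapping.single [(Omega, m + n)] 2 +
     Poly_Mapping.single [] (if m + n = 1 then c / 3 * ((of_int m - 1 / 2) ^ 2 - 1 / 4) else 0)"

definition universal_ns :: "complex \<Rightarrow> 'v::ab_group_add vsa \<Rightarrow> bool" where
  "universal_ns c V \<longleftrightarrow> vacuum_vsa ns_odd (ns_bracket c) V"


section \<open>The fermionic vertex superalgebra\<close>

text \<open>The mode \<open>\<Psi>\<^sub>(\<^sub>m\<^sub>)\<close> is \<open>\<Psi>(m + 1/2)\<close>.\<close>

fun fermion_bracket :: "unit \<times> int \<Rightarrow> unit \<times> int \<Rightarrow> unit word \<Rightarrow>\<^sub>0 complex" where
  "fermion_bracket (_, m) (_, n) = Poly_Mapping.single [] (if m + n + 1 = 0 then 1 else 0)"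

definition fermion_vsa :: "'v::ab_group_add vsa \<Rightarrow> bool" where
  "fermion_vsa V \<longleftrightarrow> vacuum_vsa (\<lambda>_. True) fermion_bracket V"


section \<open>The lattice-type vertex algebras\<close>

datatype heis = hC | hD

fun heis_form :: "heis \<Rightarrow> heis \<Rightarrow> complex" where
  "heis_form hC hC = 0"
| "heis_form hC hD = 2"
| "heis_form hD hC = 2"
| "heis_form hD hD = 0"

fun heis_bracket :: "heis \<times> int \<Rightarrow> heis \<times> int \<Rightarrow> heis word \<Rightarrow>\<^sub>0 complex" where
  "heis_bracket (a, m) (b, n) =
     Poly_Mapping.single [] (if m + n = 0 then of_int m * heis_form a b else 0)"

text \<open>
  \<open>exp_coeff s A r\<close> is the coefficient of \<open>z\<^sup>r\<close> in \<open>exp (\<Sum>\<^sub>i\<^sub>\<ge>\<^sub>1 A i z\<^sup>i / i)\<close> for commuting operators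
  \<open>A i\<close>.  The recursion results from applying \<open>z d/dz\<close> to the exponential.
\<close>

fun exp_coeff ::
    "(complex \<Rightarrow> 'v \<Rightarrow> 'v) \<Rightarrow> (nat \<Rightarrow> 'v \<Rightarrow> 'v) \<Rightarrow> nat \<Rightarrow> 'v::ab_group_add \<Rightarrow> 'v" where
  "exp_coeff s A 0 v = v"
| "exp_coeff s A (Suc r) v =
     s (1 / of_nat (Suc r)) (\<Sum>i \<le> r. A (Suc i) (exp_coeff s A (r - i) v))"

text \<open>
  \<open>lattice_type_va t P\<close> says that \<open>P = M(1) \<otimes> \<complex>[\<int>\<gamma>]\<close> with \<open>\<gamma> = t c\<close>.  The vector \<open>1 \<otimes> e\<^sup>j\<^sup>\<gamma>\<close> is \<open>e j\<close>;
  as a module over the Heisenberg algebra the space is the direct sum of the Fock modules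
  generated by the \<open>e j\<close>, on which \<open>a(0)\<close> acts by \<open>\<langle>a, j\<gamma>\<rangle>\<close> and \<open>a(n)\<close>, \<open>n > 0\<close>, by zero.
  The last clause is the vertex operator, with \<open>\<alpha> = j\<gamma>\<close>,
  \<open>Y(e\<^sup>\<alpha>, z) = e\<^sup>\<alpha> exp (\<Sum>\<^sub>i\<^sub>\<ge>\<^sub>1 \<alpha>(-i) z\<^sup>i / i) exp (- \<Sum>\<^sub>i\<^sub>\<ge>\<^sub>1 \<alpha>(i) z\<^sup>-\<^sup>i / i) z\<^sup>\<alpha>\<^sup>(\<^sup>0\<^sup>)\<close>
  on the spanning vectors \<open>a\<^sub>1(-n\<^sub>1) \<dots> a\<^sub>r(-n\<^sub>r) e\<^sup>j\<^sup>'\<^sup>\<gamma>\<close>.  The factor \<open>z\<^sup>\<alpha>\<^sup>(\<^sup>0\<^sup>)\<close> is \<open>1\<close> since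
  \<open>\<langle>c, c\<rangle> = 0\<close>, and the shift \<open>e\<^sup>\<alpha>\<close>, which commutes with all \<open>c(i)\<close>, is applied first.
\<close>

definition lattice_type_va :: "complex \<Rightarrow> 'v::ab_group_add vsa \<Rightarrow> bool" where
  "lattice_type_va t P \<longleftrightarrow> vertex_superalgebra P \<and> part P True = {0} \<and>
     (\<exists>J e. vac P = e (0::int) \<and>
       presents (scl P) (\<lambda>(w, j). act P J w (e j))
         (induced_relators (\<lambda>_. False) heis_bracket
            (\<lambda>(a, n) j. if n = 0 then of_int j * t * heis_form a hC else 0)) \<and>
       (\<forall>j j' w n. (\<forall>x \<in> set w. snd x < 0) \<longrightarrow>
          nprod P (e j) n (act P J w (e j')) =
          Sum_any (\<lambda>s::nat. if n + 1 \<le> int s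
            then exp_coeff (scl P)
                   (\<lambda>i v. scl P (of_int j * t) (nprod P (J hC) (- int i) v)) (nat (int s - n - 1))
                   (exp_coeff (scl P)
                     (\<lambda>i v. scl P (- (of_int j * t)) (nprod P (J hC) (int i) v)) s
                     (act P J w (e (j + j'))))
            else 0)))"

abbreviation Pi0 :: "'v::ab_group_add vsa \<Rightarrow> bool" where
  "Pi0 \<equiv> lattice_type_va 1"

abbreviation Pi_half0 :: "'v::ab_group_add vsa \<Rightarrow> bool" where
  "Pi_half0 \<equiv> lattice_type_va (1 / 2)"


section \<open>Central charges\<close>

definition d_charge :: "int \<Rightarrow> int \<Rightarrow> complex" where
  "d_charge p p' = 1 - 6 * (of_int p - of_int p')\<^sup>2 / (of_int p * of_int p')"

definition c_charge :: "int \<Rightarrow> int \<Rightarrow> complex" where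
  "c_charge p q = 3 / 2 - 3 * (of_int p - of_int q)\<^sup>2 / (of_int p * of_int q)"

end

theory Submission
  imports Defs "HOL-Library.Multiset"
begin

text \<open>
  Both maps are free field realizations.  For \<open>sl(2)\<close> one puts \<open>e \<mapsto> e\<^sup>c\<close>, \<open>h \<mapsto> d + (k/2) c\<close> and
  \<open>f \<mapsto> ((k + 2) \<omega> - \<nu>(-1)\<^sup>2 - (k + 1) \<nu>(-2)) e\<^sup>-\<^sup>c\<close>; for \<open>osp(1,2)\<close>, with \<open>\<gamma> = c/2\<close> and
  \<open>A\<^sup>2 = -(2k + 3)\<close>, one puts \<open>x \<mapsto> \<Psi> \<otimes> e\<^sup>\<gamma>\<close> and
  \<open>y \<mapsto> (A \<tau> + \<Psi> \<nu>(-1) + (2k + 1) \<Psi>') \<otimes> e\<^sup>-\<^sup>\<gamma>\<close>.  These define homomorphisms from the universal affine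
  vertex superalgebra, which factor through the simple quotient because their images contain no
  singular vectors other than multiples of the vacuum.  Indeed, a vector annihilated by the
  nonnegative modes of \<open>e\<close> (or \<open>x\<close>) and by the positive ones of \<open>h\<close> has the form \<open>v \<otimes> e\<^sup>r\<^sup>\<gamma>\<close>.  The positive
  modes of \<open>f\<close> (or \<open>y\<close>) make \<open>v\<close> singular for the Virasoro or Neveu-Schwarz algebra, so \<open>v\<close> is a
  multiple of the vacuum by simplicity, and one more relation leaves \<open>r = 0\<close> besides \<open>r = k + 1\<close> or
  \<open>r = 2k + 2\<close>.  The latter values are excluded by the arithmetic of \<open>k\<close>, for \<open>osp(1,2)\<close> together with
  the evenness of \<open>r\<close>, which follows from parity.  Explicit singular vectors of the universal affine
  algebra are never needed.
\<close>

section \<open>Calculus of modes\<close>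

text \<open>The algebras are known only through axioms and presentations, and this shapes the proof.
  A presentation forces vectors to vanish but does not show that others survive: that
  \<open>e j\<close> and the fermionic vacuum are nonzero needs concrete Fock modules, and that
  elementary tensors are nonzero needs functionals. Moreover the lattice factor contains vectors of
  weight 0 in every charge, so extremal vectors are chosen in the universal affine algebra, where
  the charge is at most twice the degree.

  The formulas for \<open>f\<close> and \<open>y\<close> invert quantum Drinfeld-Sokolov reduction.
  In terms of the level the central charges are 1 - 6 (k+1)^2 / (k+2) and 3/2 - 3 (2k+2)^2 / (2k+3);
  they are exactly the values for which the leading coefficient of the product of \<open>f\<close>,
  or of \<open>y\<close>, with itself vanishes. For sl(2) the remaining products of \<open>f\<close>
  with itself then vanish by skew symmetry and a weight argument. For osp(1,2) the products of
  \<open>f\<close> with \<open>y\<close> remain, and only one component of one of them has to be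
  computed.\<close>

lemma ksign_simps [simp]: "ksign False q = 1" "ksign p False = 1" "ksign True True = - 1"
  by (auto simp: ksign_def)

lemma ksign_square [simp]: "ksign p q * ksign p q = 1"
  by (auto simp: ksign_def)

lemma gchoose_minus_one: "(- 1 :: complex) gchoose j = (- 1) ^ j"
proof -
  have "(of_nat j :: complex) gchoose j = 1"
    by (metis binomial_gbinomial binomial_n_n of_nat_1)
  then show ?thesis
    using gbinomial_minus[of "1::complex" j] by simp
qed

lemma gchoose_minus_two: "(- 2 :: complex) gchoose j = (- 1) ^ j * of_nat (j + 1)"
proof -
  have "(of_nat (j + 1) :: complex) gchoose j = of_nat (Suc j choose j)"
    by (metis Suc_eq_plus1 binomial_gbinomial)
  then show ?thesis
    using gbinomial_minus[of "2::complex" j] by (simp add: add.commute)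
qed

context vertex_superalgebra
begin

lemma nprod_right [simp]:
  shows nprod_add_right: "nprod V a n (b + c) = nprod V a n b + nprod V a n c"
    and nprod_scale_right: "nprod V a n (scl V z b) = scl V z (nprod V a n b)"
  using linear_right[of a n] by (auto simp: Vector_Spaces.linear_iff)

lemma nprod_left [simp]:
  shows nprod_add_left: "nprod V (a + b) n c = nprod V a n c + nprod V b n c"
    and nprod_scale_left: "nprod V (scl V z a) n c = scl V z (nprod V a n c)"
  using linear_left[of n c] by (auto simp: Vector_Spaces.linear_iff)

lemma nprod_zero [simp]: "nprod V a n 0 = 0" "nprod V 0 n c = 0"
  using nprod_scale_right[of a n 0 0] nprod_scale_left[of 0 0 n c] by auto

lemma nprod_minus [simp]: "nprod V a n (- b) = - nprod V a n b" "nprod V (- a) n b = - nprod V a n b"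
  using nprod_scale_right[of a n "- 1" b] nprod_scale_left[of "- 1" a n b] by auto

lemma nprod_diff [simp]:
  "nprod V a n (b - c) = nprod V a n b - nprod V a n c"
  "nprod V (a - b) n c = nprod V a n c - nprod V b n c"
  using nprod_add_right[of a n b "- c"] nprod_add_left[of a "- b" n c] by auto

lemma nprod_sum_right: "nprod V a n (sum g A) = (\<Sum>i\<in>A. nprod V a n (g i))"
  by (induction A rule: infinite_finite_induct) auto

lemma nprod_sum_left: "nprod V (sum g A) n b = (\<Sum>i\<in>A. nprod V (g i) n b)"
  by (induction A rule: infinite_finite_induct) auto

lemma part_closed [simp]:
  "a \<in> part V p \<Longrightarrow> b \<in> part V p \<Longrightarrow> a + b \<in> part V p"
  "a \<in> part V p \<Longrightarrow> b \<in> part V p \<Longrightarrow> a - b \<in> part V p"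
  "a \<in> part V p \<Longrightarrow> - a \<in> part V p"
  "a \<in> part V p \<Longrightarrow> scl V z a \<in> part V p"
  "0 \<in> part V p"
  using part_subspace[of p]
  by (auto intro: subspace_add subspace_diff subspace_neg subspace_scale subspace_0)

lemma parity_even: "a \<in> part V False \<Longrightarrow> b \<in> part V p \<Longrightarrow> nprod V a n b \<in> part V p"
  using parity[of a False b p n] by simp

lemma parity_odd: "a \<in> part V True \<Longrightarrow> b \<in> part V p \<Longrightarrow> nprod V a n b \<in> part V (\<not> p)"
  using parity[of a True b p n] by simp

lemma truncation_nat: "\<exists>N::nat. \<forall>j \<ge> N. nprod V a (int j + k) b = 0"
proof -
  obtain M where M: "\<forall>n \<ge> M. nprod V a n b = 0" using truncation by blast
  show ?thesis by (rule exI[of _ "nat (M - k)"]) (use M in auto)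
qed

lemma Sum_any_lessThan:
  fixes g :: "nat \<Rightarrow> 'z::comm_monoid_add"
  assumes "\<And>j. j \<ge> N \<Longrightarrow> g j = 0"
  shows "Sum_any g = (\<Sum>j<N. g j)"
  by (rule Sum_any.expand_superset) (use assms not_less in auto)

text \<open>Borcherds identity at \<open>n = 0\<close>, where \<open>0 gchoose j\<close> leaves only
  \<open>j = 0\<close> on the right. The explicit bound \<open>N\<close> lets concrete operator
  products be evaluated as short finite sums.\<close>

lemma commutator:
  assumes "a \<in> part V p" "b \<in> part V q" and N: "\<And>j. j \<ge> N \<Longrightarrow> nprod V a (int j) b = 0"
  shows "nprod V a m (nprod V b k c) =
     scl V (ksign p q) (nprod V b k (nprod V a m c)) +
     (\<Sum>j<N. scl V (of_int m gchoose j) (nprod V (nprod V a (int j) b) (m + k - int j) c))"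
proof -
  have "Sum_any (\<lambda>j::nat. scl V (of_int m gchoose j)
          (nprod V (nprod V a (0 + int j) b) (m + k - int j) c)) =
      (\<Sum>j<N. scl V (of_int m gchoose j) (nprod V (nprod V a (int j) b) (m + k - int j) c))"
    by (subst Sum_any_lessThan[of N]) (use N in auto)
  moreover have "Sum_any (\<lambda>j::nat. scl V ((- 1) ^ j * (of_int 0 gchoose j))
          (nprod V a (m + 0 - int j) (nprod V b (k + int j) c)
           - scl V ((- 1) powi 0 * ksign p q)
               (nprod V b (0 + k - int j) (nprod V a (m + int j) c)))) =
       nprod V a m (nprod V b k c) - scl V (ksign p q) (nprod V b k (nprod V a m c))"
    by (subst Sum_any_lessThan[of 1]) (auto simp: gbinomial_0_left)
  ultimately show ?thesis
    using borcherds[OF assms(1,2), of m 0 k c] by (simp add: algebra_simps)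
qed

lemma supercommute:
  assumes "a \<in> part V p" "b \<in> part V q" and "\<And>j. j \<ge> 0 \<Longrightarrow> nprod V a j b = 0"
  shows "nprod V a m (nprod V b k c) = scl V (ksign p q) (nprod V b k (nprod V a m c))"
  using commutator[of a p b q 0 m k c] assms by simp

text \<open>Borcherds identity at \<open>m = 0\<close>. It expresses modes of a composite state by
  modes of its factors, so properties of generators propagate to all states.\<close>

lemma iterate:
  assumes "a \<in> part V p" "b \<in> part V q"
    and "\<And>j. j \<ge> N \<Longrightarrow> nprod V a (int j) c = 0" "\<And>j. j \<ge> N \<Longrightarrow> nprod V b (k + int j) c = 0"
  shows "nprod V (nprod V a n b) k c =
     (\<Sum>j<N. scl V ((- 1) ^ j * (of_int n gchoose j))
          (nprod V a (n - int j) (nprod V b (k + int j) c)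
           - scl V ((- 1) powi n * ksign p q) (nprod V b (n + k - int j) (nprod V a (int j) c))))"
proof -
  have "Sum_any (\<lambda>j::nat. scl V (of_int 0 gchoose j)
          (nprod V (nprod V a (n + int j) b) (0 + k - int j) c)) = nprod V (nprod V a n b) k c"
    by (subst Sum_any_lessThan[of 1]) (auto simp: gbinomial_0_left)
  moreover have "Sum_any (\<lambda>j::nat. scl V ((- 1) ^ j * (of_int n gchoose j))
          (nprod V a (0 + n - int j) (nprod V b (k + int j) c)
           - scl V ((- 1) powi n * ksign p q)
               (nprod V b (n + k - int j) (nprod V a (0 + int j) c)))) =
       (\<Sum>j<N. scl V ((- 1) ^ j * (of_int n gchoose j))
          (nprod V a (n - int j) (nprod V b (k + int j) c)
           - scl V ((- 1) powi n * ksign p q) (nprod V b (n + k - int j) (nprod V a (int j) c))))"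
    by (subst Sum_any_lessThan[of N]) (use assms in auto)
  ultimately show ?thesis
    using borcherds[OF assms(1,2), of 0 n k c] by simp
qed

text \<open>At \<open>n = -1\<close> the sign \<open>(-1)^j\<close> cancels against the binomial
  coefficient, and the sign \<open>(-1) powi n\<close> turns the difference into a sum.\<close>

lemma normal_product:
  assumes "a \<in> part V p" "b \<in> part V q"
    and "\<And>j. j \<ge> N \<Longrightarrow> nprod V a (int j) c = 0" "\<And>j. j \<ge> N \<Longrightarrow> nprod V b (k + int j) c = 0"
  shows "nprod V (nprod V a (- 1) b) k c =
     (\<Sum>j<N. nprod V a (- 1 - int j) (nprod V b (k + int j) c)
           + scl V (ksign p q) (nprod V b (k - 1 - int j) (nprod V a (int j) c)))"
  by (subst iterate[OF assms]; simp?)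
    (auto intro!: sum.cong simp: gchoose_minus_one algebra_simps simp flip: power_mult_distrib)

lemma normal_product_deriv:
  assumes "a \<in> part V p" "b \<in> part V q"
    and "\<And>j. j \<ge> N \<Longrightarrow> nprod V a (int j) c = 0" "\<And>j. j \<ge> N \<Longrightarrow> nprod V b (k + int j) c = 0"
  shows "nprod V (nprod V a (- 2) b) k c =
     (\<Sum>j<N. scl V (of_nat (j + 1)) (nprod V a (- 2 - int j) (nprod V b (k + int j) c)
           - scl V (ksign p q) (nprod V b (k - 2 - int j) (nprod V a (int j) c))))"
proof -
  have *: "(- 1) ^ j * ((- 2 :: complex) gchoose j) = of_nat (j + 1)" for j
    by (simp only: gchoose_minus_two mult.assoc[symmetric] power_mult_distrib[symmetric]) simp
  show ?thesis
    by (subst iterate[OF assms]; simp?)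
      (auto intro!: sum.cong simp: * algebra_simps)
qed

lemma translate_mode: "nprod V (nprod V a (- 2) (vac V)) n c = scl V (- of_int n) (nprod V a (n - 1) c)"
proof -
  have hom: "nprod V (nprod V a (- 2) (vac V)) n c = scl V (- of_int n) (nprod V a (n - 1) c)"
    if a: "a \<in> part V p" for p a
  proof -
    obtain N0 where N0: "\<forall>j \<ge> N0. nprod V a (int j + 0) c = 0" using truncation_nat by blast
    \<comment> \<open>The bound has to exceed both \<open>-1 - n\<close> and \<open>n - 1\<close>,
      the indices at which a mode of the vacuum is the identity.\<close>
    define N where "N = N0 + nat \<bar>n\<bar> + 1"
    have "nprod V (nprod V a (- 2) (vac V)) n c =
       (\<Sum>j<N. scl V (of_nat (j + 1)) (nprod V a (- 2 - int j) (nprod V (vac V) (n + int j) c)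
           - scl V (ksign p False) (nprod V (vac V) (n - 2 - int j) (nprod V a (int j) c))))"
      by (rule normal_product_deriv[OF a vac_even]) (use N0 in \<open>auto simp: N_def vacuum\<close>)
    \<comment> \<open>A mode of the vacuum is nonzero only at index -1. This selects
      \<open>j = -1 - n\<close> in the first product if \<open>n < 0\<close>,
      \<open>j = n - 1\<close> in the second if \<open>n > 0\<close>, and nothing if
      \<open>n = 0\<close>.\<close>
    also have "\<dots> = (\<Sum>j<N. (if j = nat (- 1 - n) then (if n < 0 then scl V (- of_int n) (nprod V a (n - 1) c) else 0) else 0)
        + (if j = nat (n - 1) then (if n > 0 then scl V (- of_int n) (nprod V a (n - 1) c) else 0) else 0))"
    proof (rule sum.cong)
      fix j :: nat assume "j \<in> {..<N}"
      show "scl V (of_nat (j + 1)) (nprod V a (- 2 - int j) (nprod V (vac V) (n + int j) c)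
           - scl V (ksign p False) (nprod V (vac V) (n - 2 - int j) (nprod V a (int j) c))) =
         (if j = nat (- 1 - n) then (if n < 0 then scl V (- of_int n) (nprod V a (n - 1) c) else 0) else 0)
        + (if j = nat (n - 1) then (if n > 0 then scl V (- of_int n) (nprod V a (n - 1) c) else 0) else 0)"
      proof (cases "n < 0")
        case True
        then show ?thesis
        proof (cases "j = nat (- 1 - n)")
          case True
          then have "n = - 1 - int j" using \<open>n < 0\<close> by simp
          then show ?thesis by (auto simp: vacuum)
        next
          case False
          then have "n + int j \<noteq> - 1" "n - 2 - int j \<noteq> - 1" using \<open>n < 0\<close> by auto
          then show ?thesis using False \<open>n < 0\<close> by (auto simp: vacuum)
        qed
      next
        case nonneg: False
        show ?thesis
        proof (cases "n > 0 \<and> j = nat (n - 1)")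
          case True
          then have "n = 1 + int j" by simp
          then show ?thesis by (auto simp: vacuum scale_minus_left[symmetric] simp del: scale_minus_left)
        next
          case False
          then have "n + int j \<noteq> - 1" "n - 2 - int j \<noteq> - 1" using nonneg by auto
          then show ?thesis using False nonneg by (auto simp: vacuum)
        qed
      qed
    qed simp
    also have "\<dots> = scl V (- of_int n) (nprod V a (n - 1) c)"
      by (cases n "0::int" rule: linorder_cases) (auto simp: sum.distrib N_def)
    finally show ?thesis .
  qed
  obtain a0 a1 where "a = a0 + a1" "a0 \<in> part V False" "a1 \<in> part V True" using part_sum by blast
  then show ?thesis using hom[of a0] hom[of a1] by (simp add: scale_right_distrib)
qed

text \<open>Translation is a derivation of every product; the term \<open>(T a)_(n) b\<close>
  appears already evaluated as \<open>- n a_(n-1) b\<close>. The sum stops at \<open>j = 1\<close>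
  because \<open>b_(-2+j) vac\<close> vanishes from \<open>j = 2\<close> on.\<close>

lemma translate_nprod:
  "nprod V (nprod V a n b) (- 2) (vac V) =
     nprod V a n (nprod V b (- 2) (vac V)) - scl V (of_int n) (nprod V a (n - 1) b)"
proof -
  have hom: "nprod V (nprod V a n b) (- 2) (vac V) =
     nprod V a n (nprod V b (- 2) (vac V)) - scl V (of_int n) (nprod V a (n - 1) b)"
    if a: "a \<in> part V p" and b: "b \<in> part V q" for p q a b
    using iterate[OF a b, where N = 2 and c = "vac V" and k = "- 2" and n = n]
    by (auto simp: creation numeral_2_eq_2 lessThan_Suc translate_mode algebra_simps)
  obtain a0 a1 where a: "a = a0 + a1" "a0 \<in> part V False" "a1 \<in> part V True" using part_sum by blast
  obtain b0 b1 where b: "b = b0 + b1" "b0 \<in> part V False" "b1 \<in> part V True" using part_sum by blast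
  show ?thesis
    by (simp add: a(1) b(1) hom[OF a(2) b(2)] hom[OF a(2) b(3)] hom[OF a(3) b(2)] hom[OF a(3) b(3)]
        scale_right_distrib)
qed

lemma translate_vac [simp]: "nprod V (vac V) (- 2) (vac V) = 0"
  by (simp add: vacuum)

text \<open>Borcherds identity at \<open>m = -1\<close>, \<open>k = 0\<close>,
  \<open>c = vac\<close>: creation kills all \<open>b_(j) vac\<close> with \<open>j \<ge> 0\<close>
  and leaves \<open>a_(-1+j) vac\<close> only for \<open>j = 0\<close>. The vector
  \<open>u_(-1-j) vac\<close> stands for \<open>T^j u / j!\<close>.\<close>

lemma skew:
  assumes a: "a \<in> part V p" and b: "b \<in> part V q" and N: "\<And>j. j \<ge> N \<Longrightarrow> nprod V a (n + int j) b = 0"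
  shows "nprod V b n a = scl V (- ((- 1) powi n * ksign p q))
     (\<Sum>j<N. scl V ((- 1) ^ j) (nprod V (nprod V a (n + int j) b) (- 1 - int j) (vac V)))"
proof -
  have "Sum_any (\<lambda>j::nat. scl V (of_int (- 1) gchoose j)
          (nprod V (nprod V a (n + int j) b) (- 1 + 0 - int j) (vac V))) =
     (\<Sum>j<N. scl V ((- 1) ^ j) (nprod V (nprod V a (n + int j) b) (- 1 - int j) (vac V)))"
    by (subst Sum_any_lessThan[of N]) (use N in \<open>auto simp: gchoose_minus_one\<close>)
  moreover have "Sum_any (\<lambda>j::nat. scl V ((- 1) ^ j * (of_int n gchoose j))
          (nprod V a (- 1 + n - int j) (nprod V b (0 + int j) (vac V))
           - scl V ((- 1) powi n * ksign p q)
               (nprod V b (n + 0 - int j) (nprod V a (- 1 + int j) (vac V))))) =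
     - scl V ((- 1) powi n * ksign p q) (nprod V b n a)"
    by (subst Sum_any_lessThan[of 1]) (auto simp: creation)
  ultimately have "scl V ((- 1) powi n * ksign p q) (nprod V b n a) =
     - (\<Sum>j<N. scl V ((- 1) ^ j) (nprod V (nprod V a (n + int j) b) (- 1 - int j) (vac V)))"
    using borcherds[OF a b, of "- 1" n 0 "vac V"] by simp
  then have "scl V ((- 1) powi n * ksign p q) (scl V ((- 1) powi n * ksign p q) (nprod V b n a)) =
     scl V (- ((- 1) powi n * ksign p q)) (\<Sum>j<N. scl V ((- 1) ^ j) (nprod V (nprod V a (n + int j) b) (- 1 - int j) (vac V)))"
    by simp
  moreover have "((- 1) powi n * ksign p q) * ((- 1) powi n * ksign p q) = 1"
    by (auto simp: ksign_def power_int_minus_left)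
  ultimately show ?thesis by simp
qed

lemma translate_power: "nprod V u (- 2 - int j) (vac V) =
  scl V (1 / of_nat (Suc j)) (nprod V (nprod V u (- 1 - int j) (vac V)) (- 2) (vac V))"
proof -
  have "nprod V (nprod V u (- 1 - int j) (vac V)) (- 2) (vac V) =
    scl V (of_nat (Suc j)) (nprod V u (- 2 - int j) (vac V))"
    by (subst translate_nprod) (simp add: scale_minus_left[symmetric] del: scale_minus_left)
  then show ?thesis by (simp del: of_nat_Suc)
qed

end

section \<open>Gradings by modes and decomposition into eigenvectors\<close>

context vertex_superalgebra
begin

lemma zero_mode:
  assumes h: "h \<in> part V False" and a: "a \<in> part V p"
  shows "nprod V h 0 (nprod V a n b) = nprod V a n (nprod V h 0 b) + nprod V (nprod V h 0 a) n b"
proof -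
  obtain N where N: "\<forall>j \<ge> N. nprod V h (int j + 0) a = 0" using truncation_nat by blast
  show ?thesis
    using commutator[OF h a, where N = "Suc N" and m = 0 and k = n and c = b] N
    by (simp add: gbinomial_0_left sum.lessThan_Suc_shift del: sum.lessThan_Suc)
qed

lemma one_mode:
  assumes h: "h \<in> part V False" and a: "a \<in> part V p"
  shows "nprod V h 1 (nprod V a n b) =
    nprod V a n (nprod V h 1 b) + nprod V (nprod V h 0 a) (n + 1) b + nprod V (nprod V h 1 a) n b"
proof -
  obtain N where N: "\<forall>j \<ge> N. nprod V h (int j + 0) a = 0" using truncation_nat by blast
  have "(1::complex) gchoose (Suc (Suc j)) = 0" for j
    by (metis binomial_gbinomial binomial_eq_0_iff of_nat_0 of_nat_1 Suc_less_eq zero_less_Suc One_nat_def)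
  then show ?thesis
    using commutator[OF h a, where N = "Suc (Suc N)" and m = 1 and k = n and c = b] N
    by (simp add: sum.lessThan_Suc_shift del: sum.lessThan_Suc) (simp add: add.commute)
qed

text \<open>The conditions concern the single field \<open>a\<close>, so conformal vectors of one
  tensor factor qualify; \<open>h_(1)\<close> then acts like \<open>L(0)\<close> on the modes of
  \<open>a\<close>.\<close>

lemma grading:
  assumes h: "h \<in> part V False" and a: "a \<in> part V p"
    and "nprod V h 0 a = nprod V a (- 2) (vac V)" "nprod V h 1 a = scl V \<Delta> a"
  shows "nprod V h 1 (nprod V a n b) = nprod V a n (nprod V h 1 b) + scl V (\<Delta> - of_int n - 1) (nprod V a n b)"
  by (simp add: one_mode[OF h a] assms translate_mode algebra_simps)

text \<open>Applying \<open>w_(n) - m\<close> removes one component and multiplies each other one by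
  a nonzero difference of eigenvalues, which gives the induction.\<close>

lemma eigen_components:
  assumes I: "subspace I" "\<And>x. x \<in> I \<Longrightarrow> nprod V w n x \<in> I" and "finite M"
    and "\<And>m. m \<in> M \<Longrightarrow> nprod V w n (v m) = scl V m (v m)" and "(\<Sum>m\<in>M. v m) \<in> I"
  shows "\<forall>m \<in> M. v m \<in> I"
  using assms(3-5)
proof (induction M arbitrary: v rule: finite_induct)
  case (insert m M)
  let ?s = "v m + (\<Sum>m'\<in>M. v m')"
  have "?s \<in> I" using insert by simp
  then have "nprod V w n ?s - scl V m ?s \<in> I"
    using I by (simp only: subspace_diff subspace_scale)
  also have "nprod V w n ?s - scl V m ?s = (\<Sum>m'\<in>M. nprod V w n (v m') - scl V m (v m'))"
    using insert.prems by (simp add: nprod_sum_right sum_subtractf scale_right_distrib scale_sum_right)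
  also have "\<dots> = (\<Sum>m'\<in>M. scl V (m' - m) (v m'))"
    using insert.prems by (intro sum.cong) (auto simp: algebra_simps)
  finally have "\<forall>m'\<in>M. scl V (m' - m) (v m') \<in> I"
    using insert.prems by (intro insert.IH) (auto simp: mult.commute)
  then have *: "v m' \<in> I" if "m' \<in> M" for m'
  proof -
    have "scl V (1 / (m' - m)) (scl V (m' - m) (v m')) \<in> I"
      using \<open>\<forall>m'\<in>M. _\<close> that subspace_scale[OF I(1)] by blast
    moreover have "m' - m \<noteq> 0" using insert.hyps that by auto
    ultimately show ?thesis by simp
  qed
  then have "?s - (\<Sum>m'\<in>M. v m') \<in> I"
    using \<open>?s \<in> I\<close> I(1) by (simp only: subspace_diff subspace_sum)
  with * show ?case by simp
qed simp

lemma eigen_subspace: "subspace {x. nprod V w n x = scl V m x}"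
  by (auto simp: subspace_def scale_right_distrib mult.commute)

lemma eigen_span_eigenvector:
  assumes "\<And>x m. x \<in> E m \<Longrightarrow> nprod V w n x = scl V m x" and "v \<in> span (E m)"
  shows "nprod V w n v = scl V m v"
  using span_minimal[OF _ eigen_subspace[of w n m], of "E m"] assms by auto

lemma span_Union_decomposition:
  assumes "v \<in> span (\<Union>m. E m)"
  shows "\<exists>M u. finite M \<and> v = (\<Sum>m\<in>M. u m) \<and> (\<forall>m. u m \<in> span (E m))"
  using assms
proof (induction rule: span_induct_alt)
  case base
  show ?case by (rule exI[of _ "{}"], rule exI[of _ "\<lambda>_. 0"]) (simp add: span_zero)
next
  case (step c x y)
  then obtain M u where *: "finite M" "y = (\<Sum>m\<in>M. u m)" "\<forall>m. u m \<in> span (E m)" by auto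
  obtain m0 where m0: "x \<in> E m0" using step by blast
  let ?M = "insert m0 M"
  let ?u = "\<lambda>m. (if m \<in> M then u m else 0) + (if m = m0 then scl V c x else 0)"
  have "(\<Sum>m\<in>?M. ?u m) = y + scl V c x"
  proof -
    have "(\<Sum>m\<in>?M. if m \<in> M then u m else 0) = (\<Sum>m\<in>M. u m)"
      using * by (intro sum.mono_neutral_cong_right) auto
    then show ?thesis using * by (simp add: sum.distrib)
  qed
  moreover have "?u m \<in> span (E m)" for m
    using *(3) m0 by (intro span_add) (auto intro: span_scale span_base span_zero)
  ultimately show ?case
    using * by (intro exI[of _ ?M] exI[of _ ?u]) (auto simp: add.commute)
qed

lemma invariant_decomposition:
  assumes I: "subspace I" "\<And>x. x \<in> I \<Longrightarrow> nprod V w n x \<in> I"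
    and E: "\<And>x m. x \<in> E m \<Longrightarrow> nprod V w n x = scl V m x" and v: "v \<in> I" "v \<in> span (\<Union>m. E m)"
  shows "v \<in> span (\<Union>m. I \<inter> span (E m))"
proof -
  obtain M u where *: "finite M" "v = (\<Sum>m\<in>M. u m)" "\<forall>m. u m \<in> span (E m)"
    using span_Union_decomposition[OF v(2)] by blast
  have "\<forall>m \<in> M. u m \<in> I"
    using * v eigen_span_eigenvector[where E = E, OF E] by (intro eigen_components[OF I]) auto
  then show ?thesis
    unfolding *(2) using *(3) by (intro span_sum span_base) auto
qed

lemma eigen_span:
  assumes E: "\<And>x m. x \<in> E m \<Longrightarrow> nprod V w n x = scl V m x"
    and v: "v \<in> span (\<Union>m. E m)" "nprod V w n v = scl V c v"
  shows "v \<in> span (E c)"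
proof -
  obtain M u where *: "finite M" "v = (\<Sum>m\<in>M. u m)" "\<forall>m. u m \<in> span (E m)"
    using span_Union_decomposition[OF v(1)] by blast
  \<comment> \<open>The vector itself enters the \<open>c\<close>-component with a minus sign. The
    family then sums to zero, and \<open>eigen_components\<close> for the zero subspace says that
    \<open>v\<close> equals its \<open>c\<close>-component.\<close>
  let ?u = "\<lambda>m. (if m \<in> M then u m else 0) - (if m = c then v else 0)"
  have "(\<Sum>m\<in>insert c M. if m \<in> M then u m else 0) = v"
    unfolding *(2) using *(1) by (intro sum.mono_neutral_cong_right) auto
  then have "(\<Sum>m\<in>insert c M. ?u m) \<in> {0}"
    using *(1) by (simp add: sum_subtractf)
  then have "\<forall>m \<in> insert c M. ?u m \<in> {0}"
    using * v eigen_span_eigenvector[where E = E, OF E] by (intro eigen_components) (auto simp: scale_right_diff_distrib)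
  then have "v = (if c \<in> M then u c else 0)" by auto
  then show ?thesis using *(3) by (auto simp: span_zero)
qed

lemma span_mode:
  assumes "\<And>x. x \<in> X \<Longrightarrow> nprod V a n x \<in> span Y" and "v \<in> span X"
  shows "nprod V a n v \<in> span Y"
  using assms(2)
  by (induction rule: span_induct_alt) (auto simp: span_zero assms(1) intro!: span_add span_scale)

end

section \<open>Vacuum modules\<close>

lemma act_simps [simp]:
  "act V J [] v = v"
  "act V J (x # w) v = nprod V (J (fst x)) (snd x) (act V J w v)"
  "act V J (u @ w) v = act V J u (act V J w v)"
  by (auto simp: act_def case_prod_unfold)

lemma (in vertex_superalgebra) act_linear:
  "act V J w (a + b) = act V J w a + act V J w b"
  "act V J w (scl V z a) = scl V z (act V J w a)"
  by (induction w) auto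

lemma lin_ext_superset:
  assumes "vector_space s" "finite A" "Poly_Mapping.keys p \<subseteq> A"
  shows "lin_ext s f p = (\<Sum>i\<in>A. s (Poly_Mapping.lookup p i) (f i))"
proof -
  interpret vector_space s by fact
  show ?thesis
    unfolding lin_ext_def
    using assms by (intro sum.mono_neutral_left) (auto simp: in_keys_iff)
qed

lemma lin_ext_single: "vector_space s \<Longrightarrow> lin_ext s f (Poly_Mapping.single i z) = s z (f i)"
  by (subst lin_ext_superset[where A = "{i}"]) auto

lemma lin_ext_add: 
  assumes "vector_space s"
  shows "lin_ext s f (p + q) = lin_ext s f p + lin_ext s f q"
proof -
  interpret vector_space s by fact
  let ?A = "Poly_Mapping.keys p \<union> Poly_Mapping.keys q"
  show ?thesis
    using Poly_Mapping.keys_add[of p q]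
    by (subst (1 2 3) lin_ext_superset[OF assms, where A = ?A])
      (auto simp: lookup_add scale_left_distrib sum.distrib)
qed

lemma lin_ext_scale:
  assumes "vector_space s"
  shows "lin_ext s f (fscale z p) = s z (lin_ext s f p)"
proof -
  interpret vector_space s by fact
  have "Poly_Mapping.keys (fscale z p) \<subseteq> Poly_Mapping.keys p"
    by (auto simp: in_keys_iff lookup_fscale)
  then show ?thesis
    by (subst (1 2) lin_ext_superset[OF assms, where A = "Poly_Mapping.keys p"])
      (auto simp: lookup_fscale scale_sum_right)
qed

lemma lin_ext_linear: "vector_space s \<Longrightarrow> Vector_Spaces.linear fscale s (lin_ext s f)"
  by (simp add: Vector_Spaces.linear_iff free.vector_space_axioms lin_ext_add lin_ext_scale)

lemma lin_ext_diff: "vector_space s \<Longrightarrow> lin_ext s f (p - q) = lin_ext s f p - lin_ext s f q"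
  using module_hom.diff[OF Vector_Spaces.linear.axioms(3)[OF lin_ext_linear]] by blast

lemma lin_ext_zero [simp]: "lin_ext s f 0 = 0"
  by (simp add: lin_ext_def)

lemma lin_ext_sum: "vector_space s \<Longrightarrow> lin_ext s f (sum g A) = (\<Sum>i\<in>A. lin_ext s f (g i))"
  using module_hom.sum[OF Vector_Spaces.linear.axioms(3)[OF lin_ext_linear]] by blast

lemma lin_ext_compose:
  assumes "Vector_Spaces.linear s t h"
  shows "h (lin_ext s f p) = lin_ext t (\<lambda>i. h (f i)) p"
proof -
  interpret Vector_Spaces.linear s t h by fact
  show ?thesis by (simp add: lin_ext_def sum scale)
qed

lemma lin_ext_kernel:
  assumes "vector_space t" and "\<And>r. r \<in> R \<Longrightarrow> lin_ext t g r = 0" and "p \<in> free.span R"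
  shows "lin_ext t g p = 0"
proof -
  interpret vector_space t by fact
  show ?thesis
    using assms(3)
    by (induction rule: free.span_induct_alt) (auto simp: lin_ext_add lin_ext_scale assms)
qed

lemma presents_relator:
  assumes "presents s f R" "r \<in> R"
  shows "lin_ext s f r = 0"
  using assms free.span_base[of r R] by (auto simp: presents_def)

lemma presents_span:
  assumes "vector_space s" "presents s f R"
  shows "v \<in> module.span s (range f)"
proof -
  interpret vector_space s by fact
  obtain p where "v = lin_ext s f p" using assms(2) by (auto simp: presents_def surj_def)
  then show ?thesis unfolding lin_ext_def by (auto intro!: span_sum intro: span_scale span_base)
qed

text \<open>The universal property of a presentation: a choice of preimages is harmless because two
  of them differ by an element of the span of the relators.\<close>

lemma presents_lift:
  assumes s: "vector_space s" and t: "vector_space t" and pr: "presents s f R"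
    and R: "\<And>r. r \<in> R \<Longrightarrow> lin_ext t g r = 0"
  shows "\<exists>h. Vector_Spaces.linear s t h \<and> (\<forall>i. h (f i) = g i)"
proof -
  interpret s: vector_space s by fact
  interpret t: vector_space t by fact
  define pre where "pre v = (SOME p. lin_ext s f p = v)" for v
  have pre: "lin_ext s f (pre v) = v" for v
    using pr unfolding pre_def presents_def surj_def by (metis (mono_tags) someI)
  define h where "h v = lin_ext t g (pre v)" for v
  have h: "h (lin_ext s f p) = lin_ext t g p" for p
  proof -
    have "lin_ext s f (pre (lin_ext s f p) - p) = 0" by (simp add: lin_ext_diff s pre)
    then have "pre (lin_ext s f p) - p \<in> free.span R" using pr by (auto simp: presents_def)
    then have "lin_ext t g (pre (lin_ext s f p) - p) = 0" using lin_ext_kernel[OF t R] by blast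
    then show ?thesis by (simp add: lin_ext_diff t h_def)
  qed
  have "Vector_Spaces.linear s t h"
    unfolding Vector_Spaces.linear_iff
  proof (intro conjI allI s t)
    fix x y z
    show "h (x + y) = h x + h y"
      using h[of "pre x + pre y"] by (simp add: lin_ext_add s t pre h_def)
    show "h (s z x) = t z (h x)"
      using h[of "fscale z (pre x)"] by (simp add: lin_ext_scale s t pre h_def)
  qed
  moreover have "h (f i) = g i" for i
    using h[of "Poly_Mapping.single i 1"] by (simp add: lin_ext_single s t)
  ultimately show ?thesis by blast
qed

text \<open>What remains of a presentation in quotients and in realizations: homogeneous fields with
  prescribed supercommutators, with no freeness asserted.\<close>

definition mode_relations ::
    "('g \<Rightarrow> bool) \<Rightarrow> ('g \<times> int \<Rightarrow> 'g \<times> int \<Rightarrow> 'g word \<Rightarrow>\<^sub>0 complex) \<Rightarrow>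
     'v::ab_group_add vsa \<Rightarrow> ('g \<Rightarrow> 'v) \<Rightarrow> bool" where
  "mode_relations par B V J \<longleftrightarrow>
     (\<forall>a. J a \<in> part V (par a)) \<and>
     (\<forall>a m b n v. nprod V (J a) m (nprod V (J b) n v) =
        scl V (ksign (par a) (par b)) (nprod V (J b) n (nprod V (J a) m v)) +
        lin_ext (scl V) (\<lambda>w. act V J w v) (B (a, m) (b, n)))"

lemma mode_relationsD:
  assumes "mode_relations par B V J"
  shows "J a \<in> part V (par a)"
    and "nprod V (J a) m (nprod V (J b) n v) =
        scl V (ksign (par a) (par b)) (nprod V (J b) n (nprod V (J a) m v)) +
        lin_ext (scl V) (\<lambda>w. act V J w v) (B (a, m) (b, n))"
  using assms unfolding mode_relations_def by blast+

context vertex_superalgebra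
begin

lemma act_diff: "act V J w (a - b) = act V J w a - act V J w b"
  by (induction w) auto

lemma act_zero [simp]: "act V J w 0 = 0"
  by (induction w) auto

lemma act_sum: "act V J w (sum g A) = (\<Sum>i\<in>A. act V J w (g i))"
  by (induction A rule: infinite_finite_induct) (auto simp: act_linear)

lemma lin_ext_relator:
  "lin_ext (scl V) (\<lambda>(w, j). act V J w (g j))
     (Poly_Mapping.single (u @ [x, y] @ v, j) 1 - Poly_Mapping.single (u @ [y, x] @ v, j) s
       - (\<Sum>w \<in> Poly_Mapping.keys b. Poly_Mapping.single (u @ w @ v, j) (Poly_Mapping.lookup b w))) =
   act V J u (nprod V (J (fst x)) (snd x) (nprod V (J (fst y)) (snd y) (act V J v (g j)))
     - scl V s (nprod V (J (fst y)) (snd y) (nprod V (J (fst x)) (snd x) (act V J v (g j))))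
     - lin_ext (scl V) (\<lambda>w. act V J w (act V J v (g j))) b)"
  by (simp add: lin_ext_diff lin_ext_sum lin_ext_single vector_space_axioms act_diff act_linear act_sum)
    (simp add: lin_ext_def act_sum act_linear)

lemma lin_ext_act_add:
  "lin_ext (scl V) (\<lambda>w. act V J w (a + b)) p =
     lin_ext (scl V) (\<lambda>w. act V J w a) p + lin_ext (scl V) (\<lambda>w. act V J w b) p"
  "lin_ext (scl V) (\<lambda>w. act V J w (scl V z a)) p = scl V z (lin_ext (scl V) (\<lambda>w. act V J w a) p)"
  by (simp_all add: lin_ext_def act_linear scale_right_distrib sum.distrib scale_sum_right mult.commute)

lemma induced_relations:
  assumes pr: "presents (scl V) (\<lambda>(w, j). act V J w (g j)) (induced_relators par B \<chi>)"
    and J: "\<And>a. J a \<in> part V (par a)"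
  shows "mode_relations par B V J"
    and "n \<ge> 0 \<Longrightarrow> nprod V (J a) n (g j) = scl V (\<chi> (a, n) j) (g j)"
    and "v \<in> span {act V J w (g j) | w j. True}"
proof -
  have span: "v \<in> span {act V J w (g j) | w j. True}" for v
    using presents_span[OF vector_space_axioms pr, of v]
    by (rule subsetD[OF span_mono, rotated]) auto
  then show "v \<in> span {act V J w (g j) | w j. True}" by blast
  have "nprod V (J a) m (nprod V (J b) n v) =
        scl V (ksign (par a) (par b)) (nprod V (J b) n (nprod V (J a) m v)) +
        lin_ext (scl V) (\<lambda>w. act V J w v) (B (a, m) (b, n))" for a m b n v
    using span[of v]
  proof (induction rule: span_induct_alt)
    case base
    show ?case by (simp add: lin_ext_def)
  next
    case (step c x y)
    then obtain w j where x: "x = act V J w (g j)" by blast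
    have "nprod V (J a) m (nprod V (J b) n x) =
        scl V (ksign (par a) (par b)) (nprod V (J b) n (nprod V (J a) m x)) +
        lin_ext (scl V) (\<lambda>w. act V J w x) (B (a, m) (b, n))"
    proof -
      have "Poly_Mapping.single ([] @ [(a, m), (b, n)] @ w, j) 1
          - Poly_Mapping.single ([] @ [(b, n), (a, m)] @ w, j) (ksign (par a) (par b))
          - (\<Sum>w' \<in> Poly_Mapping.keys (B (a, m) (b, n)).
            Poly_Mapping.single ([] @ w' @ w, j) (Poly_Mapping.lookup (B (a, m) (b, n)) w'))
          \<in> induced_relators par B \<chi>"
        unfolding induced_relators_def
        by (rule UnI1, rule CollectI, rule exI[of _ "[]"], rule exI[of _ "(a, m)"],
            rule exI[of _ "(b, n)"], rule exI[of _ w], rule exI[of _ j]) simp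
      from presents_relator[OF pr this] show ?thesis
        unfolding lin_ext_relator by (simp add: x algebra_simps)
    qed
    with step show ?case by (simp add: lin_ext_act_add algebra_simps)
  qed
  then show "mode_relations par B V J" unfolding mode_relations_def using J by blast
  assume n: "n \<ge> 0"
  have "Poly_Mapping.single ([] @ [(a, n)], j) 1 - Poly_Mapping.single ([], j) (\<chi> (a, n) j)
     \<in> induced_relators par B \<chi>"
    unfolding induced_relators_def
    by (rule UnI2, rule CollectI, rule exI[of _ "[]"], rule exI[of _ "(a, n)"], rule exI[of _ j]) (simp add: n)
  from presents_relator[OF pr this] show "nprod V (J a) n (g j) = scl V (\<chi> (a, n) j) (g j)"
    by (simp add: lin_ext_diff lin_ext_single vector_space_axioms)
qed

text \<open>The spanning half of a PBW theorem. Modes outside \<open>N\<close> are moved to the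
  right until they meet \<open>v0\<close>; as supercommutators consist of words of length at most 1,
  each exchange produces shorter words. It serves both the vacuum and singular vectors.\<close>

lemma creation_span:
  assumes rel: "mode_relations par B V J"
    and len: "\<And>x y w. w \<in> Poly_Mapping.keys (B x y) \<Longrightarrow> length w \<le> 1"
    and v0: "\<And>a n. (a, n) \<notin> N \<Longrightarrow> nprod V (J a) n v0 \<in> span {v0}"
  shows "act V J w v0 \<in> span {act V J u v0 | u. set u \<subseteq> N}" (is "_ \<in> span ?S")
proof -
  have create: "nprod V (J a) n v \<in> span ?S" if "(a, n) \<in> N" "v \<in> span ?S" for a n v
    using that(2)
  proof (rule span_mode[rotated])
    fix x assume "x \<in> ?S"
    then obtain u where "x = act V J u v0" "set u \<subseteq> N" by blast
    then have "nprod V (J a) n x = act V J ((a, n) # u) v0 \<and> set ((a, n) # u) \<subseteq> N" using that by simp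
    then have "nprod V (J a) n x \<in> ?S" by blast
    then show "nprod V (J a) n x \<in> span ?S" by (rule span_base)
  qed
  have v0S: "span {v0} \<subseteq> span ?S"
    by (rule span_mono) (auto intro!: exI[of _ "[]"])
  have mode: "nprod V (J a) n (act V J u v0) \<in> span ?S" if "set u \<subseteq> N" for a n u
    using that
  proof (induction u arbitrary: a n)
    case Nil
    show ?case
    proof (cases "(a, n) \<in> N")
      case True
      then show ?thesis using create[of a n v0] v0S span_base[of v0 "{v0}"] by auto
    next
      case False
      then show ?thesis using v0[OF False] v0S by auto
    qed
  next
    case (Cons y u)
    obtain b m where y: "y = (b, m)" by force
    have u: "act V J u v0 \<in> span ?S" using Cons.prems by (auto intro!: span_base)
    have "lin_ext (scl V) (\<lambda>w. act V J w (act V J u v0)) (B (a, n) (b, m)) \<in> span ?S"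
      unfolding lin_ext_def
    proof (intro span_sum span_scale)
      fix w assume "w \<in> Poly_Mapping.keys (B (a, n) (b, m))"
      then have "w = [] \<or> (\<exists>x. w = [x])" using len[of w] by (cases w) fastforce+
      then show "act V J w (act V J u v0) \<in> span ?S"
        using u Cons by auto
    qed
    moreover have "nprod V (J b) m (nprod V (J a) n (act V J u v0)) \<in> span ?S"
    proof (rule create)
      show "(b, m) \<in> N" using Cons.prems y by simp
      show "nprod V (J a) n (act V J u v0) \<in> span ?S" using Cons by simp
    qed
    moreover have "nprod V (J a) n (act V J (y # u) v0) =
       scl V (ksign (par a) (par b)) (nprod V (J b) m (nprod V (J a) n (act V J u v0))) +
        lin_ext (scl V) (\<lambda>w. act V J w (act V J u v0)) (B (a, n) (b, m))"
      unfolding y act_simps fst_conv snd_conv by (rule mode_relationsD(2)[OF rel])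
    ultimately show ?case by (simp only: span_add span_scale)
  qed
  show ?thesis
  proof (induction w)
    case Nil
    then show ?case using v0S span_base[of v0 "{v0}"] by auto
  next
    case (Cons x w)
    have "nprod V (J (fst x)) (snd x) (act V J w v0) \<in> span ?S"
      by (rule span_mode[OF _ Cons]) (use mode in blast)
    then show ?case by simp
  qed
qed

lemma parity_span:
  assumes E: "\<And>x q. x \<in> E q \<Longrightarrow> x \<in> part V q" and v: "v \<in> span (\<Union>q. E q)" "v \<in> part V p"
  shows "v \<in> span (E p)"
proof -
  have part: "y \<in> part V q" if "y \<in> span (E q)" for y q
    using that span_minimal[OF _ part_subspace, of "E q" q] E by blast
  have "(\<Union>q. E q) = E p \<union> E (\<not> p)" by (cases p) (auto simp: UNIV_bool)
  then obtain y z where *: "v = y + z" "y \<in> span (E p)" "z \<in> span (E (\<not> p))"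
    using v by (auto simp: span_Un)
  have "v - y \<in> part V p" using part[OF *(2)] v(2) by (rule part_closed(2)[rotated])
  then have "z \<in> part V p" using *(1) by simp
  moreover have "z \<in> part V (\<not> p)" using part[OF *(3)] .
  ultimately have "z \<in> part V False \<inter> part V True" by (cases p) auto
  then have "z = 0" using part_Int by auto
  then show ?thesis using * by simp
qed

end

definition word_parity :: "('g \<Rightarrow> bool) \<Rightarrow> 'g word \<Rightarrow> bool" where
  "word_parity par w = foldr (\<lambda>x q. par (fst x) \<noteq> q) w False"

lemma word_parity_simps [simp]:
  "word_parity par [] = False"
  "word_parity par (x # w) = (par (fst x) \<noteq> word_parity par w)"
  by (auto simp: word_parity_def)

lemma (in vertex_superalgebra) act_parity:
  assumes "\<And>a. J a \<in> part V (par a)" "v \<in> part V False"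
  shows "act V J w v \<in> part V (word_parity par w)"
  by (induction w) (use assms parity in auto)

lemma vsa_homD:
  assumes "vsa_hom V W f"
  shows "f (a + b) = f a + f b" "f (scl V z a) = scl W z (f a)" "f 0 = 0" "f (a - b) = f a - f b"
    "f (vac V) = vac W" "f (nprod V a n b) = nprod W (f a) n (f b)"
    "a \<in> part V p \<Longrightarrow> f a \<in> part W p" "f (sum g A) = (\<Sum>i\<in>A. f (g i))"
proof -
  have l: "Vector_Spaces.linear (scl V) (scl W) f" using assms by (auto simp: vsa_hom_def)
  interpret Vector_Spaces.linear "scl V" "scl W" f by (rule l)
  show "f (a + b) = f a + f b" "f (scl V z a) = scl W z (f a)" "f 0 = 0" "f (a - b) = f a - f b"
    "f (sum g A) = (\<Sum>i\<in>A. f (g i))"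
    by (auto simp: add scale diff sum)
qed (use assms in \<open>auto simp: vsa_hom_def\<close>)

lemma vsa_hom_act: "vsa_hom V W f \<Longrightarrow> f (act V J w v) = act W (f \<circ> J) w (f v)"
  by (induction w) (auto simp: vsa_homD)

text \<open>The presentation yields a linear map that intertwines the generating modes by
  construction. The iterate formula, by induction on words, extends this to the modes of every
  state.\<close>

lemma vacuum_hom:
  assumes V: "vertex_superalgebra V" and W: "vertex_superalgebra W"
    and pr: "presents (scl V) (\<lambda>(w, j::unit). act V J w (vac V)) (induced_relators par B (\<lambda>x j. 0))"
    and J: "\<And>a. J a \<in> part V (par a)" and rel: "mode_relations par B W K"
  shows "\<exists>h. vsa_hom V W h \<and> (\<forall>a. h (J a) = K a)"
proof -
  interpret V: vertex_superalgebra V by fact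
  interpret W: vertex_superalgebra W by fact
  have K: "K a \<in> part W (par a)" for a using rel by (rule mode_relationsD)
  have "lin_ext (scl W) (\<lambda>(w, j::unit). act W K w (vac W)) r = 0" if "r \<in> induced_relators par B (\<lambda>x j. 0)" for r
    using that unfolding induced_relators_def
  proof (elim UnE; elim CollectE exE conjE)
    fix u x y v j
    assume "r = Poly_Mapping.single (u @ [x, y] @ v, j) 1
       - Poly_Mapping.single (u @ [y, x] @ v, j) (ksign (par (fst x)) (par (fst y)))
       - (\<Sum>w \<in> Poly_Mapping.keys (B x y).
            Poly_Mapping.single (u @ w @ v, j) (Poly_Mapping.lookup (B x y) w))"
    then have "lin_ext (scl W) (\<lambda>(w, j::unit). act W K w (vac W)) r =
       act W K u (nprod W (K (fst x)) (snd x) (nprod W (K (fst y)) (snd y) (act W K v (vac W)))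
     - scl W (ksign (par (fst x)) (par (fst y))) (nprod W (K (fst y)) (snd y) (nprod W (K (fst x)) (snd x) (act W K v (vac W))))
     - lin_ext (scl W) (\<lambda>w. act W K w (act W K v (vac W))) (B x y))"
      by (simp only: W.lin_ext_relator[where g = "\<lambda>_. vac W"])
    also have "\<dots> = 0"
      by (subst mode_relationsD(2)[OF rel, of "fst x" "snd x" "fst y" "snd y"]) simp
    finally show "lin_ext (scl W) (\<lambda>(w, j::unit). act W K w (vac W)) r = 0" .
  next
    fix u and x :: "'c \<times> int" and j :: unit
    assume "r = Poly_Mapping.single (u @ [x], j) 1 - Poly_Mapping.single (u, j) 0" "0 \<le> snd x"
    then show "lin_ext (scl W) (\<lambda>(w, j::unit). act W K w (vac W)) r = 0"
      by (simp add: lin_ext_diff lin_ext_single W.vector_space_axioms W.creation)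
  qed
  from presents_lift[OF V.vector_space_axioms W.vector_space_axioms pr this]
  obtain h where h: "Vector_Spaces.linear (scl V) (scl W) h" and hw: "h (act V J w (vac V)) = act W K w (vac W)" for w
    by auto
  interpret h: Vector_Spaces.linear "scl V" "scl W" h by (rule h)
  have hJ: "h (J a) = K a" for a
    using hw[of "[(a, - 1)]"] by (simp add: V.creation W.creation)
  let ?X = "{act V J w (vac V) | w. True}"
  have spanX: "v \<in> V.span ?X" for v
    using V.induced_relations(3)[where g = "\<lambda>_. vac V", OF pr J, of v] by simp
  have mode: "h (nprod V (J a) n b) = nprod W (K a) n (h b)" for a n b
    using spanX[of b]
  proof (induction rule: V.span_induct_alt)
    case (step c x y)
    then obtain w where "x = act V J w (vac V)" by blast
    then show ?case using step hw[of "(a, n) # w"] hw[of w] by (simp add: h.add h.scale)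
  qed (simp add: h.zero)
  have word: "h (nprod V (act V J w (vac V)) n b) = nprod W (act W K w (vac W)) n (h b)" for w n b
  proof (induction w arbitrary: n b)
    case Nil
    then show ?case by (simp add: V.vacuum W.vacuum h.zero)
  next
    case (Cons x w)
    obtain a m where x: "x = (a, m)" by force
    define u where "u = act V J w (vac V)"
    define u' where "u' = act W K w (vac W)"
    have pu: "u \<in> part V (word_parity par w)" "u' \<in> part W (word_parity par w)"
      unfolding u_def u'_def using V.act_parity[of J par] W.act_parity[of K par] J K V.vac_even W.vac_even by auto
    obtain N1 where N1: "\<forall>j \<ge> N1. nprod V (J a) (int j + 0) b = 0" using V.truncation_nat by blast
    obtain N2 where N2: "\<forall>j \<ge> N2. nprod V u (int j + n) b = 0" using V.truncation_nat by blast
    obtain N3 where N3: "\<forall>j \<ge> N3. nprod W (K a) (int j + 0) (h b) = 0" using W.truncation_nat by blast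
    obtain N4 where N4: "\<forall>j \<ge> N4. nprod W u' (int j + n) (h b) = 0" using W.truncation_nat by blast
    \<comment> \<open>A common truncation bound for source and target, so that the two iterate
      expansions agree term by term.\<close>
    define N where "N = Max {N1, N2, N3, N4}"
    have *: "h (nprod V u n b) = nprod W u' n (h b)" for n b
      unfolding u_def u'_def by (rule Cons)
    have "nprod V (nprod V (J a) m u) n b = (\<Sum>j<N. scl V ((- 1) ^ j * (of_int m gchoose j))
          (nprod V (J a) (m - int j) (nprod V u (n + int j) b)
           - scl V ((- 1) powi m * ksign (par a) (word_parity par w))
               (nprod V u (m + n - int j) (nprod V (J a) (int j) b))))"
      by (rule V.iterate[OF J pu(1)]) (use N1 N2 in \<open>auto simp: N_def add.commute\<close>)
    moreover have "nprod W (nprod W (K a) m u') n (h b) = (\<Sum>j<N. scl W ((- 1) ^ j * (of_int m gchoose j))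
          (nprod W (K a) (m - int j) (nprod W u' (n + int j) (h b))
           - scl W ((- 1) powi m * ksign (par a) (word_parity par w))
               (nprod W u' (m + n - int j) (nprod W (K a) (int j) (h b)))))"
      by (rule W.iterate[OF K pu(2)]) (use N3 N4 in \<open>auto simp: N_def add.commute\<close>)
    ultimately show ?case
      by (simp add: x u_def[symmetric] u'_def[symmetric] h.sum h.scale h.diff mode *)
  qed
  have prod: "h (nprod V a n b) = nprod W (h a) n (h b)" for a n b
    using spanX[of a]
  proof (induction rule: V.span_induct_alt)
    case (step c x y)
    then show ?case using word hw by (auto simp add: h.add h.scale)
  qed (simp add: h.zero)
  \<comment> \<open>A state of pure parity is spanned by words of that parity
    (\<open>V.parity_span\<close>), and \<open>J\<close> and \<open>K\<close> assign the same parity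
    to a word.\<close>
  have par: "h a \<in> part W p" if "a \<in> part V p" for a p
  proof -
    let ?E = "\<lambda>p. {act V J w (vac V) | w. word_parity par w = p}"
    have "a \<in> V.span (?E p)"
    proof (rule V.parity_span)
      show "x \<in> part V q" if "x \<in> ?E q" for x q
        using that V.act_parity[of J par] J V.vac_even by auto
      have "?X = (\<Union>q. ?E q)" by auto
      then show "a \<in> V.span (\<Union>q. ?E q)" using spanX[of a] by simp
    qed fact
    then show ?thesis
    proof (induction rule: V.span_induct_alt)
      case (step c x y)
      then obtain w where w: "x = act V J w (vac V)" "word_parity par w = p" by blast
      have "h x \<in> part W p"
        unfolding w(1) hw using W.act_parity[of K par, OF K W.vac_even, of w] w(2) by simp
      then show ?case using step by (simp add: h.add h.scale)
    qed (simp add: h.zero)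
  qed
  have "vsa_hom V W h"
    unfolding vsa_hom_def using h prod par hw[of "[]"] by auto
  then show ?thesis using hJ by blast
qed

section \<open>Singular vectors and simple quotients\<close>

definition word_sum :: "('g \<times> int \<Rightarrow> 'n::comm_monoid_add) \<Rightarrow> 'g word \<Rightarrow> 'n" where
  "word_sum \<gamma> w = sum_list (map \<gamma> w)"

lemma word_sum_simps [simp]:
  "word_sum \<gamma> [] = 0" "word_sum \<gamma> (x # w) = \<gamma> x + word_sum \<gamma> w"
  by (auto simp: word_sum_def)

abbreviation "creation_modes \<equiv> {x. snd x < 0}"

context vertex_superalgebra
begin

lemma act_parity_shift:
  assumes "\<And>a. J a \<in> part V (par a)" "v \<in> part V p"
  shows "act V J w v \<in> part V (word_parity par w \<noteq> p)"
proof (induction w)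
  case (Cons x w)
  have "(word_parity par (x # w) \<noteq> p) = (par (fst x) \<noteq> (word_parity par w \<noteq> p))" by auto
  then show ?case
    using parity[OF assms(1) Cons, of "fst x" "snd x"] by (simp only: act_simps)
qed (use assms in simp)

lemma act_eigen:
  assumes "\<And>a n b. nprod V w k (nprod V (J a) n b) = nprod V (J a) n (nprod V w k b) + scl V (\<gamma> (a, n)) (nprod V (J a) n b)"
    and "nprod V w k v = scl V c v"
  shows "nprod V w k (act V J u v) = scl V (word_sum \<gamma> u + c) (act V J u v)"
  by (induction u) (auto simp: assms scale_left_distrib add.commute)

lemma vacuum_span:
  assumes "mode_relations par B V J"
    and "\<And>x y w. w \<in> Poly_Mapping.keys (B x y) \<Longrightarrow> length w \<le> 1"
    and "v \<in> span {act V J w (vac V) | w. True}"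
  shows "v \<in> span {act V J w (vac V) | w. set w \<subseteq> creation_modes}"
proof -
  have "{act V J w (vac V) | w. True} \<subseteq> span {act V J w (vac V) | w. set w \<subseteq> creation_modes}"
    using creation_span[OF assms(1,2), where N = creation_modes and ?v0.0 = "vac V"] by (auto simp: creation span_zero)
  then show ?thesis
    using assms(3) span_minimal[OF _ subspace_span] by blast
qed

lemma mode_invariant:
  assumes J: "\<And>a. J a \<in> part V (par a)" and gen: "\<And>v. v \<in> span {act V J w (vac V) | w. True}"
    and S: "subspace S" "\<And>a n x. x \<in> S \<Longrightarrow> nprod V (J a) n x \<in> S" and x: "x \<in> S"
  shows "nprod V a n x \<in> S"
proof -
  have "nprod V (act V J w (vac V)) n x \<in> S" if "x \<in> S" for w n x
    using that
  proof (induction w arbitrary: n x)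
    case Nil
    then show ?case using subspace_0[OF S(1)] by (simp add: vacuum)
  next
    case (Cons y w)
    obtain b m where y: "y = (b, m)" by force
    define u where "u = act V J w (vac V)"
    have pu: "u \<in> part V (word_parity par w)"
      unfolding u_def using act_parity[of J par] J vac_even by auto
    obtain N1 where N1: "\<forall>j \<ge> N1. nprod V (J b) (int j + 0) x = 0" using truncation_nat by blast
    obtain N2 where N2: "\<forall>j \<ge> N2. nprod V u (int j + n) x = 0" using truncation_nat by blast
    have "nprod V (nprod V (J b) m u) n x = (\<Sum>j<max N1 N2. scl V ((- 1) ^ j * (of_int m gchoose j))
          (nprod V (J b) (m - int j) (nprod V u (n + int j) x)
           - scl V ((- 1) powi m * ksign (par b) (word_parity par w))
               (nprod V u (m + n - int j) (nprod V (J b) (int j) x))))"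
      by (rule iterate[OF J pu]) (use N1 N2 in \<open>auto simp: add.commute\<close>)
    also have "\<dots> \<in> S"
      using S Cons unfolding u_def by (intro subspace_sum subspace_scale subspace_diff) auto
    finally show ?case by (simp add: y u_def)
  qed
  note word = this
  show ?thesis
    using gen[of a]
  proof (induction rule: span_induct_alt)
    case base
    then show ?case using subspace_0[OF S(1)] by simp
  next
    case (step c y z)
    then have "nprod V y n x \<in> S" using x word by blast
    then show ?case using step S(1) by (simp add: subspace_add subspace_scale)
  qed
qed

text \<open>Stability under generating modes gives a left ideal. Skew symmetry writes a right
  product as a sum of translates of left products, so closure under translation makes the ideal
  two-sided.\<close>

lemma generated_ideal:
  assumes J: "\<And>a. J a \<in> part V (par a)" and gen: "\<And>v. v \<in> span {act V J w (vac V) | w. True}"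
    and S: "subspace S" "\<And>a n x. x \<in> S \<Longrightarrow> nprod V (J a) n x \<in> S"
    and T: "\<And>x. x \<in> S \<Longrightarrow> nprod V x (- 2) (vac V) \<in> S"
    and graded: "\<And>x. x \<in> S \<Longrightarrow> \<exists>a \<in> S \<inter> part V False. \<exists>b \<in> S \<inter> part V True. x = a + b"
  shows "vsa_ideal V S"
proof -
  have left: "nprod V a n x \<in> S" if "x \<in> S" for a n x
    by (rule mode_invariant[OF J gen S that])
  have Tp: "nprod V x (- 1 - int j) (vac V) \<in> S" if "x \<in> S" for x j
  proof (induction j)
    case 0
    then show ?case using that by (simp add: creation)
  next
    case (Suc j)
    have "- 1 - int (Suc j) = - 2 - int j" by simp
    then show ?case
      unfolding translate_power using T[OF Suc] S(1) by (simp only: translate_power subspace_scale)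
  qed
  have right: "nprod V x n a \<in> S" if x: "x \<in> S" "x \<in> part V q" and a: "a \<in> part V p" for x n a p q
  proof -
    obtain N where N: "\<forall>j \<ge> N. nprod V a (int j + n) x = 0" using truncation_nat by blast
    have "nprod V x n a = scl V (- ((- 1) powi n * ksign p q))
     (\<Sum>j<N. scl V ((- 1) ^ j) (nprod V (nprod V a (n + int j) x) (- 1 - int j) (vac V)))"
      by (rule skew[OF a x(2)]) (use N in \<open>auto simp: add.commute\<close>)
    also have "\<dots> \<in> S" by (intro subspace_scale[OF S(1)] subspace_sum[OF S(1)] Tp left x(1))
    finally show ?thesis .
  qed
  have "nprod V x n a \<in> S" if x: "x \<in> S" for x n a
  proof -
    obtain x0 x1 where x01: "x = x0 + x1" "x0 \<in> S" "x0 \<in> part V False" "x1 \<in> S" "x1 \<in> part V True"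
      using graded[OF x] by blast
    obtain a0 a1 where a01: "a = a0 + a1" "a0 \<in> part V False" "a1 \<in> part V True" using part_sum by blast
    show ?thesis
      using right[OF x01(2,3) a01(2)] right[OF x01(2,3) a01(3)] right[OF x01(4,5) a01(2)] right[OF x01(4,5) a01(3)]
      by (simp add: x01(1) a01(1) subspace_add[OF S(1)])
  qed
  then show ?thesis
    unfolding vsa_ideal_def using S(1) graded left by blast
qed

text \<open>
  By simplicity the words of modes of positive degree, applied to \<open>v\<close>, span the whole algebra.  As
  they reach the vacuum, \<open>v\<close> has degree at most \<open>0\<close>; but the vacuum generates in degrees at least \<open>0\<close>.
\<close>

lemma simple_singular_homogeneous:
  assumes simple: "simple_vsa V" and rel: "mode_relations par B V J"
    and len: "\<And>x y w. w \<in> Poly_Mapping.keys (B x y) \<Longrightarrow> length w \<le> 1"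
    and gen: "\<And>v. v \<in> span {act V J w (vac V) | w. True}"
    and \<delta>: "\<And>u. nprod V (J \<delta>) 0 u = nprod V u (- 2) (vac V)"
      "\<And>a n b. nprod V (J \<delta>) 1 (nprod V (J a) n b) =
        nprod V (J a) n (nprod V (J \<delta>) 1 b) + scl V (of_real (gr (a, n))) (nprod V (J a) n b)"
    and gr: "\<And>a n. n < 0 \<Longrightarrow> gr (a, n) > 0" "\<And>a n. gr (a, n) = 0 \<Longrightarrow> a = \<delta> \<and> n = 1"
    and v: "v \<in> part V p" "\<And>a n. gr (a, n) < 0 \<Longrightarrow> nprod V (J a) n v = 0"
      "nprod V (J \<delta>) 1 v = scl V l v"
  shows "v \<in> span {vac V}"
proof (cases "v = 0")
  case True
  then show ?thesis by (simp add: span_zero)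
next
  case False
  note J = mode_relationsD(1)[OF rel]
  let ?N = "{x. gr x > 0}" and ?g = "\<lambda>x. complex_of_real (gr x)"
  let ?S = "span {act V J w v | w. True}"
  have Sv: "v \<in> ?S" by (rule span_base) (auto intro: exI[of _ "[]"])
  have Smode: "nprod V (J a) n x \<in> ?S" if "x \<in> ?S" for a n x
  proof (rule span_mode[OF _ that])
    fix x assume "x \<in> {act V J w v | w. True}"
    then obtain w where "x = act V J w v" by blast
    then have "nprod V (J a) n x = act V J ((a, n) # w) v" by simp
    then show "nprod V (J a) n x \<in> ?S" by (intro span_base) blast
  qed
  have "vsa_ideal V ?S"
  proof (rule generated_ideal[where J = J and par = par])
    show "\<exists>a \<in> ?S \<inter> part V False. \<exists>b \<in> ?S \<inter> part V True. x = a + b" if "x \<in> ?S" for x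
      using that
    proof (induction rule: span_induct_alt)
      case base
      show ?case by (rule bexI[of _ 0], rule bexI[of _ 0]) (auto simp: span_zero)
    next
      case (step c x y)
      then obtain a b where ab: "a \<in> ?S \<inter> part V False" "b \<in> ?S \<inter> part V True" "y = a + b" by blast
      obtain w where w: "x = act V J w v" using step by blast
      have x: "x \<in> ?S" using step by (simp add: span_base)
      have "x \<in> part V (word_parity par w \<noteq> p)"
        unfolding w using act_parity_shift[of J par v p w] J v(1) by simp
      then consider "x \<in> part V False" | "x \<in> part V True" by (cases "word_parity par w \<noteq> p") auto
      then show ?case
      proof cases
        case 1
        then show ?thesis
          using ab x by (intro bexI[of _ "scl V c x + a"] bexI[of _ b]) (auto simp: span_add span_scale)
      next
        case 2
        then show ?thesis
          using ab x by (intro bexI[of _ a] bexI[of _ "scl V c x + b"]) (auto simp: span_add span_scale)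
      qed
    qed
    \<comment> \<open>Translation is itself the mode \<open>\<delta>_(0)\<close>, and
      \<open>?S\<close> is stable under all modes of generators.\<close>
    show "nprod V x (- 2) (vac V) \<in> ?S" if "x \<in> ?S" for x
      using Smode[OF that, of \<delta> 0] by (simp add: \<delta>(1))
  qed (use J gen Smode in auto)
  then have "?S = UNIV" using simple Sv False unfolding simple_vsa_def by blast
  then have vacS: "vac V \<in> ?S" by simp
  have "act V J w v \<in> span {act V J u v | u. set u \<subseteq> ?N}" for w
  proof (rule creation_span[OF rel len])
    fix a n assume "(a, n) \<notin> ?N"
    then consider "gr (a, n) < 0" | "gr (a, n) = 0" by fastforce
    then show "nprod V (J a) n v \<in> span {v}"
      by cases (use v gr(2)[of a n] in \<open>auto simp: span_zero span_scale span_base\<close>)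
  qed
  then have "?S \<subseteq> span {act V J u v | u. set u \<subseteq> ?N}"
    by (intro span_minimal) auto
  also have "{act V J u v | u. set u \<subseteq> ?N} = (\<Union>m. {act V J u v | u. set u \<subseteq> ?N \<and> word_sum ?g u + l = m})"
    by auto
  finally have "vac V \<in> span (\<Union>m. {act V J u v | u. set u \<subseteq> ?N \<and> word_sum ?g u + l = m})"
    using vacS by blast
  then have "vac V \<in> span {act V J u v | u. set u \<subseteq> ?N \<and> word_sum ?g u + l = 0}"
  proof (rule eigen_span[rotated])
    show "nprod V (J \<delta>) 1 x = scl V m x" if "x \<in> {act V J u v | u. set u \<subseteq> ?N \<and> word_sum ?g u + l = m}" for x m
      using that act_eigen[where \<gamma> = ?g and J = J, OF \<delta>(2) v(3)] by auto
  qed (simp add: creation)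
  moreover have "vac V \<noteq> 0" using simple by (simp add: simple_vsa_def)
  ultimately obtain u where u: "set u \<subseteq> ?N" "word_sum ?g u + l = 0"
    using span_empty by (cases "{act V J u v | u. set u \<subseteq> ?N \<and> word_sum ?g u + l = 0} = {}") auto
  have sum_real: "word_sum ?g u = of_real (word_sum gr u)" for u by (induction u) auto
  have "word_sum gr u \<ge> 0" using u(1) by (induction u) auto
  then have l1: "\<exists>r. l = of_real r \<and> r \<le> 0"
    using u(2) unfolding sum_real by (intro exI[of _ "- word_sum gr u"]) (simp add: eq_neg_iff_add_eq_0 add.commute)
  have "v \<in> span (\<Union>m. {act V J u (vac V) | u. set u \<subseteq> creation_modes \<and> word_sum ?g u + 0 = m})"
    using vacuum_span[OF rel len gen, where v = v] by (rule subsetD[OF span_mono, rotated]) auto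
  then have v0: "v \<in> span {act V J u (vac V) | u. set u \<subseteq> creation_modes \<and> word_sum ?g u + 0 = l}"
  proof (rule eigen_span[rotated])
    show "nprod V (J \<delta>) 1 x = scl V m x"
      if "x \<in> {act V J u (vac V) | u. set u \<subseteq> creation_modes \<and> word_sum ?g u + 0 = m}" for x m
      using that act_eigen[where \<gamma> = ?g and J = J and v = "vac V" and c = 0, OF \<delta>(2)] by (auto simp: creation)
  qed fact
  have pos: "word_sum gr u > 0" if "set u \<subseteq> creation_modes" "u \<noteq> []" for u
    using that
  proof (induction u)
    case (Cons x u)
    then have "gr x > 0" using gr(1)[of "snd x" "fst x"] by simp
    then show ?case using Cons by (cases "u = []") auto
  qed simp
  have "u = []" if "set u \<subseteq> creation_modes" "word_sum ?g u + 0 = l" for u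
  proof (rule ccontr)
    assume "u \<noteq> []"
    with that pos[of u] l1 show False by (auto simp: sum_real)
  qed
  then have "{act V J u (vac V) | u. set u \<subseteq> creation_modes \<and> word_sum ?g u + 0 = l} \<subseteq> {vac V}"
    by fastforce
  then show ?thesis using v0 span_mono by blast
qed

text \<open>Modes of generators are homogeneous, so the even and the odd component of a singular
  vector are singular with the same eigenvalue; this reduces to the homogeneous case, which the
  grading of ideals requires.\<close>

lemma simple_singular:
  assumes simple: "simple_vsa V" and rel: "mode_relations par B V J"
    and len: "\<And>x y w. w \<in> Poly_Mapping.keys (B x y) \<Longrightarrow> length w \<le> 1"
    and gen: "\<And>v. v \<in> span {act V J w (vac V) | w. True}"
    and even: "\<not> par \<delta>"
    and \<delta>: "\<And>u. nprod V (J \<delta>) 0 u = nprod V u (- 2) (vac V)"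
      "\<And>a n b. nprod V (J \<delta>) 1 (nprod V (J a) n b) =
        nprod V (J a) n (nprod V (J \<delta>) 1 b) + scl V (of_real (gr (a, n))) (nprod V (J a) n b)"
    and gr: "\<And>a n. n < 0 \<Longrightarrow> gr (a, n) > 0" "\<And>a n. gr (a, n) = 0 \<Longrightarrow> a = \<delta> \<and> n = 1"
    and v: "\<And>a n. gr (a, n) < 0 \<Longrightarrow> nprod V (J a) n v = 0" "nprod V (J \<delta>) 1 v = scl V l v"
  shows "v \<in> span {vac V}"
proof -
  note J = mode_relationsD(1)[OF rel]
  have split: "x = 0 \<and> y = 0" if "x + y = 0" "x \<in> part V p" "y \<in> part V (\<not> p)" for x y p
  proof -
    have "x = - y" using that(1) by (simp add: eq_neg_iff_add_eq_0)
    then have "x \<in> part V (\<not> p)" using that(3) by simp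
    then have "x \<in> part V False \<inter> part V True" using that(2) by (cases p) auto
    then show ?thesis using that(1) part_Int by auto
  qed
  obtain v0 v1 where v01: "v = v0 + v1" "v0 \<in> part V False" "v1 \<in> part V True" using part_sum by blast
  have ann: "nprod V (J a) n v0 = 0 \<and> nprod V (J a) n v1 = 0" if "gr (a, n) < 0" for a n
    using v(1)[OF that] v01 parity[OF J v01(2), of a n] parity[OF J v01(3), of a n]
    by (intro split[of _ _ "par a"]) auto
  have eig: "nprod V (J \<delta>) 1 v0 - scl V l v0 = 0 \<and> nprod V (J \<delta>) 1 v1 - scl V l v1 = 0"
  proof (rule split[of _ _ False])
    have "J \<delta> \<in> part V False" using J[of \<delta>] even by simp
    then show "nprod V (J \<delta>) 1 v0 - scl V l v0 \<in> part V False" "nprod V (J \<delta>) 1 v1 - scl V l v1 \<in> part V (\<not> False)"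
      using v01 by (auto intro!: part_closed parity_even)
  qed (use v(2) v01 in \<open>simp add: algebra_simps\<close>)
  have "v0 \<in> span {vac V}"
    by (rule simple_singular_homogeneous[OF simple rel len gen \<delta> gr v01(2)]) (use ann eig in auto)
  moreover have "v1 \<in> span {vac V}"
    by (rule simple_singular_homogeneous[OF simple rel len gen \<delta> gr v01(3)]) (use ann eig in auto)
  ultimately show ?thesis unfolding v01(1) by (rule span_add)
qed

end

lemma factor_through_surjection:
  assumes U: "vertex_superalgebra U" and S: "vertex_superalgebra S" and \<Phi>: "vsa_hom U W \<Phi>"
    and f: "vsa_hom U S f" "surj f" and ker: "\<And>u. f u = 0 \<Longrightarrow> \<Phi> u = 0"
  shows "\<exists>\<Psi>. vsa_hom S W \<Psi> \<and> (\<forall>u. \<Psi> (f u) = \<Phi> u)"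
proof -
  interpret U: vertex_superalgebra U by fact
  interpret S: vertex_superalgebra S by fact
  note f' = vsa_homD[OF f(1)] and \<Phi>' = vsa_homD[OF \<Phi>]
  have wd: "\<Phi> u = \<Phi> u'" if "f u = f u'" for u u'
    using ker[of "u - u'"] that by (simp add: f'(4) \<Phi>'(4))
  define \<Psi> where "\<Psi> s = \<Phi> (inv f s)" for s
  have \<Psi>: "\<Psi> (f u) = \<Phi> u" for u
    unfolding \<Psi>_def by (rule wd) (simp add: f(2) surj_f_inv_f)
  have lin: "Vector_Spaces.linear (scl S) (scl W) \<Psi>"
    unfolding Vector_Spaces.linear_iff
  proof (intro conjI allI)
    show "vector_space (scl S)" by unfold_locales
    show "vector_space (scl W)" using \<Phi> by (simp add: vsa_hom_def Vector_Spaces.linear_iff)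
    show "\<Psi> (x + y) = \<Psi> x + \<Psi> y" for x y
    proof -
      obtain u v where "x = f u" "y = f v" using f(2) by (meson surjD)
      then show ?thesis by (simp add: \<Psi> \<Phi>'(1) flip: f'(1))
    qed
    show "\<Psi> (scl S c x) = scl W c (\<Psi> x)" for x c
    proof -
      obtain u where "x = f u" using f(2) by (meson surjD)
      then show ?thesis by (simp add: \<Psi> \<Phi>'(2) flip: f'(2))
    qed
  qed
  have par: "\<Psi> x \<in> part W p" if x: "x \<in> part S p" for x p
  proof -
    obtain u where u: "x = f u" using f(2) by (meson surjD)
    obtain c d where cd: "u = c + d" "c \<in> part U False" "d \<in> part U True" using U.part_sum by blast
    obtain a b where ab: "u = a + b" "a \<in> part U p" "b \<in> part U (\<not> p)"
    proof (cases p)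
      case True
      then show ?thesis using that[of d c] cd by (simp add: add.commute)
    next
      case False
      then show ?thesis using that[of c d] cd by simp
    qed
    \<comment> \<open>The component \<open>b\<close> of the wrong parity is mapped into both parts
      of \<open>S\<close>, hence to zero, so \<open>x\<close> has a preimage of its own
      parity.\<close>
    have "x - f a \<in> part S p" using x f'(7)[OF ab(2)] by (rule S.part_closed)
    then have "f b \<in> part S p" by (simp add: u ab(1) f'(1))
    moreover have "f b \<in> part S (\<not> p)" by (rule f'(7)[OF ab(3)])
    ultimately have "f b \<in> part S False \<inter> part S True" by (cases p) auto
    then have "f b = 0" using S.part_Int by auto
    then have "x = f a" by (simp add: u ab(1) f'(1))
    then show ?thesis using \<Phi>'(7)[OF ab(2)] by (simp add: \<Psi>)
  qed
  have prod: "\<Psi> (nprod S x n y) = nprod W (\<Psi> x) n (\<Psi> y)" for x n y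
  proof -
    obtain u v where "x = f u" "y = f v" using f(2) by (meson surjD)
    then show ?thesis by (simp add: \<Psi> \<Phi>'(6) flip: f'(6))
  qed
  have "\<Psi> (vac S) = vac W" using \<Psi>[of "vac U"] by (simp add: f'(5) \<Phi>'(5))
  then have "vsa_hom S W \<Psi>" unfolding vsa_hom_def using lin par prod by auto
  then show ?thesis using \<Psi> by blast
qed

text \<open>
  The grading operators are zero modes, so they preserve the kernel \<open>I\<close> of \<open>f\<close>.  If \<open>\<Phi>\<close> did not
  vanish on \<open>I\<close>, then a bihomogeneous element of \<open>I\<close> of minimal degree outside the kernel of \<open>\<Phi>\<close>,
  pushed up by the raising operator, would have a singular image; so the image would be a multiple
  of the vacuum, hence the element would have degree \<open>0\<close> and be the vacuum itself.
\<close>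

lemma hom_factors_through_quotient:
  fixes chg :: "'g \<Rightarrow> int"
  assumes U: "vertex_superalgebra U" and W: "vertex_superalgebra W" and S: "vertex_superalgebra S"
    and \<Phi>: "vsa_hom U W \<Phi>" and f: "vsa_hom U S f" "surj f" "vac S \<noteq> 0"
    and spanU: "\<And>v. v \<in> module.span (scl U) {act U J w (vac U) | w. set w \<subseteq> creation_modes}"
    and D: "\<And>a n b. nprod U \<delta> 1 (nprod U (J a) n b) =
      nprod U (J a) n (nprod U \<delta> 1 b) + scl U (- of_int n) (nprod U (J a) n b)"
    and H: "\<And>a n b. nprod U \<eta> 0 (nprod U (J a) n b) =
      nprod U (J a) n (nprod U \<eta> 0 b) + scl U (of_int (chg a)) (nprod U (J a) n b)"
    and chg: "\<And>a. chg a \<le> 2" "chg \<rho> > 0"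
    and singular: "\<And>i q. i \<in> module.span (scl U) {act U J w (vac U) | w. word_sum (chg \<circ> fst) w = q} \<Longrightarrow>
      (\<And>a n. n \<ge> 1 \<Longrightarrow> nprod W (\<Phi> (J a)) n (\<Phi> i) = 0) \<Longrightarrow> nprod W (\<Phi> (J \<rho>)) 0 (\<Phi> i) = 0 \<Longrightarrow>
      nprod W (\<Phi> \<eta>) 0 (\<Phi> i) = scl W (of_int q) (\<Phi> i) \<Longrightarrow> \<exists>z. \<Phi> i = scl W z (vac W)"
  shows "\<exists>\<Psi>. vsa_hom S W \<Psi> \<and> (\<forall>u. \<Psi> (f u) = \<Phi> u)"
proof (rule factor_through_surjection[OF U S \<Phi> f(1,2)], rule ccontr)
  interpret U: vertex_superalgebra U by fact
  interpret S: vertex_superalgebra S by fact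
  interpret W: vertex_superalgebra W by fact
  note f' = vsa_homD[OF f(1)] and \<Phi>' = vsa_homD[OF \<Phi>]
  fix u0 assume u0: "f u0 = 0" "\<Phi> u0 \<noteq> 0"
  define I where "I = {u. f u = 0}"
  have I: "U.subspace I" by (auto simp: I_def U.subspace_def f')
  have Imode: "nprod U a n u \<in> I" if "u \<in> I" for a n u
    using that by (simp add: I_def f')
  let ?deg = "word_sum (\<lambda>x. - snd x)" and ?chg = "word_sum (chg \<circ> fst)"
  let ?word = "\<lambda>w. act U J w (vac U)"
  \<comment> \<open>Degree and charge are recorded as complex numbers so that \<open>E\<close> is a
    family of eigenspaces; \<open>G_nonzero\<close> recovers that only integers occur.\<close>
  define E where "E m q = {?word w | w. set w \<subseteq> creation_modes \<and> of_int (?deg w) = m \<and> of_int (?chg w) = q}"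
    for m q :: complex
  have ofint: "word_sum (\<lambda>x. - of_int (snd x)) w = (of_int (?deg w) :: complex)"
    "word_sum (\<lambda>x. of_int (chg (fst x))) w = (of_int (?chg w) :: complex)" for w
    by (induction w) auto
  have D1: "nprod U \<delta> 1 x = scl U m x" if "x \<in> E m q" for x m q
    using that U.act_eigen[where \<gamma> = "\<lambda>x. - of_int (snd x)" and w = \<delta> and k = 1 and v = "vac U" and c = 0 and J = J] D
    by (auto simp: E_def ofint U.creation)
  have H1: "nprod U \<eta> 0 x = scl U q x" if "x \<in> E m q" for x m q
    using that U.act_eigen[where \<gamma> = "\<lambda>x. of_int (chg (fst x))" and w = \<eta> and k = 0 and v = "vac U" and c = 0 and J = J] H
    by (auto simp: E_def ofint U.creation)
  have spanE: "v \<in> U.span (\<Union>m. \<Union>q. E m q)" for v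
    using spanU[of v] by (rule subsetD[OF U.span_mono, rotated]) (auto simp: E_def)
  have DE: "nprod U \<delta> 1 x = scl U m x" if "x \<in> (\<Union>q. E m q)" for x m using that D1 by blast
  define G where "G m q = U.span (E m q)" for m q
  have G_eigen: "nprod U \<delta> 1 x = scl U m x" "nprod U \<eta> 0 x = scl U q x" if "x \<in> G m q" for x m q
  proof -
    show "nprod U \<delta> 1 x = scl U m x"
      using that unfolding G_def
      by (rule U.eigen_span_eigenvector[where E = "\<lambda>m'. E m' q", rotated]) (use D1 in blast)
    show "nprod U \<eta> 0 x = scl U q x"
      using that unfolding G_def
      by (rule U.eigen_span_eigenvector[where E = "\<lambda>q. E m q", rotated]) (use H1 in blast)
  qed
  have G_I: "x \<in> G m q" if "nprod U \<delta> 1 x = scl U m x" "nprod U \<eta> 0 x = scl U q x" for x m q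
  proof -
    have "x \<in> U.span (\<Union>q. E m q)"
      by (rule U.eigen_span[where E = "\<lambda>m. \<Union>q. E m q", OF DE spanE that(1)])
    then show ?thesis
      unfolding G_def by (rule U.eigen_span[where E = "\<lambda>q. E m q", rotated]) (use H1 that in auto)
  qed
  have G_mode: "nprod U (J a) n x \<in> G (m - of_int n) (q + of_int (chg a))" if "x \<in> G m q" for a n x m q
    using G_eigen[OF that] by (intro G_I) (auto simp: D H algebra_simps)
  \<comment> \<open>A creation mode has degree at least 1 and charge at most 2. The resulting
    inequality stops the raising operator on vectors of a fixed degree.\<close>
  have deg_bound: "?deg w \<ge> 0 \<and> ?chg w \<le> 2 * ?deg w" "?deg w = 0 \<Longrightarrow> w = []" if "set w \<subseteq> creation_modes" for w
  proof -
    show "?deg w \<ge> 0 \<and> ?chg w \<le> 2 * ?deg w"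
      using that
    proof (induction w)
      case (Cons x w)
      then show ?case using chg(1)[of "fst x"] by auto
    qed simp
    show "w = []" if "?deg w = 0"
    proof (cases w)
      case (Cons x w')
      then have "?deg w' \<ge> 0" using \<open>set w \<subseteq> creation_modes\<close>
        by (induction w' arbitrary: w) auto
      then show ?thesis using \<open>set w \<subseteq> creation_modes\<close> Cons that by auto
    qed
  qed
  have G_nonzero: "\<exists>d q'. m = of_nat d \<and> q = of_int q' \<and> q' \<le> 2 * int d" if "x \<in> G m q" "x \<noteq> 0" for x m q
  proof -
    have "E m q \<noteq> {}" using that by (auto simp: G_def)
    then obtain w where w: "set w \<subseteq> creation_modes" "of_int (?deg w) = m" "of_int (?chg w) = q"
      by (auto simp: E_def)
    then show ?thesis
      using deg_bound(1)[OF w(1)] by (intro exI[of _ "nat (?deg w)"] exI[of _ "?chg w"]) auto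
  qed
  define good where "good d = (\<exists>q u. u \<in> I \<and> u \<in> G (of_nat d) q \<and> \<Phi> u \<noteq> 0)" for d :: nat
  \<comment> \<open>Split \<open>u0\<close> by degree and then by charge; both splittings stay
    inside \<open>I\<close>, and by linearity some component is not killed by \<Phi>.\<close>
  have "\<exists>d. good d"
  proof -
    have \<Phi>_span: "\<exists>x\<in>X. \<Phi> x \<noteq> 0" if "v \<in> U.span X" "\<Phi> v \<noteq> 0" for v X
    proof (rule ccontr)
      assume "\<not> ?thesis"
      then have "X \<subseteq> {u. \<Phi> u = 0}" by auto
      moreover have "U.subspace {u. \<Phi> u = 0}" by (auto simp: U.subspace_def \<Phi>')
      ultimately have "v \<in> {u. \<Phi> u = 0}" using U.span_minimal that(1) by blast
      then show False using that by simp
    qed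
    have "u0 \<in> I" using u0 by (simp add: I_def)
    then have "u0 \<in> U.span (\<Union>m. I \<inter> U.span (\<Union>q. E m q))"
      using U.invariant_decomposition[where E = "\<lambda>m. \<Union>q. E m q", OF I Imode DE _ spanE] by blast
    from \<Phi>_span[OF this u0(2)] obtain m u1 where u1: "u1 \<in> I" "u1 \<in> U.span (\<Union>q. E m q)" "\<Phi> u1 \<noteq> 0" by blast
    have "u1 \<in> U.span (\<Union>q. I \<inter> U.span (E m q))"
      using U.invariant_decomposition[where E = "\<lambda>q. E m q", OF I Imode _ u1(1,2)] H1 by blast
    from \<Phi>_span[OF this u1(3)] obtain q u2 where u2: "u2 \<in> I" "u2 \<in> G m q" "\<Phi> u2 \<noteq> 0" by (auto simp: G_def)
    have "u2 \<noteq> 0" using u2(3) \<Phi>'(3) by auto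
    then show ?thesis using G_nonzero[OF u2(2)] u2 by (auto simp: good_def)
  qed
  define d where "d = (LEAST d. good d)"
  have "good d" unfolding d_def using \<open>\<exists>d. good d\<close> by (rule LeastI_ex)
  then obtain q u where u: "u \<in> I" "u \<in> G (of_nat d) q" "\<Phi> u \<noteq> 0" by (auto simp: good_def)
  have "u \<noteq> 0" using u(3) \<Phi>'(3) by auto
  then obtain q0 where q0: "q = of_int q0" using G_nonzero[OF u(2)] by blast
  define R where "R M = (nprod U (J \<rho>) 0 ^^ M) u" for M
  have RI: "R M \<in> I" for M using u(1) by (induction M) (auto simp: R_def intro: Imode)
  have RG: "R M \<in> G (of_nat d) (of_int (q0 + int M * chg \<rho>))" for M
  proof (induction M)
    case 0
    then show ?case using u(2) q0 by (simp add: R_def)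
  next
    case (Suc M)
    have "R (Suc M) = nprod U (J \<rho>) 0 (R M)" by (simp add: R_def)
    then show ?case using G_mode[OF Suc, of \<rho> 0] by (simp add: algebra_simps)
  qed
  \<comment> \<open>After this many steps the charge exceeds \<open>2 d\<close>, where no nonzero
    vector of degree \<open>d\<close> exists.\<close>
  define M0 where "M0 = nat (2 * int d - q0 + 1)"
  have "R M0 = 0"
  proof (rule ccontr)
    assume "R M0 \<noteq> 0"
    from G_nonzero[OF RG this] have "q0 + int M0 * chg \<rho> \<le> 2 * int d"
      by (metis of_int_eq_iff of_nat_eq_iff)
    moreover have "int M0 * chg \<rho> \<ge> int M0 * 1" using chg(2) by (intro mult_left_mono) auto
    moreover have "int M0 \<ge> 2 * int d - q0 + 1" by (simp add: M0_def)
    ultimately show False by linarith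
  qed
  then have ex: "\<exists>M. \<Phi> (R M) = 0" using \<Phi>'(3) by (intro exI[of _ M0]) simp
  \<comment> \<open>The first power killed by \<Phi>, not the first that vanishes: only the image of
    \<open>i\<close> has to be singular.\<close>
  define M where "M = (LEAST M. \<Phi> (R M) = 0)"
  have M: "\<Phi> (R M) = 0" unfolding M_def using ex by (rule LeastI_ex)
  moreover have "\<Phi> (R 0) \<noteq> 0" using u(3) by (simp add: R_def)
  ultimately obtain M' where M': "M = Suc M'" by (cases M) auto
  then have nz: "\<Phi> (R M') \<noteq> 0" using not_less_Least[of M' "\<lambda>M. \<Phi> (R M) = 0"] by (auto simp: M_def)
  define i where "i = R M'"
  define qi where "qi = q0 + int M' * chg \<rho>"
  have i: "i \<in> I" "i \<in> G (of_nat d) (of_int qi)" "\<Phi> i \<noteq> 0" using RI RG nz by (auto simp: i_def qi_def)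
  have "\<exists>z. \<Phi> i = scl W z (vac W)"
  proof (rule singular)
    show "i \<in> U.span {?word w | w. ?chg w = qi}"
      using i(2) unfolding G_def by (rule subsetD[OF U.span_mono, rotated]) (auto simp: E_def)
    show "nprod W (\<Phi> (J a)) n (\<Phi> i) = 0" if n: "n \<ge> 1" for a n
    proof (rule ccontr)
      assume "nprod W (\<Phi> (J a)) n (\<Phi> i) \<noteq> 0"
      then have nz: "\<Phi> (nprod U (J a) n i) \<noteq> 0" by (simp add: \<Phi>')
      then have "nprod U (J a) n i \<noteq> 0" using \<Phi>'(3) by auto
      note x = G_mode[OF i(2), of a n]
      obtain d' where d': "of_nat d - of_int n = (of_nat d' :: complex)" using G_nonzero[OF x] \<open>nprod U (J a) n i \<noteq> 0\<close> by blast
      then have "good d'" using x nz Imode[OF i(1)] by (auto simp: good_def)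
      then have "d \<le> d'" unfolding d_def by (rule Least_le)
      moreover have "of_int (int d - n) = (of_int (int d') :: complex)" using d' by simp
      then have "int d - n = int d'" by (simp only: of_int_eq_iff)
      ultimately show False using n by simp
    qed
    have "R M = nprod U (J \<rho>) 0 i" by (simp add: R_def M' i_def)
    then show "nprod W (\<Phi> (J \<rho>)) 0 (\<Phi> i) = 0" using M by (simp add: \<Phi>')
    show "nprod W (\<Phi> \<eta>) 0 (\<Phi> i) = scl W (of_int qi) (\<Phi> i)"
      using G_eigen(2)[OF i(2)] by (metis \<Phi>'(2) \<Phi>'(6))
  qed
  then obtain z where z: "\<Phi> i = scl W z (vac W)" by blast
  have "nprod W (\<Phi> \<delta>) 1 (\<Phi> i) = scl W (of_nat d) (\<Phi> i)"
    using G_eigen(1)[OF i(2)] by (metis \<Phi>'(2) \<Phi>'(6))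
  moreover have "nprod W (\<Phi> \<delta>) 1 (\<Phi> i) = 0" by (simp add: z W.creation)
  ultimately have "d = 0" using i(3) by simp
  have "E 0 (of_int qi) \<subseteq> {vac U}"
    using deg_bound(2) by (auto simp: E_def) (metis act_simps(1))
  then have "i \<in> U.span {vac U}" using i(2) U.span_mono unfolding G_def \<open>d = 0\<close> by auto
  then obtain z' where z': "i = scl U z' (vac U)" by (auto simp: U.span_singleton)
  then have "f i = scl S z' (vac S)" by (simp add: f')
  then have "z' = 0" using i(1) f(3) by (simp add: I_def)
  then show False using i(3) z' \<Phi>'(3) by simp
qed

section \<open>Tensor products\<close>

lemma functional_exists:
  assumes "vector_space s" "v \<noteq> 0"
  shows "\<exists>\<phi>. Vector_Spaces.linear s ((*) :: complex \<Rightarrow> complex \<Rightarrow> complex) \<phi> \<and> \<phi> v = 1"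
proof -
  interpret vector_space s by fact
  interpret c: vector_space "(*) :: complex \<Rightarrow> complex \<Rightarrow> complex"
    by unfold_locales (auto simp: algebra_simps)
  interpret p: vector_space_pair s "(*) :: complex \<Rightarrow> complex \<Rightarrow> complex" by unfold_locales
  have "independent {v}" using assms(2) by (simp add: dependent_single)
  from p.linear_independent_extend[OF this, of "\<lambda>_. 1"] show ?thesis by auto
qed

locale tensor_product =
  X: vertex_superalgebra X + P: vertex_superalgebra P + T: vertex_superalgebra T
  for X :: "'x::ab_group_add vsa" and P :: "'p::ab_group_add vsa" and T :: "'t::ab_group_add vsa" +
  fixes \<beta> :: "'x \<Rightarrow> 'p \<Rightarrow> 't"
  assumes presents: "presents (scl T) (\<lambda>(a, b). \<beta> a b) (tensor_relators (scl X) (scl P))"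
    and vac_T: "vac T = \<beta> (vac X) (vac P)"
    and part_T: "a \<in> part X p \<Longrightarrow> b \<in> part P q \<Longrightarrow> \<beta> a b \<in> part T (p \<noteq> q)"
    and nprod_T: "b \<in> part P p \<Longrightarrow> a' \<in> part X q \<Longrightarrow> nprod T (\<beta> a b) n (\<beta> a' b') =
      scl T (ksign p q) (Sum_any (\<lambda>i::int. \<beta> (nprod X a i a') (nprod P b (n - 1 - i) b')))"
begin

lemma beta_linear [simp]:
  "\<beta> (a + a') b = \<beta> a b + \<beta> a' b" "\<beta> a (b + b') = \<beta> a b + \<beta> a b'"
  "\<beta> (scl X z a) b = scl T z (\<beta> a b)" "\<beta> a (scl P z b) = scl T z (\<beta> a b)"
proof -
  note rel = presents_relator[OF presents]
  have "Poly_Mapping.single (a + a', b) 1 - Poly_Mapping.single (a, b) 1 - Poly_Mapping.single (a', b) 1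
    \<in> tensor_relators (scl X) (scl P)"
    "Poly_Mapping.single (a, b + b') 1 - Poly_Mapping.single (a, b) 1 - Poly_Mapping.single (a, b') 1
    \<in> tensor_relators (scl X) (scl P)"
    "Poly_Mapping.single (scl X z a, b) 1 - Poly_Mapping.single (a, b) z \<in> tensor_relators (scl X) (scl P)"
    "Poly_Mapping.single (a, scl P z b) 1 - Poly_Mapping.single (a, b) z \<in> tensor_relators (scl X) (scl P)"
    unfolding tensor_relators_def by blast+
  from this[THEN rel] show
    "\<beta> (a + a') b = \<beta> a b + \<beta> a' b" "\<beta> a (b + b') = \<beta> a b + \<beta> a b'"
    "\<beta> (scl X z a) b = scl T z (\<beta> a b)" "\<beta> a (scl P z b) = scl T z (\<beta> a b)"
    by (simp_all add: lin_ext_diff lin_ext_add lin_ext_single T.vector_space_axioms algebra_simps)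
qed

lemma beta_zero [simp]: "\<beta> 0 b = 0" "\<beta> a 0 = 0"
  using beta_linear(3)[of 0 0 b] beta_linear(4)[of a 0 0] by auto

lemma beta_minus [simp]: "\<beta> (- a) b = - \<beta> a b" "\<beta> a (- b) = - \<beta> a b"
  using beta_linear(3)[of "- 1" a b] beta_linear(4)[of a "- 1" b] by auto

lemma beta_diff [simp]: "\<beta> (a - a') b = \<beta> a b - \<beta> a' b" "\<beta> a (b - b') = \<beta> a b - \<beta> a b'"
  using beta_linear(1)[of a "- a'" b] beta_linear(2)[of a b "- b'"] by auto

lemma T_span: "v \<in> T.span {\<beta> a b | a b. True}"
  using presents_span[OF T.vector_space_axioms presents, of v]
  by (rule subsetD[OF T.span_mono, rotated]) auto

text \<open>Functionals equal to 1 at \<open>a\<close> and at \<open>b\<close> multiply to a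
  bilinear map that kills the tensor relators, so it descends to a functional on \<open>T\<close>
  with value 1 at \<open>\<beta> a b\<close>.\<close>

lemma beta_eq_zero:
  assumes "\<beta> a b = 0"
  shows "a = 0 \<or> b = 0"
proof (rule ccontr)
  assume "\<not> ?thesis"
  then obtain \<phi> \<psi> where \<phi>: "Vector_Spaces.linear (scl X) (*) \<phi>" "\<phi> a = (1::complex)"
    and \<psi>: "Vector_Spaces.linear (scl P) (*) \<psi>" "\<psi> b = (1::complex)"
    using functional_exists X.vector_space_axioms P.vector_space_axioms by metis
  interpret c: vector_space "(*) :: complex \<Rightarrow> complex \<Rightarrow> complex"
    by unfold_locales (auto simp: algebra_simps)
  have "\<exists>h. Vector_Spaces.linear (scl T) (*) h \<and> (\<forall>i. h ((\<lambda>(a, b). \<beta> a b) i) = (\<lambda>(a, b). \<phi> a * \<psi> b) i)"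
  proof (rule presents_lift[OF T.vector_space_axioms c.vector_space_axioms presents])
    fix r assume "r \<in> tensor_relators (scl X) (scl P)"
    then show "lin_ext (*) (\<lambda>(a, b). \<phi> a * \<psi> b) r = 0"
      using \<phi>(1) \<psi>(1) unfolding tensor_relators_def Vector_Spaces.linear_iff
      by (auto simp: lin_ext_diff lin_ext_single c.vector_space_axioms distrib_left distrib_right)
  qed
  then obtain h where h: "Vector_Spaces.linear (scl T) (*) h" "\<forall>i. h ((\<lambda>(a, b). \<beta> a b) i) = (\<lambda>(a, b). \<phi> a * \<psi> b) i"
    by blast
  have "h (\<beta> a b) = 1" using h(2) \<phi>(2) \<psi>(2) by (metis (mono_tags, lifting) mult_1 old.prod.case)
  moreover have "h 0 = 0" using h(1) module_hom.zero[OF Vector_Spaces.linear.axioms(3)[OF h(1)]] by blast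
  ultimately show False using assms by simp
qed

lemma nprod_T_sum:
  assumes "b \<in> part P p" "a' \<in> part X q" and "finite A"
    and "\<And>i. i \<notin> A \<Longrightarrow> nprod X a i a' = 0 \<or> nprod P b (n - 1 - i) b' = 0"
  shows "nprod T (\<beta> a b) n (\<beta> a' b') =
      scl T (ksign p q) (\<Sum>i\<in>A. \<beta> (nprod X a i a') (nprod P b (n - 1 - i) b'))"
proof -
  have "Sum_any (\<lambda>i::int. \<beta> (nprod X a i a') (nprod P b (n - 1 - i) b')) =
    (\<Sum>i\<in>A. \<beta> (nprod X a i a') (nprod P b (n - 1 - i) b'))"
    by (rule Sum_any.expand_superset[OF assms(3)]) (use assms(4) beta_zero in fastforce)
  then show ?thesis using nprod_T[OF assms(1,2)] by simp
qed

lemma nprod_left_factor: "nprod T (\<beta> a (vac P)) n (\<beta> a' b') = \<beta> (nprod X a n a') b'"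
proof -
  have "nprod T (\<beta> a (vac P)) n (\<beta> a' b') = \<beta> (nprod X a n a') b'" if "a' \<in> part X q" for a' q
    by (subst nprod_T_sum[OF P.vac_even that, of "{n}"]) (auto simp: P.vacuum)
  moreover obtain a0 a1 where "a' = a0 + a1" "a0 \<in> part X False" "a1 \<in> part X True" using X.part_sum by blast
  ultimately show ?thesis by simp
qed

lemma nprod_right_factor:
  assumes "b \<in> part P p" "a' \<in> part X q"
  shows "nprod T (\<beta> (vac X) b) n (\<beta> a' b') = scl T (ksign p q) (\<beta> a' (nprod P b n b'))"
  by (subst nprod_T_sum[OF assms, of "{- 1}"]) (auto simp: X.vacuum)

lemma nprod_right_factor_even:
  assumes "b \<in> part P False"
  shows "nprod T (\<beta> (vac X) b) n (\<beta> a' b') = \<beta> a' (nprod P b n b')"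
proof -
  obtain a0 a1 where "a' = a0 + a1" "a0 \<in> part X False" "a1 \<in> part X True" using X.part_sum by blast
  then show ?thesis
    using nprod_right_factor[OF assms, of a0 False n b'] nprod_right_factor[OF assms, of a1 True n b'] by simp
qed

end

lemma tensor_vsa_locale:
  assumes "vertex_superalgebra X" "vertex_superalgebra P" "tensor_vsa X P T"
  obtains \<beta> where "tensor_product X P T \<beta>"
proof -
  from assms(3) obtain \<beta> where *: "vertex_superalgebra T"
    "presents (scl T) (\<lambda>(a, b). \<beta> a b) (tensor_relators (scl X) (scl P))"
    "vac T = \<beta> (vac X) (vac P)"
    "\<forall>p q. \<forall>a \<in> part X p. \<forall>b \<in> part P q. \<beta> a b \<in> part T (p \<noteq> q)"
    "\<forall>p q n a b'. \<forall>b \<in> part P p. \<forall>a' \<in> part X q.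
          nprod T (\<beta> a b) n (\<beta> a' b') =
          scl T (ksign p q)
            (Sum_any (\<lambda>i::int. \<beta> (nprod X a i a') (nprod P b (n - 1 - i) b')))"
    unfolding tensor_vsa_def by blast
  have "tensor_product X P T \<beta>"
    unfolding tensor_product_def tensor_product_axioms_def using assms(1,2) * by blast
  then show ?thesis by (rule that)
qed

section \<open>Lattice-type vertex algebras\<close>

locale lattice_type =
  P: vertex_superalgebra P for P :: "'p::ab_group_add vsa" +
  fixes t :: complex and J :: "heis \<Rightarrow> 'p" and e :: "int \<Rightarrow> 'p"
  assumes t: "t \<noteq> 0" and odd_zero: "part P True = {0}" and vac_P: "vac P = e 0"
    and presents: "presents (scl P) (\<lambda>(w, j). act P J w (e j))
         (induced_relators (\<lambda>_. False) heis_bracket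
            (\<lambda>(a, n) j. if n = 0 then of_int j * t * heis_form a hC else 0))"
    and e_mode: "(\<forall>x \<in> set w. snd x < 0) \<Longrightarrow>
          nprod P (e j) n (act P J w (e j')) =
          Sum_any (\<lambda>s::nat. if n + 1 \<le> int s
            then exp_coeff (scl P)
                   (\<lambda>i v. scl P (of_int j * t) (nprod P (J hC) (- int i) v)) (nat (int s - n - 1))
                   (exp_coeff (scl P)
                     (\<lambda>i v. scl P (- (of_int j * t)) (nprod P (J hC) (int i) v)) s
                     (act P J w (e (j + j'))))
            else 0)"
begin

lemma P_even [simp]: "a \<in> part P False"
proof -
  obtain b c where "a = b + c" "b \<in> part P False" "c \<in> part P True" using P.part_sum by blast
  then show ?thesis using odd_zero by simp
qed

lemmas relations = P.induced_relations[OF presents P_even]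

lemma heis_commute:
  "nprod P (J a) m (nprod P (J b) n v) = nprod P (J b) n (nprod P (J a) m v) +
     scl P (if m + n = 0 then of_int m * heis_form a b else 0) v"
  using mode_relationsD(2)[OF relations(1), of a m b n v]
  by (simp add: lin_ext_single P.vector_space_axioms)

lemma heis_e: "n \<ge> 0 \<Longrightarrow> nprod P (J a) n (e j) = scl P (if n = 0 then of_int j * t * heis_form a hC else 0) (e j)"
  using relations(2)[of n a j] by simp

lemma P_span: "v \<in> P.span {act P J w (e j) | w j. set w \<subseteq> creation_modes}"
proof -
  have "{act P J w (e j) | w j. True} \<subseteq> P.span {act P J w (e j) | w j. set w \<subseteq> creation_modes}"
  proof clarify
    fix w j
    have "act P J w (e j) \<in> P.span {act P J u (e j) | u. set u \<subseteq> creation_modes}"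
    proof (rule P.creation_span[OF relations(1)])
      show "length w \<le> 1" if "w \<in> Poly_Mapping.keys (heis_bracket x y)" for x y w
        using that by (cases x; cases y) (auto split: if_splits)
      show "nprod P (J a) n (e j) \<in> P.span {e j}" if "(a, n) \<notin> creation_modes" for a n
        using that heis_e[of n a j] by (simp add: P.span_scale P.span_base)
    qed
    then show "act P J w (e j) \<in> P.span {act P J w (e j) | w j. set w \<subseteq> creation_modes}"
      by (rule subsetD[OF P.span_mono, rotated]) auto
  qed
  then show ?thesis using relations(3)[of v] P.span_minimal[OF _ P.subspace_span] by blast
qed

text \<open>On a lattice vector the annihilating exponential is trivial because \<open>c(i)\<close>
  kills it for \<open>i > 0\<close>, so only \<open>s = 0\<close> contributes. Products with other
  vectors are obtained later by commuting Heisenberg modes past \<open>e i\<close>.\<close>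

lemma e_mode_e:
  shows e_nonneg: "n \<ge> 0 \<Longrightarrow> nprod P (e i) n (e j) = 0"
    and e_minus_one: "nprod P (e i) (- 1) (e j) = e (i + j)"
    and e_minus_two: "nprod P (e i) (- 2) (e j) = scl P (of_int i * t) (nprod P (J hC) (- 1) (e (i + j)))"
proof -
  let ?A = "\<lambda>k v. scl P (- (of_int i * t)) (nprod P (J hC) (int k) v)"
  let ?C = "\<lambda>k v. scl P (of_int i * t) (nprod P (J hC) (- int k) v)"
  have ann: "exp_coeff (scl P) ?A s (e k) = (if s = 0 then e k else 0)" for s k
  proof (induction s rule: less_induct)
    case (less s)
    show ?case
    proof (cases s)
      case (Suc r)
      have "(\<Sum>l\<le>r. ?A (Suc l) (exp_coeff (scl P) ?A (r - l) (e k))) = 0"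
        using less Suc by (intro sum.neutral) (auto simp: heis_e)
      then show ?thesis by (simp add: Suc)
    qed simp
  qed
  have zero: "exp_coeff (scl P) ?C r 0 = 0" for r
  proof (induction r rule: less_induct)
    case (less r)
    then show ?case by (cases r) auto
  qed
  have *: "nprod P (e i) n (e j) = (if n + 1 \<le> 0 then exp_coeff (scl P) ?C (nat (- n - 1)) (e (i + j)) else 0)" for n
  proof -
    have "nprod P (e i) n (act P J [] (e j)) = Sum_any (\<lambda>s::nat. if n + 1 \<le> int s
       then exp_coeff (scl P) ?C (nat (int s - n - 1)) (exp_coeff (scl P) ?A s (act P J [] (e (i + j)))) else 0)"
      by (rule e_mode) simp
    also have "\<dots> = (\<Sum>s\<in>{0::nat}. if n + 1 \<le> int s
       then exp_coeff (scl P) ?C (nat (int s - n - 1)) (exp_coeff (scl P) ?A s (act P J [] (e (i + j)))) else 0)"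
      by (rule Sum_any.expand_superset) (auto simp: ann zero simp del: P.scale_minus_left split: if_splits)
    finally show ?thesis by simp
  qed
  show "n \<ge> 0 \<Longrightarrow> nprod P (e i) n (e j) = 0" by (simp add: *)
  show "nprod P (e i) (- 1) (e j) = e (i + j)" by (simp add: *)
  show "nprod P (e i) (- 2) (e j) = scl P (of_int i * t) (nprod P (J hC) (- 1) (e (i + j)))" by (simp add: *)
qed

lemma translate_e: "nprod P (e j) (- 2) (vac P) = scl P (of_int j * t) (nprod P (J hC) (- 1) (e j))"
  using e_minus_two[of j 0] by (simp add: vac_P)

end

section \<open>Fock spaces\<close>

text \<open>A concrete module with highest weight vector \<delta> separates the generator from zero:
  applying a word to \<delta> and reading the coefficient at \<open>s0\<close>, on the summand
  \<open>j0\<close> only, is a functional that kills all relators and takes the value 1 at the empty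
  word. Centrality of the supercommutators keeps the module explicit.\<close>

lemma central_presentation_nonzero:
  fixes op :: "'j \<Rightarrow> 'g \<times> int \<Rightarrow> ('s \<Rightarrow> complex) \<Rightarrow> 's \<Rightarrow> complex"
  assumes s: "vector_space s" and pr: "presents s (\<lambda>(w, j). F w j) (induced_relators par B \<chi>)"
    and B: "\<And>x y. B x y = Poly_Mapping.single [] (\<zeta> x y)"
    and lin: "\<And>j x f z g. op j x (\<lambda>m. f m + z * g m) = (\<lambda>m. op j x f m + z * op j x g m)"
    and rel: "\<And>j x y h. op j x (op j y h) =
      (\<lambda>m. ksign (par (fst x)) (par (fst y)) * op j y (op j x h) m + \<zeta> x y * h m)"
    and \<delta>: "\<And>j x. snd x \<ge> 0 \<Longrightarrow> op j x \<delta> = (\<lambda>m. \<chi> x j * \<delta> m)" "\<delta> s0 = 1"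
  shows "F [] j0 \<noteq> 0"
proof
  assume "F [] j0 = 0"
  interpret c: vector_space "(*) :: complex \<Rightarrow> complex \<Rightarrow> complex"
    by unfold_locales (auto simp: algebra_simps)
  define \<phi> where "\<phi> = (\<lambda>(w, j). if j = j0 then foldr (op j) w \<delta> s0 else 0)"
  have word: "foldr (op j) u (\<lambda>m. f m + z * g m) = (\<lambda>m. foldr (op j) u f m + z * foldr (op j) u g m)" for j u f z g
    by (induction u) (auto simp: lin)
  have word_scale: "foldr (op j) u (\<lambda>m. z * g m) = (\<lambda>m. z * foldr (op j) u g m)" for j u z g
  proof -
    have "foldr (op j) u (\<lambda>_. 0) = (\<lambda>_. 0)"
    proof
      fix m
      show "foldr (op j) u (\<lambda>_. 0) m = 0"
        using fun_cong[OF word[of j u "\<lambda>_. 0" 1 "\<lambda>_. 0"], of m] by simp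
    qed
    then show ?thesis using word[of j u "\<lambda>_. 0" z g] by simp
  qed
  have "lin_ext (*) \<phi> r = 0" if "r \<in> induced_relators par B \<chi>" for r
    using that unfolding induced_relators_def
  proof (elim UnE; elim CollectE exE conjE)
    fix u x y v j
    assume r: "r = Poly_Mapping.single (u @ [x, y] @ v, j) 1
       - Poly_Mapping.single (u @ [y, x] @ v, j) (ksign (par (fst x)) (par (fst y)))
       - (\<Sum>w \<in> Poly_Mapping.keys (B x y).
            Poly_Mapping.single (u @ w @ v, j) (Poly_Mapping.lookup (B x y) w))"
    have "lin_ext (*) \<phi> r = \<phi> (u @ [x, y] @ v, j) - ksign (par (fst x)) (par (fst y)) * \<phi> (u @ [y, x] @ v, j)
       - \<zeta> x y * \<phi> (u @ v, j)"
      by (cases "\<zeta> x y = 0")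
        (auto simp: r B lin_ext_diff lin_ext_sum lin_ext_single c.vector_space_axioms)
    also have "\<dots> = 0"
    proof (cases "j = j0")
      case True
      define h where "h = foldr (op j) v \<delta>"
      have "\<phi> (u @ [x, y] @ v, j) = foldr (op j) u (op j x (op j y h)) s0"
        by (simp add: \<phi>_def h_def True)
      also have "op j x (op j y h) =
         (\<lambda>m. (ksign (par (fst x)) (par (fst y)) * op j y (op j x h) m) + \<zeta> x y * h m)" by (rule rel)
      also have "foldr (op j) u \<dots> s0 = ksign (par (fst x)) (par (fst y)) * \<phi> (u @ [y, x] @ v, j) + \<zeta> x y * \<phi> (u @ v, j)"
        by (subst word) (simp add: word_scale \<phi>_def h_def True)
      finally show ?thesis by simp
    qed (simp add: \<phi>_def)
    finally show "lin_ext (*) \<phi> r = 0" .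
  next
    fix u x j
    assume r: "r = Poly_Mapping.single (u @ [x], j) 1 - Poly_Mapping.single (u, j) (\<chi> x j)" "snd x \<ge> 0"
    then show "lin_ext (*) \<phi> r = 0"
      by (simp add: lin_ext_diff lin_ext_single c.vector_space_axioms \<phi>_def \<delta>(1) word_scale)
  qed
  moreover have "lin_ext s (\<lambda>(w, j). F w j) (Poly_Mapping.single ([], j0) 1) = 0"
  proof -
    interpret vector_space s by fact
    show ?thesis using \<open>F [] j0 = 0\<close> by (simp add: lin_ext_single s)
  qed
  then have "Poly_Mapping.single ([], j0) 1 \<in> free.span (induced_relators par B \<chi>)"
    using pr by (auto simp: presents_def)
  ultimately have "lin_ext (*) \<phi> (Poly_Mapping.single ([], j0) 1) = 0"
    using lin_ext_kernel[OF c.vector_space_axioms] by blast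
  then show False by (simp add: lin_ext_single c.vector_space_axioms \<phi>_def \<delta>(2))
qed

text \<open>
  Vectors of the Fock spaces below are arbitrary coefficient functions on monomials; a finite support
  is not required, since the operators act on coefficients one at a time.
\<close>

definition boson_create :: "'i \<Rightarrow> ('i multiset \<Rightarrow> complex) \<Rightarrow> 'i multiset \<Rightarrow> complex" where
  "boson_create i g m = (if i \<in># m then g (m - {#i#}) else 0)"

text \<open>The derivative with respect to the variable \<open>i\<close>, read on coefficients;
  \<open>boson_create\<close> is multiplication by that variable.\<close>

definition boson_annihilate :: "'i \<Rightarrow> ('i multiset \<Rightarrow> complex) \<Rightarrow> 'i multiset \<Rightarrow> complex" where
  "boson_annihilate i g m = of_nat (Suc (count m i)) * g (add_mset i m)"

lemma boson_create_commute: "boson_create i (boson_create k g) = boson_create k (boson_create i g)"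
proof
  fix m
  show "boson_create i (boson_create k g) m = boson_create k (boson_create i g) m"
  proof (cases "i = k")
    case False
    then show ?thesis by (auto simp: boson_create_def in_diff_count add_mset_commute count_eq_zero_iff)
  qed simp
qed

lemma boson_annihilate_commute:
  "boson_annihilate i (boson_annihilate k g) = boson_annihilate k (boson_annihilate i g)"
  by (rule ext) (auto simp: boson_annihilate_def add_mset_commute)

lemma boson_commutator:
  "boson_annihilate i (boson_create k g) =
     (\<lambda>m. boson_create k (boson_annihilate i g) m + (if i = k then 1 else 0) * g m)"
proof
  fix m
  show "boson_annihilate i (boson_create k g) m =
     boson_create k (boson_annihilate i g) m + (if i = k then 1 else 0) * g m"
  proof (cases "i = k")
    case True
    then show ?thesis
      by (cases "k \<in># m") (auto simp: boson_create_def boson_annihilate_def not_in_iff algebra_simps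
          elim!: multi_member_split dest!: multi_member_split)
  next
    case False
    then show ?thesis
      by (cases "k \<in># m") (auto simp: boson_create_def boson_annihilate_def add_mset_commute dest!: multi_member_split)
  qed
qed

fun heis_dual :: "heis \<Rightarrow> heis" where
  "heis_dual hC = hD" | "heis_dual hD = hC"

text \<open>Negative modes multiply by variables. A positive mode \<open>a(n)\<close> is
  \<open>2 n\<close> times the derivative in the variable of the dual letter, because the form pairs
  \<open>c\<close> only with \<open>d\<close>, with value 2. Zero modes act by the
  character.\<close>

definition fock_op :: "(heis \<Rightarrow> complex) \<Rightarrow> heis \<times> int \<Rightarrow> ((heis \<times> nat) multiset \<Rightarrow> complex) \<Rightarrow>
    (heis \<times> nat) multiset \<Rightarrow> complex" where
  "fock_op \<chi> x g = (case x of (a, n) \<Rightarrow>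
     if n < 0 then boson_create (a, nat (- n)) g
     else if n = 0 then (\<lambda>m. \<chi> a * g m)
     else (\<lambda>m. 2 * of_int n * boson_annihilate (heis_dual a, nat n) g m))"

lemma boson_linear:
  "boson_create i (\<lambda>m. f m + z * g m) = (\<lambda>m. boson_create i f m + z * boson_create i g m)"
  "boson_create i (\<lambda>m. z * g m) = (\<lambda>m. z * boson_create i g m)"
  "boson_annihilate i (\<lambda>m. f m + z * g m) = (\<lambda>m. boson_annihilate i f m + z * boson_annihilate i g m)"
  "boson_annihilate i (\<lambda>m. z * g m) = (\<lambda>m. z * boson_annihilate i g m)"
  by (auto simp: boson_create_def boson_annihilate_def algebra_simps)

lemma fock_op_linear: "fock_op \<chi> x (\<lambda>m. f m + z * g m) = (\<lambda>m. fock_op \<chi> x f m + z * fock_op \<chi> x g m)"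
  by (auto simp: fock_op_def boson_linear algebra_simps split: prod.splits)

lemma fock_op_commutator:
  "fock_op \<chi> (a, m) (fock_op \<chi> (b, n) h) =
     (\<lambda>s. fock_op \<chi> (b, n) (fock_op \<chi> (a, m) h) s + (if m + n = 0 then of_int m * heis_form a b else 0) * h s)"
proof -
  have form: "heis_form a b = (if heis_dual a = b then 2 else 0)" "heis_dual a = b \<longleftrightarrow> heis_dual b = a"
    by (cases a; cases b; simp)+
  show ?thesis
  proof (cases m "0::int" rule: linorder_cases; cases n "0::int" rule: linorder_cases)
    assume "m < 0" "n < 0"
    then show ?thesis by (auto simp: fock_op_def boson_create_commute)
  next
    assume *: "m < 0" "n > 0"
    have "nat n = nat (- m) \<longleftrightarrow> m + n = 0" using * by auto
    then show ?thesis
      using * form(2) by (cases "m + n = 0")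
        (auto simp: fock_op_def boson_linear boson_commutator algebra_simps form(1) dest: minus_unique)
  next
    assume *: "m > 0" "n < 0"
    have "nat m = nat (- n) \<longleftrightarrow> m + n = 0" using * by auto
    then show ?thesis
      using * form(2) by (auto simp: fock_op_def boson_linear boson_commutator algebra_simps form(1))
  next
    assume *: "m > 0" "n > 0"
    then show ?thesis
      by (auto simp: fock_op_def boson_linear boson_annihilate_commute[of "(heis_dual a, nat m)"] algebra_simps)
  qed (auto simp: fock_op_def boson_linear algebra_simps)
qed

lemma (in lattice_type) e_nonzero: "e j \<noteq> 0"
proof -
  define \<delta> :: "(heis \<times> nat) multiset \<Rightarrow> complex" where "\<delta> m = (if m = {#} then 1 else 0)" for m
  have "(\<lambda>w j. act P J w (e j)) [] j \<noteq> 0"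
  proof (rule central_presentation_nonzero[OF P.vector_space_axioms presents,
        where op = "\<lambda>j. fock_op (\<lambda>a. of_int j * t * heis_form a hC)" and \<delta> = \<delta> and ?s0.0 = "{#}"])
    show "heis_bracket x y = Poly_Mapping.single []
       (if snd x + snd y = 0 then of_int (snd x) * heis_form (fst x) (fst y) else 0)" for x y
      by (cases x; cases y) simp
    show "fock_op (\<lambda>a. of_int j * t * heis_form a hC) x \<delta> =
      (\<lambda>m. (case x of (a, n) \<Rightarrow> \<lambda>j. if n = 0 then of_int j * t * heis_form a hC else 0) j * \<delta> m)"
      if "snd x \<ge> 0" for j x
      using that by (cases x) (auto simp: fock_op_def boson_annihilate_def \<delta>_def)
    show "fock_op (\<lambda>a. of_int j * t * heis_form a hC) x (fock_op (\<lambda>a. of_int j * t * heis_form a hC) y h) =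
      (\<lambda>m. ksign False False * fock_op (\<lambda>a. of_int j * t * heis_form a hC) y
          (fock_op (\<lambda>a. of_int j * t * heis_form a hC) x h) m +
        (if snd x + snd y = 0 then of_int (snd x) * heis_form (fst x) (fst y) else 0) * h m)" for j x y h
      using fock_op_commutator[of _ "fst x" "snd x" "fst y" "snd y" h] by simp
  qed (auto simp: fock_op_linear \<delta>_def)
  then show ?thesis by simp
qed

text \<open>The sign for moving the factor \<open>k\<close> past the smaller factors of an exterior
  monomial. The elements of \<open>S\<close> below \<open>k\<close> are finitely many even when
  \<open>S\<close> is infinite.\<close>

definition clifford_sign :: "nat set \<Rightarrow> nat \<Rightarrow> complex" where
  "clifford_sign S k = (- 1) ^ card {s \<in> S. s < k}"

lemma clifford_sign_insert:
  "clifford_sign (insert j S) k = (if j < k \<and> j \<notin> S then - clifford_sign S k else clifford_sign S k)"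
proof (cases "j < k \<and> j \<notin> S")
  case True
  then have "{s \<in> insert j S. s < k} = insert j {s \<in> S. s < k}" by auto
  then show ?thesis using True by (simp add: clifford_sign_def)
next
  case False
  then have "{s \<in> insert j S. s < k} = {s \<in> S. s < k}" by auto
  then show ?thesis using False by (simp add: clifford_sign_def)
qed

lemma clifford_sign_remove:
  "clifford_sign (S - {j}) k = (if j < k \<and> j \<in> S then - clifford_sign S k else clifford_sign S k)"
  using clifford_sign_insert[of j "S - {j}" k] by (cases "j \<in> S") (auto simp: insert_absorb)

lemma clifford_sign_square: "clifford_sign S k * (clifford_sign S k * z) = z"
  by (simp add: clifford_sign_def flip: mult.assoc power_add)

text \<open>Exterior multiplication and contraction. The modes \<open>-1 - s\<close> and
  \<open>s\<close> belong to the same index \<open>s\<close>, since these are the pairs with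
  anticommutator 1.\<close>

definition clifford_op :: "unit \<times> int \<Rightarrow> (nat set \<Rightarrow> complex) \<Rightarrow> nat set \<Rightarrow> complex" where
  "clifford_op x g S = (let n = snd x in
     if n < 0 then (if nat (- 1 - n) \<in> S then clifford_sign S (nat (- 1 - n)) * g (S - {nat (- 1 - n)}) else 0)
     else (if nat n \<in> S then 0 else clifford_sign S (nat n) * g (insert (nat n) S)))"

lemma clifford_op_anticommutator:
  "clifford_op x (clifford_op y h) = (\<lambda>S. - clifford_op y (clifford_op x h) S +
     (if snd x + snd y + 1 = 0 then 1 else 0) * h S)"
proof
  fix S
  define m n where "m = snd x" and "n = snd y"
  consider "m < 0" "n < 0" | "m < 0" "n \<ge> 0" | "m \<ge> 0" "n < 0" | "m \<ge> 0" "n \<ge> 0" by linarith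
  then show "clifford_op x (clifford_op y h) S = - clifford_op y (clifford_op x h) S +
     (if snd x + snd y + 1 = 0 then 1 else 0) * h S"
  proof cases
    case 1
    define i k where "i = nat (- 1 - m)" and "k = nat (- 1 - n)"
    have "S - {i} - {k} = S - {k} - {i}" by auto
    then show ?thesis
      using 1 by (cases i k rule: linorder_cases)
        (auto simp: clifford_op_def Let_def m_def[symmetric] n_def[symmetric] i_def[symmetric] k_def[symmetric] clifford_sign_remove)
  next
    case 2
    define i k where "i = nat (- 1 - m)" and "k = nat n"
    have eq: "i = k \<longleftrightarrow> m + n + 1 = 0" using 2 by (auto simp: i_def k_def)
    have "insert k (S - {i}) = insert k S - {i}" if "i \<noteq> k" using that by auto
    then show ?thesis
      using 2 eq by (cases i k rule: linorder_cases)
        (auto simp: clifford_op_def Let_def m_def[symmetric] n_def[symmetric] i_def[symmetric] k_def[symmetric]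
          clifford_sign_remove clifford_sign_insert clifford_sign_square insert_absorb)
  next
    case 3
    define i k where "i = nat m" and "k = nat (- 1 - n)"
    have eq: "i = k \<longleftrightarrow> m + n + 1 = 0" using 3 by (auto simp: i_def k_def)
    have "insert i (S - {k}) = insert i S - {k}" if "i \<noteq> k" using that by auto
    then show ?thesis
      using 3 eq by (cases i k rule: linorder_cases)
        (auto simp: clifford_op_def Let_def m_def[symmetric] n_def[symmetric] i_def[symmetric] k_def[symmetric]
          clifford_sign_remove clifford_sign_insert clifford_sign_square insert_absorb)
  next
    case 4
    define i k where "i = nat m" and "k = nat n"
    have "insert i (insert k S) = insert k (insert i S)" by auto
    then show ?thesis
      using 4 by (cases i k rule: linorder_cases)
        (auto simp: clifford_op_def Let_def m_def[symmetric] n_def[symmetric] i_def[symmetric] k_def[symmetric] clifford_sign_insert)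
  qed
qed

lemma fermion_vac_nonzero:
  assumes "vertex_superalgebra F"
    and pr: "presents (scl F) (\<lambda>(w, j::unit). act F J w (vac F)) (induced_relators (\<lambda>_. True) fermion_bracket (\<lambda>x j. 0))"
  shows "vac F \<noteq> 0"
proof -
  interpret vertex_superalgebra F by fact
  define \<delta> :: "nat set \<Rightarrow> complex" where "\<delta> S = (if S = {} then 1 else 0)" for S
  have "(\<lambda>w (j::unit). act F J w (vac F)) [] () \<noteq> 0"
  proof (rule central_presentation_nonzero[OF vector_space_axioms pr,
        where op = "\<lambda>j. clifford_op" and \<delta> = \<delta> and ?s0.0 = "{}"])
    show "fermion_bracket x y = Poly_Mapping.single [] (if snd x + snd y + 1 = 0 then 1 else 0)" for x y
      by (cases x; cases y) simp
    show "clifford_op x (\<lambda>m. f m + z * g m) = (\<lambda>m. clifford_op x f m + z * clifford_op x g m)" for x f z g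
      by (auto simp: clifford_op_def Let_def algebra_simps)
    show "clifford_op x (clifford_op y h) = (\<lambda>S. ksign True True * clifford_op y (clifford_op x h) S +
     (if snd x + snd y + 1 = 0 then 1 else 0) * h S)" for x y h
      by (simp add: clifford_op_anticommutator[of x y])
    show "clifford_op x \<delta> = (\<lambda>m. 0 * \<delta> m)" if "0 \<le> snd x" for x
      using that by (auto simp: clifford_op_def Let_def \<delta>_def)
  qed (auto simp: \<delta>_def)
  then show ?thesis by simp
qed

section \<open>Heisenberg modes and the conformal vector of the lattice factor\<close>

context lattice_type
begin

lemma J_state: "J a = nprod P (J a) (- 1) (e 0)"
  using P.creation(1)[of "J a"] by (simp add: vac_P)

lemma heis_ope: "n \<ge> 0 \<Longrightarrow> nprod P (J a) n (J b) = scl P (if n = 1 then heis_form a b else 0) (vac P)"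
  by (subst J_state[of b]) (auto simp: heis_commute[of a n b "- 1"] heis_e vac_P)

text \<open>The momentum lattice is isotropic: \<open>c(0)\<close> acts on \<open>e j\<close> by a
  multiple of <c, c> = 0, and it commutes with all Heisenberg modes.\<close>

lemma c_zero: "nprod P (J hC) 0 v = 0"
  using P_span[of v]
proof (induction rule: P.span_induct_alt)
  case (step z x y)
  then obtain w j where x: "x = act P J w (e j)" by blast
  have "nprod P (J hC) 0 (act P J w (e j)) = 0"
    by (induction w) (auto simp: heis_e heis_commute[of hC 0])
  then show ?case using step x by simp
qed simp

lemma heis_e_commute:
  "nprod P (J a) m (nprod P (e j) n v) =
     nprod P (e j) n (nprod P (J a) m v) + scl P (of_int j * t * heis_form a hC) (nprod P (e j) (m + n) v)"
  using P.commutator[OF P_even P_even, of 1 "J a" "e j" m n v] by (simp add: heis_e)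

text \<open>The standard conformal vector for the pairing <c, d> = 2, without background charge:
  every \<open>e j\<close> gets weight 0, so the weight counts oscillators only.\<close>

definition heis_conformal :: 'p where
  "heis_conformal = scl P (1 / 2) (nprod P (J hC) (- 1) (J hD))"

lemma heis_conformal_mode:
  assumes "\<And>j. j \<ge> 2 \<Longrightarrow> nprod P (J hC) (int j) v = 0" "\<And>j. j \<ge> 2 \<Longrightarrow> nprod P (J hD) (n + int j) v = 0"
  shows "nprod P heis_conformal n v = scl P (1 / 2)
    (nprod P (J hC) (- 1) (nprod P (J hD) n v) + nprod P (J hD) (n - 1) (nprod P (J hC) 0 v) +
     (nprod P (J hC) (- 2) (nprod P (J hD) (n + 1) v) + nprod P (J hD) (n - 2) (nprod P (J hC) 1 v)))"
  unfolding heis_conformal_def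
  using P.normal_product[OF P_even P_even assms] by (simp add: numeral_2_eq_2)

lemma heis_conformal_J:
  "nprod P heis_conformal 0 (J a) = nprod P (J a) (- 2) (vac P)"
  "nprod P heis_conformal 1 (J a) = J a"
  by (cases a; subst heis_conformal_mode; simp add: heis_ope P.creation flip: P.scale_right_distrib)+

lemma heis_conformal_e:
  "nprod P heis_conformal 0 (e j) = nprod P (e j) (- 2) (vac P)"
  "nprod P heis_conformal 1 (e j) = 0"
  by (subst heis_conformal_mode; simp add: heis_e translate_e)+

lemma heis_grading:
  "nprod P heis_conformal 1 (nprod P (J a) n v) =
     nprod P (J a) n (nprod P heis_conformal 1 v) + scl P (- of_int n) (nprod P (J a) n v)"
  "nprod P heis_conformal 1 (nprod P (e j) n v) =
     nprod P (e j) n (nprod P heis_conformal 1 v) + scl P (- of_int n - 1) (nprod P (e j) n v)"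
  using P.grading[OF P_even P_even, of heis_conformal "J a" 1 n v]
    P.grading[OF P_even P_even, of heis_conformal "e j" 0 n v]
  by (simp_all add: heis_conformal_J heis_conformal_e)

end

section \<open>Tensor products with a lattice-type factor\<close>

locale lattice_tensor = tensor_product X P T \<beta> + lattice_type P t J e
  for X :: "'x::ab_group_add vsa" and P :: "'p::ab_group_add vsa" and T :: "'t::ab_group_add vsa"
    and \<beta> t J e
begin

abbreviation \<iota> :: "'p \<Rightarrow> 't" where "\<iota> b \<equiv> \<beta> (vac X) b"

lemma \<iota>_even: "\<iota> b \<in> part T False"
  using part_T[OF X.vac_even P_even, of b] by simp

lemma \<iota>_mode: "nprod T (\<iota> b) n (\<beta> v b') = \<beta> v (nprod P b n b')"
  by (rule nprod_right_factor_even) simp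

lemma T_induct [case_names zero add tensor]:
  assumes "Q 0" "\<And>x y z. Q x \<Longrightarrow> Q y \<Longrightarrow> Q (scl T z x + y)"
    and "\<And>v w j. set w \<subseteq> creation_modes \<Longrightarrow> Q (\<beta> v (act P J w (e j)))"
  shows "Q u"
proof -
  have tensor: "Q (\<beta> v b)" for v b
    using P_span[of b]
  proof (induction rule: P.span_induct_alt)
    case (step z x y)
    then show ?case using assms(2,3) by auto
  qed (use assms(1) in simp)
  show ?thesis
    using T_span[of u] by (induction rule: T.span_induct_alt) (use assms(1,2) tensor in auto)
qed

lemma translate_\<iota>_e: "nprod T (\<iota> (e j)) (- 2) (vac T) = scl T (of_int j * t) (nprod T (\<iota> (J hC)) (- 1) (\<iota> (e j)))"
  by (simp add: vac_T \<iota>_mode translate_e)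

lemma T_c_zero: "nprod T (\<iota> (J hC)) 0 u = 0"
  by (induction u rule: T_induct) (auto simp: \<iota>_mode c_zero)

lemma T_c_e_commute: "nprod T (\<iota> (J hC)) m (nprod T (\<iota> (e j)) n u) = nprod T (\<iota> (e j)) n (nprod T (\<iota> (J hC)) m u)"
  using T.supercommute[OF \<iota>_even \<iota>_even, of "J hC" "e j" m n u] by (simp add: \<iota>_mode heis_e)

lemma T_e_commute: "nprod T (\<iota> (e i)) m (nprod T (\<iota> (e j)) n u) = nprod T (\<iota> (e j)) n (nprod T (\<iota> (e i)) m u)"
  using T.supercommute[OF \<iota>_even \<iota>_even, of "e i" "e j" m n u] by (simp add: \<iota>_mode e_nonneg)

text \<open>The coefficients of \<open>\<partial> Y(e\<^sup>\<alpha>, z) = :\<alpha>(z) Y(e\<^sup>\<alpha>, z):\<close>; the induction steps below all run over this recursion.\<close>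

lemma e_recursion:
  assumes "\<And>i. i \<ge> N \<Longrightarrow> nprod T (\<iota> (J hC)) (int i) u = 0" "\<And>i. i \<ge> N \<Longrightarrow> nprod T (\<iota> (e j)) (n + int i) u = 0"
  shows "scl T (- of_int n) (nprod T (\<iota> (e j)) (n - 1) u) = scl T (of_int j * t)
     (\<Sum>i<N. nprod T (\<iota> (J hC)) (- 1 - int i) (nprod T (\<iota> (e j)) (n + int i) u) +
       nprod T (\<iota> (e j)) (n - 1 - int i) (nprod T (\<iota> (J hC)) (int i) u))"
  using T.normal_product[OF \<iota>_even \<iota>_even assms]
  by (simp only: T.translate_mode[symmetric] translate_\<iota>_e T.nprod_scale_left ksign_simps T.scale_one)

text \<open>Oscillator degree in the lattice factor; \<open>X\<close> is given degree 0, whatever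
  grading it has itself.\<close>

definition level :: "complex \<Rightarrow> 't set" where
  "level m = {\<beta> v (act P J w (e j)) | v w j. set w \<subseteq> creation_modes \<and> of_int (word_sum (\<lambda>x. - snd x) w) = m}"

lemma T_level_span: "u \<in> T.span (\<Union>m. level m)"
proof (induction u rule: T_induct)
  case (tensor v w j)
  then show ?case by (intro T.span_base) (auto simp: level_def)
qed (auto simp: T.span_zero T.span_add T.span_scale)

lemma level_eigen: "x \<in> level m \<Longrightarrow> nprod T (\<iota> heis_conformal) 1 x = scl T m x"
proof -
  assume "x \<in> level m"
  then obtain v w j where x: "x = \<beta> v (act P J w (e j))" "of_int (word_sum (\<lambda>x. - snd x) w) = m"
    by (auto simp: level_def)
  have "word_sum (\<lambda>x. - of_int (snd x)) w = m"
    unfolding x(2)[symmetric] by (induction w) auto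
  then show ?thesis
    using P.act_eigen[where \<gamma> = "\<lambda>x. - of_int (snd x)" and w = heis_conformal and k = 1 and v = "e j" and c = 0 and J = J and u = w] heis_grading(1)
    by (simp add: x(1) \<iota>_mode heis_conformal_e)
qed

lemma level_nonzero:
  assumes "x \<in> T.span (level m)" "x \<noteq> 0"
  obtains n :: nat where "m = of_nat n"
proof -
  have "level m \<noteq> {}" using assms by auto
  then obtain w :: "heis word" where w: "set w \<subseteq> creation_modes" "of_int (word_sum (\<lambda>x. - snd x) w) = m"
    by (auto simp: level_def)
  have "word_sum (\<lambda>x. - snd x) w \<ge> 0" using w(1) by (induction w) auto
  then show ?thesis using w(2) that[of "nat (word_sum (\<lambda>x. - snd x) w)"] by auto
qed

lemma level_zero: "level 0 \<subseteq> {\<beta> v (e j) | v j. True}"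
proof
  fix x assume "x \<in> level 0"
  then obtain v w j where x: "x = \<beta> v (act P J w (e j))" "set w \<subseteq> creation_modes" "word_sum (\<lambda>x. - snd x) w = 0"
    by (auto simp: level_def)
  have pos: "word_sum (\<lambda>x. - snd x) w \<ge> 0" if "set w \<subseteq> creation_modes" for w :: "heis word"
    using that by (induction w) auto
  have "w = []"
    using x(2,3) pos[of "tl w"] by (cases w) auto
  then show "x \<in> {\<beta> v (e j) | v j. True}" using x(1) by auto
qed

lemma level_span: 
  assumes "nprod T (\<iota> heis_conformal) 1 u = scl T m u"
  shows "u \<in> T.span (level m)"
  using level_eigen T_level_span assms by (rule T.eigen_span)

text \<open>In the normally ordered form of the level operator every surviving term contains a
  positive mode or \<open>c(0)\<close> on the right, so it kills \<open>u\<close>, and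
  \<open>u\<close> has level 0.\<close>

lemma vacuum_space:
  assumes "\<And>i a. i \<ge> 1 \<Longrightarrow> nprod T (\<iota> (J a)) i u = 0"
  shows "u \<in> T.span {\<beta> v (e j) | v j. True}"
proof -
  have "\<iota> heis_conformal = scl T (1 / 2) (nprod T (\<iota> (J hC)) (- 1) (\<iota> (J hD)))"
    by (simp add: heis_conformal_def \<iota>_mode)
  moreover have "nprod T (nprod T (\<iota> (J hC)) (- 1) (\<iota> (J hD))) 1 u = 0"
    by (subst T.normal_product[OF \<iota>_even \<iota>_even, of 1]) (auto simp: assms T_c_zero)
  ultimately have "u \<in> T.span (level 0)" by (intro level_span) simp
  then show ?thesis using T.span_mono[OF level_zero] by blast
qed

text \<open>The vectors in question form a space \<open>K\<close> stable under the level operator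
  and under all modes of \<open>c\<close>. By induction on the level the positive modes of
  \<open>c\<close> kill such a vector; then the recursion for \<open>e j\<close> kills it by all
  remaining modes of \<open>e j\<close>, although some normally ordered product of
  \<open>e j\<close> with its inverse is the identity.\<close>

lemma e_modes_injective:
  assumes j: "j \<noteq> 0" and u: "\<And>n. n \<ge> - 1 \<Longrightarrow> nprod T (\<iota> (e j)) n u = 0"
  shows "u = 0"
proof -
  define K where "K = {u. \<forall>n \<ge> - 1. nprod T (\<iota> (e j)) n u = 0}"
  have K: "T.subspace K" by (auto simp: K_def T.subspace_def)
  have grade: "nprod T (\<iota> heis_conformal) 1 (nprod T (\<iota> (e j)) n u) =
     nprod T (\<iota> (e j)) n (nprod T (\<iota> heis_conformal) 1 u) + scl T (- of_int n - 1) (nprod T (\<iota> (e j)) n u)"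
    "nprod T (\<iota> heis_conformal) 1 (nprod T (\<iota> (J hC)) n u) =
     nprod T (\<iota> (J hC)) n (nprod T (\<iota> heis_conformal) 1 u) + scl T (- of_int n) (nprod T (\<iota> (J hC)) n u)" for n u
    using T.grading[OF \<iota>_even \<iota>_even, of heis_conformal "e j" 0 n u]
      T.grading[OF \<iota>_even \<iota>_even, of heis_conformal "J hC" 1 n u]
    by (simp_all add: \<iota>_mode vac_T heis_conformal_e heis_conformal_J)
  have KN: "nprod T (\<iota> heis_conformal) 1 x \<in> K" if "x \<in> K" for x
  proof -
    have "nprod T (\<iota> (e j)) n (nprod T (\<iota> heis_conformal) 1 x) = 0" if "n \<ge> - 1" for n
      using grade(1)[of n x] that \<open>x \<in> K\<close> by (simp add: K_def)
    then show ?thesis by (simp add: K_def)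
  qed
  have Kc: "nprod T (\<iota> (J hC)) m x \<in> K" if "x \<in> K" for x m
    using that by (auto simp: K_def simp flip: T_c_e_commute)
  have zero: "x = 0" if "x \<in> K" "x \<in> T.span (level (of_nat n))" for x n
    using that
  proof (induction n arbitrary: x rule: less_induct)
    case (less n)
    have eig: "nprod T (\<iota> heis_conformal) 1 x = scl T (of_nat n) x"
      by (rule T.eigen_span_eigenvector[where E = level, OF level_eigen less.prems(2)])
    \<comment> \<open>A positive mode \<open>c(i)\<close> lowers the level by \<open>i\<close> and
      stays in \<open>K\<close>, so the induction hypothesis applies; the mode \<open>c(0)\<close>
      is zero anyway.\<close>
    have c: "nprod T (\<iota> (J hC)) (int i) x = 0" for i
    proof (rule ccontr)
      let ?y = "nprod T (\<iota> (J hC)) (int i) x"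
      assume y: "?y \<noteq> 0"
      then have "i \<noteq> 0" by (metis T_c_zero of_nat_0)
      have "nprod T (\<iota> heis_conformal) 1 ?y = scl T (of_nat n - of_nat i) ?y"
        by (simp add: grade(2) eig algebra_simps)
      then have ys: "?y \<in> T.span (level (of_nat n - of_nat i))" by (rule level_span)
      then obtain l where l: "(of_nat n :: complex) - of_nat i = of_nat l" using y level_nonzero by blast
      then have "(of_nat n :: complex) = of_nat (l + i)" by (simp add: algebra_simps)
      then have "n = l + i" by (simp only: of_nat_eq_iff)
      then show False
        using less.IH[of l ?y] ys l Kc[OF less.prems(1)] y \<open>i \<noteq> 0\<close> by auto
    qed
    have all: "nprod T (\<iota> (e j)) (- 1 - int k) x = 0" for k
    proof (induction k rule: less_induct)
      case (less k)
      show ?case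
      proof (cases "k = 0")
        case True
        then show ?thesis using \<open>x \<in> K\<close> by (simp add: K_def)
      next
        case False
        have e0: "nprod T (\<iota> (e j)) (- int k + int i) x = 0" for i
        proof (cases "i < k")
          case True
          then have "- int k + int i = - 1 - int (k - 1 - i)" by auto
          then show ?thesis using less[of "k - 1 - i"] True by simp
        next
          case False
          then show ?thesis using \<open>x \<in> K\<close> by (simp add: K_def)
        qed
        \<comment> \<open>All nonnegative modes of \<open>c\<close> kill \<open>x\<close>, so the
          recursion at \<open>-k\<close> expresses \<open>k\<close> times the mode
          \<open>-k - 1\<close> by modes already known to vanish.\<close>
        have "scl T (- of_int (- int k)) (nprod T (\<iota> (e j)) (- int k - 1) x) = 0"
          by (subst e_recursion[where N = 0]) (use c e0 in auto)
        moreover have "- 1 - int k = - int k - 1" by simp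
        ultimately show ?thesis using False by (simp only:) simp
      qed
    qed
    have all': "nprod T (\<iota> (e j)) n x = 0" for n
    proof (cases "n \<ge> - 1")
      case True
      then show ?thesis using \<open>x \<in> K\<close> by (simp add: K_def)
    next
      case False
      then have "n = - 1 - int (nat (- 1 - n))" by auto
      then show ?thesis using all by metis
    qed
    have "x = nprod T (vac T) (- 1) x" by (simp add: T.vacuum)
    \<comment> \<open>The vacuum, whose mode -1 is the identity, is the product of
      \<open>e (- j)\<close> and \<open>e j\<close>. In its expansion every term can be arranged to
      have a mode of \<open>e j\<close> acting on \<open>x\<close> first.\<close>
    also have "vac T = nprod T (\<iota> (e (- j))) (- 1) (\<iota> (e j))" by (simp add: \<iota>_mode e_minus_one vac_T vac_P)
    also obtain N where N: "\<forall>i \<ge> N. nprod T (\<iota> (e (- j))) (int i + 0) x = 0" using T.truncation_nat by blast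
    have "nprod T (nprod T (\<iota> (e (- j))) (- 1) (\<iota> (e j))) (- 1) x = 0"
      by (subst T.normal_product[OF \<iota>_even \<iota>_even, of N]) (use N all' in \<open>auto simp: T_e_commute[of j _ "- j"]\<close>)
    finally show ?case .
  qed
  have "u \<in> K" using u by (simp add: K_def)
  then have "u \<in> T.span (\<Union>m. K \<inter> T.span (level m))"
    using T.invariant_decomposition[where E = level, OF K KN level_eigen _ T_level_span] by blast
  also have "(\<Union>m. K \<inter> T.span (level m)) \<subseteq> {0}"
    using zero level_nonzero by auto metis
  then have "T.span (\<Union>m. K \<inter> T.span (level m)) \<subseteq> {0}" by (intro T.span_minimal) auto
  finally show ?thesis by simp
qed

text \<open>If \<open>M\<close> is the largest index with \<open>c(M) u\<close> nonzero, the
  recursion at \<open>M\<close> reduces to the single term \<open>e_(-1) c(M) u\<close>. Hence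
  \<open>c(M) u\<close> is killed by all modes of \<open>e j\<close> from -1 on, and it vanishes by
  \<open>e_modes_injective\<close>.\<close>

lemma e_annihilates:
  assumes j: "j \<noteq> 0" and u: "\<And>n. n \<ge> 0 \<Longrightarrow> nprod T (\<iota> (e j)) n u = 0" and "i \<ge> 1"
  shows "nprod T (\<iota> (J hC)) i u = 0"
proof (rule ccontr)
  assume nz: "nprod T (\<iota> (J hC)) i u \<noteq> 0"
  obtain N where N: "\<forall>i \<ge> N. nprod T (\<iota> (J hC)) (int i + 0) u = 0" using T.truncation_nat by blast
  define A where "A = {i::nat. nprod T (\<iota> (J hC)) (int i) u \<noteq> 0}"
  have "A \<subseteq> {..<N}" using N by (auto simp: A_def) (metis not_less)
  then have finA: "finite A" using finite_subset by blast
  have "nat i \<in> A" using nz \<open>i \<ge> 1\<close> by (simp add: A_def)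
  define M where "M = Max A"
  have M: "M \<in> A" unfolding M_def using finA \<open>nat i \<in> A\<close> by (intro Max_in) auto
  have Mmax: "nprod T (\<iota> (J hC)) (int l) u = 0" if "l > M" for l
    using that Max_ge[OF finA, of l] unfolding M_def A_def by (metis (mono_tags, lifting) linorder_not_le mem_Collect_eq)
  have "M \<noteq> 0" using M T_c_zero by (auto simp: A_def intro!: Nat.gr0I)
  let ?y = "nprod T (\<iota> (J hC)) (int M) u"
  have "scl T (- of_int (int M)) (nprod T (\<iota> (e j)) (int M - 1) u) = scl T (of_int j * t)
     (\<Sum>i<Suc M. nprod T (\<iota> (J hC)) (- 1 - int i) (nprod T (\<iota> (e j)) (int M + int i) u) +
       nprod T (\<iota> (e j)) (int M - 1 - int i) (nprod T (\<iota> (J hC)) (int i) u))"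
    by (rule e_recursion) (use Mmax u in auto)
  also have "nprod T (\<iota> (e j)) (int M - 1) u = 0" using u \<open>M \<noteq> 0\<close> by simp
  also have "(\<Sum>i<Suc M. nprod T (\<iota> (J hC)) (- 1 - int i) (nprod T (\<iota> (e j)) (int M + int i) u) +
       nprod T (\<iota> (e j)) (int M - 1 - int i) (nprod T (\<iota> (J hC)) (int i) u)) = nprod T (\<iota> (e j)) (- 1) ?y"
    using u by (simp flip: T_c_e_commute)
  finally have y1: "nprod T (\<iota> (e j)) (- 1) ?y = 0" using j t by simp
  have "nprod T (\<iota> (e j)) n ?y = 0" if "n \<ge> - 1" for n
  proof (cases "n = - 1")
    case False
    then show ?thesis using that u by (simp flip: T_c_e_commute)
  qed (use y1 in simp)
  from e_modes_injective[OF j this] show False using M by (simp add: A_def)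
qed

end

context vector_space
begin

lemma scale_collect:
  "scale a x + scale b x = scale (a + b) x" "x + scale b x = scale (1 + b) x"
  "scale a x + x = scale (a + 1) x" "x + x = scale 2 x"
  "scale a x + (scale b x + y) = scale (a + b) x + y" "x + (scale b x + y) = scale (1 + b) x + y"
  "scale a x + (x + y) = scale (a + 1) x + y" "x + (x + y) = scale 2 x + y"
  "- scale a x = scale (- a) x" "scale a x - scale b x = scale (a - b) x"
  "scale a x - x = scale (a - 1) x" "x - scale b x = scale (1 - b) x" "- x - scale b x = scale (- 1 - b) x"
  using scale_left_distrib[of 1 1 x] scale_left_distrib[of 1 b x] scale_left_distrib[of a 1 x]
    scale_left_diff_distrib[of a 1 x] scale_left_diff_distrib[of 1 b x]
    scale_left_diff_distrib[of "- 1" b x]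
  by (simp_all add: scale_left_distrib scale_left_diff_distrib add.assoc[symmetric])

lemma scale_two: "scale 2 x = x + x"
  by (simp add: scale_collect)

lemma scale_three: "scale 3 x = x + (x + x)"
  by (simp add: scale_collect)

end

section \<open>Lattice components of the images of \<open>f\<close> and \<open>y\<close>\<close>

context lattice_type
begin

text \<open>
  With \<open>t = 1\<close> these vectors serve for \<open>sl(2)\<close>, with \<open>t = 1/2\<close> for \<open>osp(1,2)\<close>.  The Heisenberg vector \<open>\<nu>\<close>
  is orthogonal to \<open>h\<close> and normalized by \<open>\<langle>\<nu>, \<gamma>\<rangle> = 1\<close>.
\<close>

definition h_vec :: "complex \<Rightarrow> 'p" where
  "h_vec k = J hD + scl P (k / 2) (J hC)"

definition \<nu> :: "complex \<Rightarrow> 'p" where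
  "\<nu> k = scl P (1 / (2 * t)) (J hD - scl P (k / 2) (J hC))"

definition q1 :: "complex \<Rightarrow> 'p" where "q1 k = nprod P (\<nu> k) (- 1) (e (- 1))"
definition q2 :: "complex \<Rightarrow> 'p" where "q2 k = nprod P (\<nu> k) (- 1) (q1 k)"
definition q3 :: "complex \<Rightarrow> 'p" where "q3 k = nprod P (\<nu> k) (- 2) (e (- 1))"

lemma h_mode: "nprod P (h_vec k) n v = nprod P (J hD) n v + scl P (k / 2) (nprod P (J hC) n v)"
  by (simp add: h_vec_def)

lemma \<nu>_mode: "nprod P (\<nu> k) n v = scl P (1 / (2 * t)) (nprod P (J hD) n v - scl P (k / 2) (nprod P (J hC) n v))"
  by (simp add: \<nu>_def)

text \<open>The norm <\<nu>, \<nu>> is \<open>- k / (2 t^2)\<close>, that is -k/2 for sl(2) and -2k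
  for osp(1,2).\<close>

lemma \<nu>_\<nu>: "nprod P (\<nu> k) m (nprod P (\<nu> k) n v) = nprod P (\<nu> k) n (nprod P (\<nu> k) m v) +
    scl P (if m + n = 0 then - of_int m * k / (2 * t\<^sup>2) else 0) v"
proof -
  have "- (of_int m * k) / (2 * t * (2 * t)) + - (of_int m * k) / (2 * t * (2 * t)) = - (of_int m * k) / (2 * t * t)"
    using t by (simp add: field_simps)
  then show ?thesis
    using heis_commute[of hD m hC n v] heis_commute[of hC m hD n v] heis_commute[of hD m hD n v] heis_commute[of hC m hC n v]
    by (simp add: \<nu>_mode P.scale_right_diff_distrib P.scale_right_distrib)
      (simp add: algebra_simps power2_eq_square flip: P.scale_left_distrib P.scale_left_diff_distrib)
qed

lemma h_\<nu>: "nprod P (h_vec k) m (nprod P (\<nu> k) n v) = nprod P (\<nu> k) n (nprod P (h_vec k) m v)"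
  using heis_commute[of hD m hC n v] heis_commute[of hC m hD n v] heis_commute[of hD m hD n v] heis_commute[of hC m hC n v]
  by (simp add: \<nu>_mode h_mode P.scale_right_diff_distrib P.scale_right_distrib algebra_simps)

lemma e_\<nu>: "nprod P (e j) n (nprod P (\<nu> k) m v) =
   nprod P (\<nu> k) m (nprod P (e j) n v) - scl P (of_int j) (nprod P (e j) (m + n) v)"
  using t heis_e_commute[of hD m j n v] heis_e_commute[of hC m j n v]
  by (simp add: \<nu>_mode P.scale_right_diff_distrib P.scale_right_distrib)

lemma \<nu>_e: "n \<ge> 0 \<Longrightarrow> nprod P (\<nu> k) n (e j) = (if n = 0 then scl P (of_int j) (e j) else 0)"
  using t by (simp add: \<nu>_mode heis_e)

lemma h_e: "n \<ge> 0 \<Longrightarrow> nprod P (h_vec k) n (e j) = (if n = 0 then scl P (2 * of_int j * t) (e j) else 0)"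
  by (simp add: h_mode heis_e mult.commute)

lemma h_h: "n \<ge> 0 \<Longrightarrow> nprod P (h_vec k) n (h_vec k) = (if n = 1 then scl P (2 * k) (vac P) else 0)"
  by (subst (2) h_vec_def) (simp add: h_mode heis_ope flip: P.scale_left_distrib)

lemma h_q: 
  assumes "n \<ge> 0"
  shows "nprod P (h_vec k) n (q1 k) = (if n = 0 then scl P (- 2 * t) (q1 k) else 0)"
    "nprod P (h_vec k) n (q2 k) = (if n = 0 then scl P (- 2 * t) (q2 k) else 0)"
    "nprod P (h_vec k) n (q3 k) = (if n = 0 then scl P (- 2 * t) (q3 k) else 0)"
  using assms by (simp_all add: q1_def q2_def q3_def h_\<nu> h_e)

lemma \<nu>_q1: "n \<ge> 0 \<Longrightarrow> nprod P (\<nu> k) n (q1 k) =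
    (if n = 0 then - q1 k else if n = 1 then scl P (- k / (2 * t\<^sup>2)) (e (- 1)) else 0)"
  unfolding q1_def by (subst \<nu>_\<nu>) (auto simp: \<nu>_e)

lemma \<nu>_q2: "n \<ge> 0 \<Longrightarrow> nprod P (\<nu> k) n (q2 k) =
    (if n = 0 then - q2 k else if n = 1 then scl P (- k / t\<^sup>2) (q1 k) else 0)"
  unfolding q2_def by (subst \<nu>_\<nu>) (auto simp: \<nu>_q1 q1_def[symmetric] P.scale_collect simp del: P.scale_minus_left)

lemma \<nu>_q3: "n \<ge> 0 \<Longrightarrow> nprod P (\<nu> k) n (q3 k) =
    (if n = 0 then - q3 k else if n = 2 then scl P (- k / t\<^sup>2) (e (- 1)) else 0)"
  unfolding q3_def by (subst \<nu>_\<nu>) (auto simp: \<nu>_e)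

lemma E_q:
  assumes "n \<ge> 0"
  shows "nprod P (e (- 1)) n (q1 k) = (if n = 0 then e (- 2) else 0)"
    and "nprod P (e (- 1)) (n + 1) (q2 k) = (if n = 0 then e (- 2) else 0)"
    and "nprod P (e (- 1)) (n + 1) (q3 k) = (if n = 0 then e (- 2) else 0)"
proof -
  have 1: "nprod P (e (- 1)) n (q1 k) = (if n = 0 then e (- 2) else 0)" if "n \<ge> 0" for n
    unfolding q1_def using that by (auto simp: e_\<nu> e_nonneg e_minus_one)
  show "nprod P (e (- 1)) n (q1 k) = (if n = 0 then e (- 2) else 0)" using 1 assms .
  show "nprod P (e (- 1)) (n + 1) (q2 k) = (if n = 0 then e (- 2) else 0)"
    unfolding q2_def using assms by (auto simp: e_\<nu> 1)
  show "nprod P (e (- 1)) (n + 1) (q3 k) = (if n = 0 then e (- 2) else 0)"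
    unfolding q3_def using assms by (auto simp: e_\<nu> e_nonneg e_minus_one)
qed

text \<open>Meant for the poles of high order: the bound on \<open>b\<close> removes all terms in
  which \<nu> acts last, and the bound on \<nu> leaves only its modes 0, 1 and 2 acting
  first.\<close>

lemma normal_product_\<nu>:
  assumes "\<And>j. j \<ge> 3 \<Longrightarrow> nprod P (\<nu> k) j v = 0" "\<And>j. j \<ge> n \<Longrightarrow> nprod P b j v = 0"
  shows "nprod P (nprod P (\<nu> k) (- 1) b) n v = nprod P b (n - 1) (nprod P (\<nu> k) 0 v) +
    nprod P b (n - 2) (nprod P (\<nu> k) 1 v) + nprod P b (n - 3) (nprod P (\<nu> k) 2 v)"
    and "nprod P (nprod P (\<nu> k) (- 2) b) n v = - (nprod P b (n - 2) (nprod P (\<nu> k) 0 v) +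
    scl P 2 (nprod P b (n - 3) (nprod P (\<nu> k) 1 v)) + scl P 3 (nprod P b (n - 4) (nprod P (\<nu> k) 2 v)))"
  using P.normal_product[OF P_even P_even, of 3 "\<nu> k" v b n] P.normal_product_deriv[OF P_even P_even, of 3 "\<nu> k" v b n] assms
  by (simp_all add: eval_nat_numeral add.assoc algebra_simps P.scale_three P.scale_two)

lemma q1_q1: "n \<ge> 1 \<Longrightarrow> nprod P (q1 k) n (q1 k) = (if n = 1 then scl P (- 1 - k / (2 * t\<^sup>2)) (e (- 2)) else 0)"
  by (subst q1_def, subst normal_product_\<nu>(1)) (auto simp: \<nu>_q1 E_q e_nonneg e_minus_one algebra_simps)

lemma q1_E: "n \<ge> 0 \<Longrightarrow> nprod P (q1 k) n (e (- 1)) = (if n = 0 then - e (- 2) else 0)"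
  by (subst q1_def, subst normal_product_\<nu>(1)) (auto simp: \<nu>_e e_nonneg e_minus_one)

lemma q1_e: "n \<ge> 0 \<Longrightarrow> nprod P (q1 k) n (e r) = (if n = 0 then scl P (of_int r) (e (r - 1)) else 0)"
  by (subst q1_def, subst normal_product_\<nu>(1)) (auto simp: \<nu>_e e_nonneg e_minus_one)

lemma q2_e: "n \<ge> 1 \<Longrightarrow> nprod P (q2 k) n (e r) = (if n = 1 then scl P (of_int (r ^ 2)) (e (r - 1)) else 0)"
  by (subst q2_def, subst normal_product_\<nu>(1)) (auto simp: \<nu>_e q1_e power2_eq_square)

lemma q3_e: "n \<ge> 1 \<Longrightarrow> nprod P (q3 k) n (e r) = (if n = 1 then scl P (- of_int r) (e (r - 1)) else 0)"
  by (subst q3_def, subst normal_product_\<nu>(2)) (auto simp: \<nu>_e e_nonneg e_minus_one)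

definition p_vec :: "complex \<Rightarrow> 'p" where
  "p_vec k = - q2 k - scl P (k + 1) (q3 k)"

text \<open>The factor \<open>r (r - k - 1)\<close> decides in which charges a multiple of
  \<open>vac X \<otimes> e r\<close> can be singular; the root \<open>k + 1\<close> is the one that
  the arithmetic of \<open>k\<close> excludes.\<close>

lemma p_e: "n \<ge> 1 \<Longrightarrow> nprod P (p_vec k) n (e r) =
    (if n = 1 then scl P (- of_int r * (of_int r - k - 1)) (e (r - 1)) else 0)"
  by (auto simp: p_vec_def q2_e q3_e algebra_simps power2_eq_square)

lemma E_p: "n \<ge> 1 \<Longrightarrow> nprod P (e (- 1)) n (p_vec k) = (if n = 1 then scl P (- (k + 2)) (e (- 2)) else 0)"
  using E_q(2,3)[of "n - 1" k] by (auto simp: p_vec_def P.scale_collect simp del: P.scale_minus_left)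

lemma h_p: "n \<ge> 0 \<Longrightarrow> nprod P (h_vec k) n (p_vec k) = (if n = 0 then scl P (- 2 * t) (p_vec k) else 0)"
  by (simp add: p_vec_def h_q algebra_simps)

lemma \<nu>_p: "t\<^sup>2 = 1 \<Longrightarrow> n \<ge> 0 \<Longrightarrow> nprod P (\<nu> k) n (p_vec k) =
    (if n = 0 then - p_vec k else if n = 1 then scl P k (q1 k) else if n = 2 then scl P (k * (k + 1)) (e (- 1)) else 0)"
  by (auto simp: p_vec_def \<nu>_q2 \<nu>_q3 algebra_simps)

lemma q1_p: "t\<^sup>2 = 1 \<Longrightarrow> n \<ge> 2 \<Longrightarrow> nprod P (q1 k) n (p_vec k) = (if n = 2 then scl P ((k + 1) * (k + 2)) (e (- 2)) else 0)"
  by (subst q1_def, subst normal_product_\<nu>(1))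
    (auto simp: \<nu>_p E_q e_nonneg e_minus_one E_p P.scale_collect simp del: P.scale_minus_left,
      simp add: algebra_simps)

text \<open>The polynomial equals \<open>- (k + 2)^2 c / 2\<close> for
  \<open>c = 1 - 6 (k + 1)^2 / (k + 2)\<close>, so it cancels the contribution of the Virasoro
  factor at exactly this central charge.\<close>

lemma p_p:
  assumes "t\<^sup>2 = 1" "n \<ge> 3"
  shows "nprod P (p_vec k) n (p_vec k) = (if n = 3 then scl P (3 * k ^ 3 + 23 / 2 * k\<^sup>2 + 13 * k + 4) (e (- 2)) else 0)"
proof -
  have "nprod P (q2 k) n (p_vec k) = (if n = 3 then scl P (- (5 / 2 * k\<^sup>2 + 5 * k + 2)) (e (- 2)) else 0)"
    unfolding q2_def
    by (subst normal_product_\<nu>(1))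
      (use assms in \<open>auto simp: \<nu>_p q1_p q1_q1 q1_E P.scale_collect power2_eq_square simp del: P.scale_minus_left\<close>,
        simp add: field_simps)
  moreover have "nprod P (q3 k) n (p_vec k) = (if n = 3 then scl P (- (3 * k\<^sup>2 + 6 * k + 2)) (e (- 2)) else 0)"
    unfolding q3_def
    by (subst normal_product_\<nu>(2))
      (use assms in \<open>auto simp: \<nu>_p E_p E_q e_nonneg e_minus_one P.scale_collect power2_eq_square simp del: P.scale_minus_left\<close>,
        simp add: algebra_simps)
  ultimately have "nprod P (p_vec k) n (p_vec k) = (if n = 3 then scl P ((5 / 2 * k\<^sup>2 + 5 * k + 2) + (k + 1) * (3 * k\<^sup>2 + 6 * k + 2)) (e (- 2)) else 0)"
    by (subst p_vec_def, cases "n = 3")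
      (simp_all add: P.scale_collect del: P.scale_minus_left, simp add: algebra_simps)
  also have "(5 / 2 * k\<^sup>2 + 5 * k + 2) + (k + 1) * (3 * k\<^sup>2 + 6 * k + 2) = 3 * k ^ 3 + 23 / 2 * k\<^sup>2 + 13 * k + 4"
    by (simp add: field_simps power2_eq_square power3_eq_cube)
  finally show ?thesis .
qed

lemma e1_E: "nprod P (e 1) (- 1) (e (- 1)) = vac P" "nprod P (e 1) (- 2) (e (- 1)) = scl P t (J hC)"
  by (simp_all add: e_minus_one e_minus_two vac_P flip: J_state)

lemma e1_q1:
  "nprod P (e 1) (- 1) (q1 k) = \<nu> k - scl P t (J hC)"
  "n \<ge> 0 \<Longrightarrow> nprod P (e 1) n (q1 k) = (if n = 0 then - vac P else 0)"
  unfolding q1_def by (auto simp: e_\<nu> e_nonneg e1_E P.creation)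

lemma e1_p:
  assumes "t = 1" "n \<ge> 0"
  shows "nprod P (e 1) n (p_vec k) = (if n = 0 then h_vec k else if n = 1 then scl P k (vac P) else 0)"
proof -
  have "nprod P (e 1) n (q2 k) = (if n = 0 then scl P t (J hC) - scl P 2 (\<nu> k) else if n = 1 then vac P else 0)"
    unfolding q2_def using assms(2) by (auto simp: e_\<nu> e1_q1 P.creation P.scale_two)
  moreover have "nprod P (e 1) n (q3 k) = (if n = 0 then - scl P t (J hC) else if n = 1 then - vac P else 0)"
    unfolding q3_def using assms(2) by (auto simp: e_\<nu> e_nonneg e1_E)
  moreover have "scl P 2 (\<nu> k) + scl P (k * t) (J hC) = h_vec k"
  proof -
    have *: "scl P 2 (\<nu> k) = scl P (1 / t) (J hD) - scl P (k / (2 * t)) (J hC)"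
      by (simp add: \<nu>_def P.scale_right_diff_distrib)
    have "scl P k (J hC) = scl P (k / 2) (J hC) + scl P (k / 2) (J hC)"
      by (simp flip: P.scale_left_distrib)
    then show ?thesis
      unfolding * h_vec_def using assms(1) by simp
  qed
  ultimately show ?thesis
    using assms(2) by (auto simp: p_vec_def algebra_simps)
qed

end

section \<open>Affine modes\<close>

context vertex_superalgebra
begin

lemma lin_ext_affine:
  "lin_ext (scl V) (\<lambda>w. act V K w v) (affine_bracket g k (a, m) (b, n)) =
     nprod V (lin_ext (scl V) K (bracket g a b)) (m + n) v +
     scl V (if m + n = 0 then of_int m * form g a b * k else 0) v"
  by (simp add: lin_ext_add lin_ext_single lin_ext_sum vector_space_axioms)
    (simp add: lin_ext_def nprod_sum_left)

lemma affine_mode_relationsI: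
  assumes K: "\<And>a. K a \<in> part V (odd_elt g a)"
    and ope: "\<And>a b n. n \<ge> 0 \<Longrightarrow> nprod V (K a) n (K b) =
      (if n = 0 then lin_ext (scl V) K (bracket g a b) else if n = 1 then scl V (form g a b * k) (vac V) else 0)"
  shows "mode_relations (odd_elt g) (affine_bracket g k) V K"
  unfolding mode_relations_def
proof (intro conjI allI)
  show "K a \<in> part V (odd_elt g a)" for a by (rule K)
  show "nprod V (K a) m (nprod V (K b) n v) =
        scl V (ksign (odd_elt g a) (odd_elt g b)) (nprod V (K b) n (nprod V (K a) m v)) +
        lin_ext (scl V) (\<lambda>w. act V K w v) (affine_bracket g k (a, m) (b, n))" for a m b n v
    using commutator[OF K K, of 2 a b m n v] unfolding lin_ext_affine
    by (simp add: ope numeral_2_eq_2 vacuum mult.assoc)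
qed

lemma affine_ope:
  assumes rel: "mode_relations (odd_elt g) (affine_bracket g k) V K" and "n \<ge> 0"
  shows "nprod V (K a) n (K b) =
      (if n = 0 then lin_ext (scl V) K (bracket g a b) else if n = 1 then scl V (form g a b * k) (vac V) else 0)"
proof -
  have "nprod V (K a) n (nprod V (K b) (- 1) (vac V)) =
     nprod V (lin_ext (scl V) K (bracket g a b)) (n + - 1) (vac V) +
     scl V (if n + - 1 = 0 then of_int n * form g a b * k else 0) (vac V)"
    using mode_relationsD(2)[OF rel, of a n b "- 1" "vac V"] \<open>n \<ge> 0\<close> unfolding lin_ext_affine
    by (simp add: creation)
  then show ?thesis using \<open>n \<ge> 0\<close> by (auto simp: creation)
qed

lemma affine_product:
  assumes rel: "mode_relations (odd_elt g) (affine_bracket g k) V K"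
  shows "nprod V (K a) n (nprod V (K b) (- 1) v) =
     scl V (ksign (odd_elt g a) (odd_elt g b)) (nprod V (K b) (- 1) (nprod V (K a) n v)) +
     nprod V (lin_ext (scl V) K (bracket g a b)) (n - 1) v + scl V (if n = 1 then form g a b * k else 0) v"
  using mode_relationsD(2)[OF rel, of a n b "- 1" v] unfolding lin_ext_affine by (simp add: add.assoc)

text \<open>A Sugawara vector is easier to test by applying affine modes to it. Skew symmetry then
  gives its own action on the generators.\<close>

lemma conformal_skew:
  assumes a: "a \<in> part V p" and w: "w \<in> part V False"
    and aw: "\<And>n. n \<ge> 0 \<Longrightarrow> nprod V a n w = (if n = 1 then a else 0)"
  shows "nprod V w 0 a = nprod V a (- 2) (vac V)" "nprod V w 1 a = a"
  using skew[OF a w, of 2 0] skew[OF a w, of 1 1] by (simp_all add: aw numeral_2_eq_2 creation)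

end

lemma quotient_generated:
  assumes "vacuum_vsa par B U" "simple_quotient U L"
  obtains J where "mode_relations par B L J" "\<And>v. v \<in> module.span (scl L) {act L J w (vac L) | w. True}"
proof -
  from assms(1) obtain J where U: "vertex_superalgebra U" and J: "\<And>a. J a \<in> part U (par a)"
    and pr: "presents (scl U) (\<lambda>(w, j::unit). act U J w (vac U)) (induced_relators par B (\<lambda>x j. 0))"
    unfolding vacuum_vsa_def by blast
  from assms(2) obtain f where L: "vertex_superalgebra L" and f: "vsa_hom U L f" "surj f"
    unfolding simple_quotient_def simple_vsa_def by blast
  interpret U: vertex_superalgebra U by fact
  interpret L: vertex_superalgebra L by fact
  have lin: "Vector_Spaces.linear (scl U) (scl L) f" using f(1) by (simp add: vsa_hom_def)
  interpret f: Vector_Spaces.linear "scl U" "scl L" f by (rule lin)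
  note f' = vsa_homD[OF f(1)]
  note rel = U.induced_relations[where g = "\<lambda>_. vac U", OF pr J]
  have "mode_relations par B L (f \<circ> J)"
    unfolding mode_relations_def
  proof (intro conjI allI)
    show "(f \<circ> J) a \<in> part L (par a)" for a using f'(7)[OF J] by simp
    fix a m b n v
    obtain u where v: "v = f u" using f(2) by (meson surjD)
    have "f (nprod U (J a) m (nprod U (J b) n u)) =
      f (scl U (ksign (par a) (par b)) (nprod U (J b) n (nprod U (J a) m u)) +
        lin_ext (scl U) (\<lambda>w. act U J w u) (B (a, m) (b, n)))"
      by (rule arg_cong[of _ _ f], rule mode_relationsD(2)[OF rel(1)])
    then show "nprod L ((f \<circ> J) a) m (nprod L ((f \<circ> J) b) n v) =
        scl L (ksign (par a) (par b)) (nprod L ((f \<circ> J) b) n (nprod L ((f \<circ> J) a) m v)) +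
        lin_ext (scl L) (\<lambda>w. act L (f \<circ> J) w v) (B (a, m) (b, n))"
      by (simp add: f'(1,2,6) v lin_ext_compose[OF lin] vsa_hom_act[OF f(1)])
  qed
  moreover have "v \<in> L.span {act L (f \<circ> J) w (vac L) | w. True}" for v
  proof -
    have "v \<in> f ` U.span {act U J w (vac U) | w. True}"
      using rel(3) f(2) by (metis (mono_tags, lifting) Collect_cong image_eqI surjD)
    also have "\<dots> = L.span (f ` {act U J w (vac U) | w. True})" by (rule f.span_image[symmetric])
    also have "f ` {act U J w (vac U) | w. True} = {act L (f \<circ> J) w (vac L) | w. True}"
      by (auto simp: vsa_hom_act[OF f(1)] f'(5) image_iff) (metis vsa_hom_act[OF f(1)] f'(5))
    finally show ?thesis .
  qed
  ultimately show ?thesis by (rule that)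
qed

section \<open>Singular vectors in simple Virasoro and Neveu-Schwarz vertex superalgebras\<close>

lemma (in vertex_superalgebra) lin_ext_L_bracket:
  "lin_ext (scl V) (\<lambda>w. act V J w v) (L_bracket \<omega> c (m - 1) (n - 1)) =
     scl V (of_int (m - n)) (nprod V (J \<omega>) (m + n - 1) v) +
     scl V (if m + n = 2 then ((of_int m - 1) ^ 3 - (of_int m - 1)) / 12 * c else 0) v"
proof -
  have "m - 1 + (n - 1) = 0 \<longleftrightarrow> m + n = 2" "m - 1 + (n - 1) + 1 = m + n - 1" by auto
  then show ?thesis
    unfolding L_bracket_def by (simp only: lin_ext_add lin_ext_single vector_space_axioms) simp
qed

text \<open>The mode \<open>\<omega>_(n)\<close> is \<open>L(n - 1)\<close>, so it has degree
  \<open>1 - n\<close>, and the operator of degree zero is \<open>\<omega>_(1) = L(0)\<close>. With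
  this grading the general result on singular vectors applies.\<close>

lemma virasoro_quotient:
  assumes "universal_virasoro c U" "simple_quotient U L"
  obtains \<omega> where "\<omega> \<in> part L False"
    "\<And>n. n \<ge> 1 \<Longrightarrow> nprod L \<omega> n \<omega> = (if n = 1 then scl L 2 \<omega> else if n = 3 then scl L (c / 2) (vac L) else 0)"
    "\<And>v l. (\<And>n. n \<ge> 2 \<Longrightarrow> nprod L \<omega> n v = 0) \<Longrightarrow> nprod L \<omega> 1 v = scl L l v \<Longrightarrow>
      v \<in> module.span (scl L) {vac L}"
proof -
  from assms(2) have simple: "simple_vsa L" by (simp add: simple_quotient_def)
  then interpret vertex_superalgebra L by (simp add: simple_vsa_def)
  obtain J where rel: "mode_relations (\<lambda>_. False) (virasoro_bracket c) L J"
    and gen: "\<And>v. v \<in> span {act L J w (vac L) | w. True}"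
    using quotient_generated[OF _ assms(2)] assms(1) unfolding universal_virasoro_def by blast
  define \<omega> where "\<omega> = J ()"
  have J: "J = (\<lambda>_. \<omega>)" by (simp add: \<omega>_def fun_eq_iff)
  have comm: "nprod L \<omega> m (nprod L \<omega> n v) = nprod L \<omega> n (nprod L \<omega> m v) +
     scl L (of_int (m - n)) (nprod L \<omega> (m + n - 1) v) +
     scl L (if m + n = 2 then ((of_int m - 1) ^ 3 - (of_int m - 1)) / 12 * c else 0) v" for m n v
    using mode_relationsD(2)[OF rel, of "()" m "()" n v]
    by (simp only: \<omega>_def virasoro_bracket.simps lin_ext_L_bracket ksign_simps scale_one add.assoc)
  have even: "\<omega> \<in> part L False" unfolding \<omega>_def by (rule mode_relationsD(1)[OF rel])
  \<comment> \<open>Both \<open>L(-1)\<close> and translation kill the vacuum and have the same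
    commutator with every \<open>\<omega>_(n)\<close>, so they agree on all words.\<close>
  have Leibniz: "nprod L \<omega> 0 u = nprod L u (- 2) (vac L)" for u
    using gen[of u]
  proof (induction rule: span_induct_alt)
    case (step z x y)
    then obtain w :: "unit word" where "x = act L (\<lambda>_. \<omega>) w (vac L)" unfolding J by blast
    moreover have "nprod L \<omega> 0 (act L (\<lambda>_. \<omega>) w (vac L)) = nprod L (act L (\<lambda>_. \<omega>) w (vac L)) (- 2) (vac L)"
    proof (induction w)
      case (Cons a w)
      then show ?case
        using comm[of 0 "snd a" "act L (\<lambda>_. \<omega>) w (vac L)"] translate_nprod[of \<omega> "snd a" "act L (\<lambda>_. \<omega>) w (vac L)"]
        by (simp add: \<omega>_def[symmetric])
    qed (simp add: creation vacuum)
    ultimately show ?case using step by simp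
  qed simp
  have sing: "v \<in> span {vac L}" if v: "\<And>n. n \<ge> 2 \<Longrightarrow> nprod L \<omega> n v = 0" "nprod L \<omega> 1 v = scl L l v" for v l
  proof (rule simple_singular[OF simple rel _ gen, where \<delta> = "()" and gr = "\<lambda>(a, n). of_int (1 - n)" and l = l])
    show "length w \<le> 1" if "w \<in> Poly_Mapping.keys (virasoro_bracket c x y)" for x y w
      using that Poly_Mapping.keys_add by (cases x; cases y) (fastforce simp: L_bracket_def split: if_splits)
    show "nprod L (J ()) 1 (nprod L (J a) n b) = nprod L (J a) n (nprod L (J ()) 1 b) +
        scl L (complex_of_real (case (a, n) of (a, n) \<Rightarrow> of_int (1 - n))) (nprod L (J a) n b)" for a n b
      using comm[of 1 n b] by (simp add: \<omega>_def)
  qed (use v Leibniz in \<open>auto simp: \<omega>_def\<close>)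
  have ope: "nprod L \<omega> n \<omega> = (if n = 1 then scl L 2 \<omega> else if n = 3 then scl L (c / 2) (vac L) else 0)"
    if "n \<ge> 1" for n
  proof -
    have "nprod L \<omega> n (nprod L \<omega> (- 1) (vac L)) =
      scl L (of_int (n + 1)) (nprod L \<omega> (n - 2) (vac L)) +
      scl L (if n = 3 then ((of_int n - 1) ^ 3 - (of_int n - 1)) / 12 * c else 0) (vac L)"
      using comm[of n "- 1" "vac L"] that by (simp add: creation)
    then show ?thesis using that by (auto simp: creation)
  qed
  show ?thesis by (rule that[OF even ope]) (use sing in blast)+
qed

text \<open>Here \<open>\<tau>_(n) = G(n - 1/2)\<close> has degree \<open>1/2 - n\<close>. The
  singular vector condition mentions only the positive modes of \<tau>, because these generate those
  of \<omega>.\<close>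

lemma ns_quotient:
  assumes "universal_ns c U" "simple_quotient U L"
  obtains \<omega> \<tau> where "\<omega> \<in> part L False" "\<tau> \<in> part L True"
    "\<And>m n v. nprod L \<tau> m (nprod L \<tau> n v) = - nprod L \<tau> n (nprod L \<tau> m v) +
      scl L 2 (nprod L \<omega> (m + n) v) +
      scl L (if m + n = 1 then c / 3 * ((of_int m - 1 / 2) ^ 2 - 1 / 4) else 0) v"
    "\<And>m n v. nprod L \<omega> m (nprod L \<tau> n v) = nprod L \<tau> n (nprod L \<omega> m v) +
     scl L ((of_int m - 1) / 2 - (of_int n - 1 / 2)) (nprod L \<tau> (m + n - 1) v)"
    "\<And>v l. (\<And>n. n \<ge> 1 \<Longrightarrow> nprod L \<tau> n v = 0) \<Longrightarrow> nprod L \<omega> 1 v = scl L l v \<Longrightarrow>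
      v \<in> module.span (scl L) {vac L}"
proof -
  from assms(2) have simple: "simple_vsa L" by (simp add: simple_quotient_def)
  then interpret vertex_superalgebra L by (simp add: simple_vsa_def)
  obtain J where rel: "mode_relations ns_odd (ns_bracket c) L J"
    and gen: "\<And>v. v \<in> span {act L J w (vac L) | w. True}"
    using quotient_generated[OF _ assms(2)] assms(1) unfolding universal_ns_def by blast
  define \<omega> \<tau> where "\<omega> = J Omega" and "\<tau> = J Tau"
  have even: "\<omega> \<in> part L False" using mode_relationsD(1)[OF rel, of Omega] by (simp add: \<omega>_def)
  have odd: "\<tau> \<in> part L True" using mode_relationsD(1)[OF rel, of Tau] by (simp add: \<tau>_def)
  have comm: "nprod L \<omega> m (nprod L \<omega> n v) = nprod L \<omega> n (nprod L \<omega> m v) +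
     scl L (of_int (m - n)) (nprod L \<omega> (m + n - 1) v) +
     scl L (if m + n = 2 then ((of_int m - 1) ^ 3 - (of_int m - 1)) / 12 * c else 0) v" for m n v
    using mode_relationsD(2)[OF rel, of Omega m Omega n v]
    by (simp only: \<omega>_def ns_bracket.simps lin_ext_L_bracket ns_odd.simps ksign_simps scale_one add.assoc)
  have comm_\<tau>: "nprod L \<omega> m (nprod L \<tau> n v) = nprod L \<tau> n (nprod L \<omega> m v) +
     scl L ((of_int m - 1) / 2 - (of_int n - 1 / 2)) (nprod L \<tau> (m + n - 1) v)" for m n v
    using mode_relationsD(2)[OF rel, of Omega m Tau n v]
    by (simp add: \<omega>_def \<tau>_def lin_ext_single vector_space_axioms)
  have anti: "nprod L \<tau> m (nprod L \<tau> n v) = - nprod L \<tau> n (nprod L \<tau> m v) +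
      scl L 2 (nprod L \<omega> (m + n) v) +
      scl L (if m + n = 1 then c / 3 * ((of_int m - 1 / 2) ^ 2 - 1 / 4) else 0) v" for m n v
    using mode_relationsD(2)[OF rel, of Tau m Tau n v]
    by (simp add: \<omega>_def \<tau>_def lin_ext_single lin_ext_add vector_space_axioms add.assoc)
  have Leibniz: "nprod L \<omega> 0 u = nprod L u (- 2) (vac L)" for u
    using gen[of u]
  proof (induction rule: span_induct_alt)
    case (step z x y)
    then obtain w where "x = act L J w (vac L)" by blast
    moreover have "nprod L \<omega> 0 (act L J w (vac L)) = nprod L (act L J w (vac L)) (- 2) (vac L)"
    proof (induction w)
      case (Cons a w)
      then show ?case
        using comm[of 0 "snd a" "act L J w (vac L)"] comm_\<tau>[of 0 "snd a" "act L J w (vac L)"]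
          translate_nprod[of "J (fst a)" "snd a" "act L J w (vac L)"]
        by (cases "fst a") (simp_all add: \<omega>_def[symmetric] \<tau>_def[symmetric])
    qed (simp add: creation vacuum)
    ultimately show ?case using step by simp
  qed simp
  have sing: "v \<in> span {vac L}" if v: "\<And>n. n \<ge> 1 \<Longrightarrow> nprod L \<tau> n v = 0" "nprod L \<omega> 1 v = scl L l v" for v l
  proof (rule simple_singular[OF simple rel _ gen, where \<delta> = Omega
        and gr = "\<lambda>(a, n). (if a = Omega then 1 else 1 / 2) - of_int n" and l = l])
    show "length w \<le> 1" if "w \<in> Poly_Mapping.keys (ns_bracket c x y)" for x y w
      using that Poly_Mapping.keys_add
      by (cases x; cases y; cases "fst x"; cases "fst y") (fastforce simp: L_bracket_def split: if_splits)+
    show "nprod L (J Omega) 1 (nprod L (J a) n b) = nprod L (J a) n (nprod L (J Omega) 1 b) +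
        scl L (complex_of_real (case (a, n) of (a, n) \<Rightarrow> (if a = Omega then 1 else 1 / 2) - of_int n)) (nprod L (J a) n b)" for a n b
      using comm[of 1 n b] comm_\<tau>[of 1 n b] by (cases a) (simp_all add: \<omega>_def \<tau>_def)
    \<comment> \<open>Modes of \<tau> have half-integral degree, so degree zero occurs only for
      \<open>L(0)\<close>, as the grading hypotheses demand.\<close>
    have half: "(1 / 2 :: real) = of_int n \<longleftrightarrow> False" "(1 / 2 :: real) < of_int n \<longleftrightarrow> n \<ge> 1" for n :: int
    proof -
      have "(1::real) \<noteq> of_int (2 * n)" by (metis of_int_1 of_int_eq_iff one_add_one mult_2 odd_one even_add dvd_triv_left)
      then show "(1 / 2 :: real) = of_int n \<longleftrightarrow> False" by auto
      show "(1 / 2 :: real) < of_int n \<longleftrightarrow> n \<ge> 1" by linarith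
    qed
    \<comment> \<open>\<open>2 L(n - 1)\<close> is the anticommutator of \<open>G(n - 3/2)\<close>
      and \<open>G(1/2)\<close>; its central term vanishes for \<open>n \<ge> 2\<close>.\<close>
    have \<omega>v: "nprod L \<omega> n v = 0" if "n \<ge> 2" for n
      using anti[of "n - 1" 1 v] v(1) that by simp
    show "nprod L (J a) n v = 0" if "(case (a, n) of (a, n) \<Rightarrow> (if a = Omega then 1 else 1 / 2) - real_of_int n) < 0" for a n
      using that v(1)[of n] \<omega>v[of n] half(2)[of n] by (cases a) (auto simp: \<omega>_def \<tau>_def)
    show "a = Omega \<and> n = 1" if "(case (a, n) of (a, n) \<Rightarrow> (if a = Omega then 1 else 1 / 2) - real_of_int n) = 0" for a n
      using that half(1)[of n] by (cases a) auto
    show "(case (a, n) of (a, n) \<Rightarrow> (if a = Omega then 1 else 1 / 2) - real_of_int n) > 0" if "n < 0" for a n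
      using that by auto
  qed (use v Leibniz in \<open>auto simp: \<omega>_def\<close>)
  show ?thesis by (rule that[OF even odd anti comm_\<tau>]) (use sing in blast)+
qed

section \<open>Sugawara vectors\<close>

context vertex_superalgebra
begin

text \<open>Numerical multiples are unfolded into sums so that cancellation becomes an identity in
  the additive group of vectors.\<close>

lemma scale_multiples:
  "scl V 2 x = x + x" "scl V 4 x = x + x + (x + x)" "scl V 6 x = x + x + (x + x) + (x + x)"
  "scl V 8 x = x + x + (x + x) + (x + x + (x + x))"
  "scl V (z * 2) x = scl V z x + scl V z x"
  "scl V (z * 4) x = scl V z x + scl V z x + (scl V z x + scl V z x)"
  "scl V (2 * z) x = scl V z x + scl V z x"
  "scl V (4 * z) x = scl V z x + scl V z x + (scl V z x + scl V z x)"
  by (simp_all flip: scale_left_distrib add: scale_collect)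

lemma affine_product_nonneg:
  assumes "mode_relations (odd_elt g) (affine_bracket g k) V K" "n \<ge> 0"
  shows "nprod V (K a) n (nprod V (K b) (- 1) v) =
     scl V (ksign (odd_elt g a) (odd_elt g b)) (nprod V (K b) (- 1) (nprod V (K a) n v)) +
     nprod V (lin_ext (scl V) K (bracket g a b)) (n - 1) v + scl V (if n = 1 then form g a b * k else 0) v"
  by (rule affine_product[OF assms(1)])

lemma int_cases_3:
  fixes n :: int
  assumes "n \<ge> 0"
  obtains "n = 0" | "n = 1" | "n = 2" | "n \<ge> 3"
  using assms by linarith

lemma sugawara:
  assumes rel: "mode_relations (odd_elt g) (affine_bracket g k) V K" and even: "S \<in> part V False" and z: "z \<noteq> 0"
    and S: "\<And>a n. n \<ge> 0 \<Longrightarrow> nprod V (K a) n S = (if n = 1 then scl V z (K a) else 0)"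
  obtains \<delta> where "\<And>a n b. nprod V \<delta> 1 (nprod V (K a) n b) =
      nprod V (K a) n (nprod V \<delta> 1 b) + scl V (- of_int n) (nprod V (K a) n b)"
proof -
  define \<delta> where "\<delta> = scl V (1 / z) S"
  have \<delta>: "\<delta> \<in> part V False" using even by (simp add: \<delta>_def)
  have "nprod V (K a) n \<delta> = (if n = 1 then K a else 0)" if "n \<ge> 0" for a n
    using S[OF that, of a] z by (simp add: \<delta>_def)
  note skew = conformal_skew[OF mode_relationsD(1)[OF rel] \<delta> this]
  show ?thesis
  proof (rule that)
    show "nprod V \<delta> 1 (nprod V (K a) n b) =
      nprod V (K a) n (nprod V \<delta> 1 b) + scl V (- of_int n) (nprod V (K a) n b)" for a n b
      using grading[OF \<delta> mode_relationsD(1)[OF rel, of a], of 1 n b] skew by simp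
  qed
qed

text \<open>\<open>S\<close> is twice the Casimir element in dual bases, and \<open>4 k + 8\<close>
  is four times the level shifted by the dual Coxeter number 2.\<close>

lemma sugawara_sl2:
  assumes rel: "mode_relations (odd_elt sl2) (affine_bracket sl2 k) V K" and "k + 2 \<noteq> 0"
  obtains \<delta> where "\<And>a n b. nprod V \<delta> 1 (nprod V (K a) n b) =
      nprod V (K a) n (nprod V \<delta> 1 b) + scl V (- of_int n) (nprod V (K a) n b)"
proof -
  define S where "S = scl V 2 (nprod V (K sE) (- 1) (K sF)) + scl V 2 (nprod V (K sF) (- 1) (K sE)) +
    nprod V (K sH) (- 1) (K sH)"
  note K = mode_relationsD(1)[OF rel]
  have even: "S \<in> part V False"
    unfolding S_def using K by (auto intro!: part_closed parity_even simp: sl2_def)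
  have "nprod V (K a) n S = (if n = 1 then scl V (4 * k + 8) (K a) else 0)" if "n \<ge> 0" for a n
    using that
    by (cases n rule: int_cases_3; cases a)
      (simp_all add: S_def affine_product_nonneg[OF rel] affine_ope[OF rel],
       simp_all add: sl2_def lin_ext_single vector_space_axioms affine_ope[OF rel, unfolded sl2_def, simplified]
         creation scale_multiples algebra_simps)
  moreover have "4 * k + 8 = 4 * (k + 2)" by simp
  then have "4 * k + 8 \<noteq> 0" using assms(2) by (metis mult_eq_0_iff zero_neq_numeral)
  ultimately show ?thesis using sugawara[OF rel even] that by metis
qed

text \<open>Again twice the Casimir element, the signs of the odd terms coming from the
  antisymmetric form; the dual Coxeter number is 3/2.\<close>

lemma sugawara_osp12:
  assumes rel: "mode_relations (odd_elt osp12) (affine_bracket osp12 k) V K" and "2 * k + 3 \<noteq> 0"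
  obtains \<delta> where "\<And>a n b. nprod V \<delta> 1 (nprod V (K a) n b) =
      nprod V (K a) n (nprod V \<delta> 1 b) + scl V (- of_int n) (nprod V (K a) n b)"
proof -
  define S where "S = scl V 2 (nprod V (K oE) (- 1) (K oF)) + scl V 2 (nprod V (K oF) (- 1) (K oE)) +
    nprod V (K oH) (- 1) (K oH) + nprod V (K oY) (- 1) (K oX) - nprod V (K oX) (- 1) (K oY)"
  note K = mode_relationsD(1)[OF rel]
  have K': "K oE \<in> part V False" "K oF \<in> part V False" "K oH \<in> part V False" "K oX \<in> part V True" "K oY \<in> part V True"
    using K[of oE] K[of oF] K[of oH] K[of oX] K[of oY] by (simp_all add: osp12_def)
  have even: "S \<in> part V False"
    unfolding S_def using parity_odd[OF K'(4,5)] parity_odd[OF K'(5,4)] K' by (simp add: parity_even)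
  have "nprod V (K a) n S = (if n = 1 then scl V (4 * k + 6) (K a) else 0)" if "n \<ge> 0" for a n
    using that
    by (cases n rule: int_cases_3; cases a)
      (simp_all add: S_def affine_product_nonneg[OF rel] affine_ope[OF rel],
       simp_all add: osp12_def lin_ext_single vector_space_axioms affine_ope[OF rel, unfolded osp12_def, simplified]
         creation scale_multiples algebra_simps)
  moreover have "4 * k + 6 = 2 * (2 * k + 3)" by simp
  then have "4 * k + 6 \<noteq> 0" using assms(2) by (metis mult_eq_0_iff zero_neq_numeral)
  ultimately show ?thesis using sugawara[OF rel even] that by metis
qed

end

text \<open>Downward induction starting at a truncation bound. Once all higher modes are zero, a
  product in a tensor product isolates the highest remaining one.\<close>

lemma int_descend:
  fixes P :: "int \<Rightarrow> bool"
  assumes N: "\<forall>n \<ge> N. P n" and step: "\<And>n. n \<ge> n0 \<Longrightarrow> (\<And>m. m > n \<Longrightarrow> P m) \<Longrightarrow> P n" and n: "n \<ge> n0"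
  shows "P n"
proof -
  have "\<forall>m \<ge> N - int k. m \<ge> n0 \<longrightarrow> P m" for k
  proof (induction k)
    case (Suc k)
    show ?case
    proof (intro allI impI)
      fix m assume m: "m \<ge> N - int (Suc k)" "m \<ge> n0"
      show "P m" by (rule step[OF m(2)]) (use Suc m in auto)
    qed
  qed (use N in simp)
  from this[of "nat (N - n)"] n show ?thesis by auto
qed

lemma affine_bracket_length:
  assumes "w \<in> Poly_Mapping.keys (affine_bracket g k x y)"
  shows "length w \<le> 1"
proof -
  obtain a m b n where xy: "x = (a, m)" "y = (b, n)" by force
  have "w \<in> Poly_Mapping.keys (\<Sum>z \<in> Poly_Mapping.keys (bracket g a b).
        Poly_Mapping.single [(z, m + n)] (Poly_Mapping.lookup (bracket g a b) z)) \<union> {[]}"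
    using assms Poly_Mapping.keys_add unfolding xy affine_bracket.simps
    by (fastforce split: if_splits)
  moreover have "Poly_Mapping.keys (\<Sum>z \<in> A. Poly_Mapping.single [(z, m + n)] (h z)) \<subseteq> (\<lambda>z. [(z, m + n)]) ` A"
    for A and h :: "_ \<Rightarrow> complex"
  proof (induction A rule: infinite_finite_induct)
    case (insert z A)
    have "Poly_Mapping.keys (\<Sum>z \<in> insert z A. Poly_Mapping.single [(z, m + n)] (h z)) \<subseteq>
      Poly_Mapping.keys (Poly_Mapping.single [(z, m + n)] (h z)) \<union>
      Poly_Mapping.keys (\<Sum>z \<in> A. Poly_Mapping.single [(z, m + n)] (h z))"
      unfolding sum.insert[OF insert(1,2)] by (rule Poly_Mapping.keys_add)
    then show ?case using insert by (auto split: if_splits)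
  qed auto
  ultimately show ?thesis by fastforce
qed

context vertex_superalgebra
begin

lemma affine_skew:
  assumes a: "a \<in> part V p" and b: "b \<in> part V q"
    and ab: "\<And>n. n \<ge> 0 \<Longrightarrow> nprod V a n b = (if n = 0 then u else if n = 1 then scl V z (vac V) else 0)"
    and "n \<ge> 0"
  shows "nprod V b n a = scl V (ksign p q) (if n = 0 then - u else if n = 1 then scl V z (vac V) else 0)"
proof -
  have *: "nprod V a (n + int j) b = 0" if "j \<ge> 2" for j using ab[of "n + int j"] \<open>n \<ge> 0\<close> that by simp
  have "nprod V b n a = scl V (- ((- 1) powi n * ksign p q))
     (\<Sum>j<2. scl V ((- 1) ^ j) (nprod V (nprod V a (n + int j) b) (- 1 - int j) (vac V)))"
    by (rule skew[OF a b]) (use * in auto)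
  also have "\<dots> = scl V (- ((- 1) powi n * ksign p q)) (if n = 0 then u else if n = 1 then scl V z (vac V) else 0)"
    using \<open>n \<ge> 0\<close> by (auto simp: numeral_2_eq_2 ab creation vacuum)
  also have "\<dots> = scl V (ksign p q) (if n = 0 then - u else if n = 1 then scl V z (vac V) else 0)"
    by auto
  finally show ?thesis .
qed

text \<open>At the highest order that can still be nonzero, skew symmetry has a single term; the
  parity condition makes its sign -1.\<close>

lemma skew_self:
  assumes a: "a \<in> part V p" and "\<And>m. m > n \<Longrightarrow> nprod V a m a = 0" and "even n \<noteq> p"
  shows "nprod V a n a = 0"
proof -
  have "nprod V a n a = scl V (- ((- 1) powi n * ksign p p)) (nprod V a n a)"
    using skew[OF a a, of 1 n] assms(2) by (simp add: creation)
  moreover have "- ((- 1) powi n * ksign p p) = - 1"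
    using assms(3) by (cases p) (auto simp: power_int_minus_left)
  ultimately have "nprod V a n a + nprod V a n a = 0" by (simp add: eq_neg_iff_add_eq_0)
  then have "scl V 2 (nprod V a n a) = 0" by (simp add: scale_two)
  then show ?thesis by simp
qed

lemma translation_closed:
  assumes "w \<in> part V False" "a \<in> part V p" "nprod V w 0 a = nprod V a (- 2) (vac V)"
    "nprod V w 0 b = nprod V b (- 2) (vac V)"
  shows "nprod V w 0 (nprod V a n b) = nprod V (nprod V a n b) (- 2) (vac V)"
  by (simp add: zero_mode[OF assms(1,2)] assms(3,4) translate_nprod translate_mode)

end

context lattice_type
begin

lemma heis_conformal_\<nu>:
  "nprod P heis_conformal 0 (\<nu> k) = nprod P (\<nu> k) (- 2) (vac P)" "nprod P heis_conformal 1 (\<nu> k) = \<nu> k"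
  by (simp_all add: \<nu>_def heis_conformal_J)

lemma heis_grading_\<nu>: "nprod P heis_conformal 1 (nprod P (\<nu> k) n v) =
     nprod P (\<nu> k) n (nprod P heis_conformal 1 v) + scl P (- of_int n) (nprod P (\<nu> k) n v)"
  using P.grading[OF P_even P_even, of heis_conformal "\<nu> k" 1 n v] by (simp add: heis_conformal_\<nu>)

lemma heis_conformal_p:
  "nprod P heis_conformal 0 (p_vec k) = nprod P (p_vec k) (- 2) (vac P)"
  "nprod P heis_conformal 1 (p_vec k) = scl P 2 (p_vec k)"
proof -
  show "nprod P heis_conformal 0 (p_vec k) = nprod P (p_vec k) (- 2) (vac P)"
    by (simp add: p_vec_def q1_def q2_def q3_def heis_conformal_e
        P.translation_closed[OF P_even P_even heis_conformal_\<nu>(1)])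
  have "nprod P heis_conformal 1 (q1 k) = q1 k"
    by (simp add: q1_def heis_grading_\<nu> heis_conformal_e)
  then have "nprod P heis_conformal 1 (q2 k) = scl P 2 (q2 k)" "nprod P heis_conformal 1 (q3 k) = scl P 2 (q3 k)"
    by (simp_all add: q2_def q3_def heis_grading_\<nu> heis_conformal_e P.scale_two)
  then show "nprod P heis_conformal 1 (p_vec k) = scl P 2 (p_vec k)"
    by (simp add: p_vec_def P.scale_right_diff_distrib mult.commute)
qed

lemma heis_grading_p: "nprod P heis_conformal 1 (nprod P (p_vec k) n v) =
     nprod P (p_vec k) n (nprod P heis_conformal 1 v) + scl P (1 - of_int n) (nprod P (p_vec k) n v)"
  using P.grading[OF P_even P_even, of heis_conformal "p_vec k" 2 n v] by (simp add: heis_conformal_p)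

end

section \<open>Products and charge components in a tensor product with a lattice factor\<close>

context lattice_tensor
begin

lemma nprod_tensor:
  assumes A: "finite A" "\<And>i. i \<notin> A \<Longrightarrow> nprod X a i a' = 0 \<or> nprod P b (n - 1 - i) b' = 0"
  shows "nprod T (\<beta> a b) n (\<beta> a' b') = (\<Sum>i\<in>A. \<beta> (nprod X a i a') (nprod P b (n - 1 - i) b'))"
proof -
  obtain a0 a1 where a': "a' = a0 + a1" "a0 \<in> part X False" "a1 \<in> part X True" using X.part_sum by blast
  obtain N0 where N0: "\<forall>i \<ge> N0. nprod X a i a0 = 0" using X.truncation by blast
  obtain N1 where N1: "\<forall>i \<ge> N1. nprod X a i a1 = 0" using X.truncation by blast
  obtain M where M: "\<forall>i \<ge> M. nprod P b i b' = 0" using P.truncation by blast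
  \<comment> \<open>Outside \<open>A\<close> the product with \<open>a'\<close> vanishes, but those
    with its even and odd components may not. \<open>C\<close> is a finite set outside which both
    vanish.\<close>
  define C where "C = A \<union> {n - 1 - M..max N0 N1}"
  have C: "finite C" "A \<subseteq> C" using A by (auto simp: C_def)
  have out: "nprod X a i a0 = 0 \<or> nprod P b (n - 1 - i) b' = 0" "nprod X a i a1 = 0 \<or> nprod P b (n - 1 - i) b' = 0"
    if "i \<notin> C" for i
    using that N0 N1 M by (auto simp: C_def not_le)
  have "nprod T (\<beta> a b) n (\<beta> a' b') = (\<Sum>i\<in>C. \<beta> (nprod X a i a') (nprod P b (n - 1 - i) b'))"
    using nprod_T_sum[OF P_even a'(2) C(1) out(1)] nprod_T_sum[OF P_even a'(3) C(1) out(2)]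
    by (simp add: a'(1) sum.distrib)
  also have "\<dots> = (\<Sum>i\<in>A. \<beta> (nprod X a i a') (nprod P b (n - 1 - i) b'))"
    using C A(2) by (intro sum.mono_neutral_right) fastforce+
  finally show ?thesis .
qed

lemma tensor_e_level: "u \<in> T.span {\<beta> v (e j) | v j. True} \<Longrightarrow> nprod T (\<iota> heis_conformal) 1 u = 0"
  by (induction u rule: T.span_induct_alt) (auto simp: \<iota>_mode heis_conformal_e)

text \<open>The mode \<open>d(0)\<close> acts on \<open>\<beta> v (e r)\<close> by
  \<open>2 r t\<close>, and these numbers are distinct because \<open>t\<close> is nonzero; an
  eigenvector therefore involves one \<open>r\<close> only.\<close>

lemma charge_component:
  assumes w: "u \<in> T.span {\<beta> v (e j) | v j. True}" and q: "nprod T (\<iota> (J hD)) 0 u = scl T q u"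
  obtains v r where "u = \<beta> v (e r)"
proof -
  have uq: "u \<in> T.span {\<beta> v (e j) | v j. of_int j * t * 2 = q}"
  proof (rule T.eigen_span[where E = "\<lambda>m. {\<beta> v (e j) | v j. of_int j * t * 2 = m}", OF _ _ q])
    show "u \<in> T.span (\<Union>m. {\<beta> v (e j) | v j. of_int j * t * 2 = m})"
      using w by (rule subsetD[OF T.span_mono, rotated]) auto
  qed (auto simp: \<iota>_mode heis_e)
  have sub: "{\<beta> v (e j) | v j. of_int j * t * 2 = q} \<subseteq> range (\<lambda>v. \<beta> v (e r))"
    if "of_int r * t * 2 = q" for r
    using t that by auto
  have subspace: "T.subspace (range (\<lambda>v. \<beta> v (e r)))" for r
    by (auto simp: T.subspace_def image_iff simp flip: beta_linear) (metis beta_zero(1))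
  have "\<exists>v r. u = \<beta> v (e r)"
  proof (cases "\<exists>r. of_int r * t * 2 = q")
    case True
    then obtain r where r: "of_int r * t * 2 = q" by blast
    have "T.span {\<beta> v (e j) | v j. of_int j * t * 2 = q} \<subseteq> range (\<lambda>v. \<beta> v (e r))"
      by (rule T.span_minimal[OF sub[OF r] subspace])
    then show ?thesis using uq by blast
  next
    case False
    then have "{\<beta> v (e j) | v j. of_int j * t * 2 = q} = {}" by auto
    then have "u = 0" using uq by simp
    then show ?thesis by (metis beta_zero(1))
  qed
  then show ?thesis using that by blast
qed

text \<open>The field \<open>e j\<close> controls the positive modes of \<open>c\<close> by
  \<open>e_annihilates\<close>; since \<open>h\<close> is \<open>d\<close> plus a multiple of
  \<open>c\<close>, those of \<open>d\<close> follow.\<close>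

lemma vacuum_space_e:
  assumes "j \<noteq> 0" and e: "\<And>n. n \<ge> 0 \<Longrightarrow> nprod T (\<iota> (e j)) n u = 0"
    and h: "\<And>n. n \<ge> 1 \<Longrightarrow> nprod T (\<iota> (h_vec k)) n u = 0"
  shows "u \<in> T.span {\<beta> v (e j) | v j. True}"
proof (rule vacuum_space)
  have c: "nprod T (\<iota> (J hC)) i u = 0" if "i \<ge> 1" for i
    by (rule e_annihilates[OF assms(1) e that])
  show "nprod T (\<iota> (J a)) i u = 0" if "i \<ge> 1" for i a
    using h[OF that] c[OF that] by (cases a) (auto simp: h_vec_def)
qed

section \<open>The realization of affine sl(2)\<close>

definition sl2_f :: "'x \<Rightarrow> complex \<Rightarrow> 't" where
  "sl2_f \<omega> k = scl T (k + 2) (\<beta> \<omega> (e (- 1))) + \<iota> (p_vec k)"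

fun sl2_map :: "'x \<Rightarrow> complex \<Rightarrow> sl2_basis \<Rightarrow> 't" where
  "sl2_map \<omega> k sE = \<iota> (e 1)"
| "sl2_map \<omega> k sH = \<iota> (h_vec k)"
| "sl2_map \<omega> k sF = sl2_f \<omega> k"

lemma sl2_f_even: "\<omega> \<in> part X False \<Longrightarrow> sl2_f \<omega> k \<in> part T False"
  unfolding sl2_f_def using part_T[of \<omega> False "e (- 1)" False] \<iota>_even by (intro T.part_closed) auto

lemma h_f:
  assumes "t = 1" "n \<ge> 0"
  shows "nprod T (\<iota> (h_vec k)) n (sl2_f \<omega> k) = (if n = 0 then scl T (- 2) (sl2_f \<omega> k) else 0)"
proof -
  have "nprod P (h_vec k) n (e (- 1)) = (if n = 0 then scl P (- 2) (e (- 1)) else 0)"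
    using h_e[OF assms(2), of k "- 1"] assms(1) by simp
  moreover have "nprod P (h_vec k) n (p_vec k) = (if n = 0 then scl P (- 2) (p_vec k) else 0)"
    using h_p[OF assms(2), of k] assms(1) by simp
  moreover define K where "K = k + 2"
  ultimately show ?thesis
    unfolding sl2_f_def K_def[symmetric]
    by (simp add: \<iota>_mode T.scale_right_distrib T.scale_right_diff_distrib T.scale_multiples P.scale_two)
qed

lemma e_f:
  assumes "t = 1" "n \<ge> 0"
  shows "nprod T (\<iota> (e 1)) n (sl2_f \<omega> k) = (if n = 0 then \<iota> (h_vec k) else if n = 1 then scl T k (vac T) else 0)"
  using e1_p[OF assms, of k] e_nonneg[OF assms(2), of 1 "- 1"] by (simp add: sl2_f_def \<iota>_mode vac_T)

text \<open>At \<open>n = 1\<close> the terms in \<open>\<omega> \<otimes> e (- 2)\<close> cancel: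
  \<open>2 (k + 2)^2\<close> from \<omega> with itself against \<open>- (k + 2)^2\<close> from each
  of the two mixed products. Hence only the lattice factor remains for all
  \<open>n \<ge> 1\<close>.\<close>

lemma f_f_product:
  assumes \<omega>: "\<And>n. n \<ge> 1 \<Longrightarrow> nprod X \<omega> n \<omega> = (if n = 1 then scl X 2 \<omega> else if n = 3 then scl X (c / 2) (vac X) else 0)"
    and n: "n \<ge> 1"
  shows "nprod T (sl2_f \<omega> k) n (sl2_f \<omega> k) =
     scl T ((k + 2)\<^sup>2 * (c / 2)) (\<iota> (nprod P (e (- 1)) (n - 4) (e (- 1)))) + \<iota> (nprod P (p_vec k) n (p_vec k))"
proof -
  have 1: "nprod T (\<beta> \<omega> (e (- 1))) n (\<beta> \<omega> (e (- 1))) =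
    scl T (c / 2) (\<iota> (nprod P (e (- 1)) (n - 4) (e (- 1)))) +
    (if n = 1 then \<beta> \<omega> (e (- 2)) + \<beta> \<omega> (e (- 2)) else 0)"
  proof (cases "n = 1")
    case True
    have "nprod X \<omega> i \<omega> = 0 \<or> nprod P (e (- 1)) (n - 1 - i) (e (- 1)) = 0" if "i \<notin> {1, 3}" for i
      using that \<omega>[of i] e_nonneg[of "n - 1 - i" "- 1" "- 1"] n True by (cases "i \<ge> 1") auto
    then show ?thesis
      using True by (subst nprod_tensor[of "{1, 3}"]) (auto simp: \<omega> e_minus_one T.scale_two)
  next
    case False
    have "nprod X \<omega> i \<omega> = 0 \<or> nprod P (e (- 1)) (n - 1 - i) (e (- 1)) = 0" if "i \<notin> {3}" for i
      using that \<omega>[of i] e_nonneg[of "n - 1 - i" "- 1" "- 1"] n False by (cases "i \<ge> n") auto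
    then show ?thesis
      using False by (subst nprod_tensor[of "{3}"]) (auto simp: \<omega>)
  qed
  have 2: "nprod T (\<beta> \<omega> (e (- 1))) n (\<iota> (p_vec k)) = (if n = 1 then scl T (- (k + 2)) (\<beta> \<omega> (e (- 2))) else 0)"
  proof -
    have "nprod X \<omega> i (vac X) = 0 \<or> nprod P (e (- 1)) (n - 1 - i) (p_vec k) = 0" if "i \<notin> {- 1}" for i
      using that X.creation(2)[of i \<omega>] E_p[of "n - 1 - i" k] n by (cases "i \<ge> 0") auto
    then show ?thesis
      using n by (subst nprod_tensor[of "{- 1}"]) (auto simp: X.creation E_p)
  qed
  have 3: "nprod T (\<iota> (p_vec k)) n (\<beta> \<omega> (e (- 1))) = (if n = 1 then scl T (- (k + 2)) (\<beta> \<omega> (e (- 2))) else 0)"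
    using p_e[OF n, of k "- 1"] by (simp add: \<iota>_mode)
  define K where "K = k + 2"
  have "nprod T (sl2_f \<omega> k) n (sl2_f \<omega> k) =
     scl T K (scl T K (nprod T (\<beta> \<omega> (e (- 1))) n (\<beta> \<omega> (e (- 1))))) +
     scl T K (nprod T (\<iota> (p_vec k)) n (\<beta> \<omega> (e (- 1)))) +
     (scl T K (nprod T (\<beta> \<omega> (e (- 1))) n (\<iota> (p_vec k))) + nprod T (\<iota> (p_vec k)) n (\<iota> (p_vec k)))"
    by (simp only: sl2_f_def K_def T.nprod_left T.nprod_right T.scale_right_distrib)
  then show ?thesis
    unfolding 1 2 3 K_def[symmetric]
    by (cases "n = 1") (simp_all add: \<iota>_mode T.scale_right_distrib power2_eq_square mult.assoc)
qed

text \<open>Explicit coefficients are needed only for \<open>n \<ge> 3\<close>, where the central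
  charge enters. Orders 2 and 0 vanish by skew symmetry. The product of order 1 is killed by the
  modes of \<open>e\<close> and \<open>h\<close> required in \<open>vacuum_space_e\<close>, so it
  has level 0; but its explicit form has level 2.\<close>

lemma f_f:
  assumes t1: "t = 1" and even: "\<omega> \<in> part X False"
    and \<omega>: "\<And>n. n \<ge> 1 \<Longrightarrow> nprod X \<omega> n \<omega> = (if n = 1 then scl X 2 \<omega> else if n = 3 then scl X (c / 2) (vac X) else 0)"
    and c: "(k + 2)\<^sup>2 * (c / 2) + (3 * k ^ 3 + 23 / 2 * k\<^sup>2 + 13 * k + 4) = 0" and n: "n \<ge> 0"
  shows "nprod T (sl2_f \<omega> k) n (sl2_f \<omega> k) = 0"
proof -
  let ?f = "sl2_f \<omega> k"
  note f_even = sl2_f_even[OF even, of k]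
  have t2: "t\<^sup>2 = 1" using t1 by simp
  have ff3: "nprod T ?f n ?f = 0" if "n \<ge> 3" for n
  proof (cases "n = 3")
    case True
    have "nprod T ?f n ?f = scl T ((k + 2)\<^sup>2 * (c / 2) + (3 * k ^ 3 + 23 / 2 * k\<^sup>2 + 13 * k + 4)) (\<iota> (e (- 2)))"
      using True by (subst f_f_product[OF \<omega>]) (simp_all add: p_p[OF t2] e_minus_one T.scale_left_distrib)
    then show ?thesis by (simp only: c T.scale_zero_left)
  next
    case False
    then show ?thesis
      using that e_nonneg[of "n - 4" "- 1" "- 1"] by (subst f_f_product[OF \<omega>]) (simp_all add: p_p[OF t2])
  qed
  have ff2: "nprod T ?f n ?f = 0" if "n \<ge> 2" for n
  proof (cases "n = 2")
    case True
    show ?thesis by (rule T.skew_self[OF f_even]) (use True ff3 in auto)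
  qed (use that ff3 in auto)
  have ff1: "nprod T ?f 1 ?f = 0"
  proof -
    let ?w = "nprod T ?f 1 ?f"
    have fh: "nprod T ?f 1 (\<iota> (h_vec k)) = 0"
      using T.affine_skew[OF \<iota>_even f_even, of "h_vec k" "scl T (- 2) ?f" 0 1] h_f[OF t1] by simp
    have "?w \<in> T.span {\<beta> v (e j) | v j. True}"
    proof (rule vacuum_space_e[of 1])
      show "nprod T (\<iota> (e 1)) m ?w = 0" if "m \<ge> 0" for m
        using that T.commutator[OF \<iota>_even f_even, of 2 "e 1" m 1 ?f]
        by (auto simp: e_f[OF t1] h_f[OF t1] fh numeral_2_eq_2 T.vacuum T.creation)
      show "nprod T (\<iota> (h_vec k)) m ?w = 0" if "m \<ge> 1" for m
        using that T.commutator[OF \<iota>_even f_even, of 1 "h_vec k" m 1 ?f]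
        by (auto simp: h_f[OF t1] ff2)
    qed simp
    then have "nprod T (\<iota> heis_conformal) 1 ?w = 0" by (rule tensor_e_level)
    moreover have "nprod T (\<iota> heis_conformal) 1 ?w = scl T 2 ?w"
      by (subst (1 2) f_f_product[OF \<omega>])
        (simp_all add: \<iota>_mode heis_grading heis_grading_p heis_conformal_p heis_conformal_e T.scale_right_distrib mult.commute)
    ultimately show ?thesis by simp
  qed
  show ?thesis
  proof (cases "n \<ge> 1")
    case True
    show ?thesis
    proof (cases "n = 1")
      case True
      then show ?thesis using ff1 by simp
    next
      case False
      then show ?thesis using \<open>n \<ge> 1\<close> by (intro ff2) simp
    qed
  next
    case False
    have "nprod T ?f m ?f = 0" if "m > 0" for m
    proof (cases "m = 1")
      case True
      then show ?thesis using ff1 by simp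
    next
      case False
      then show ?thesis using that by (intro ff2) simp
    qed
    then have "nprod T ?f 0 ?f = 0" by (rule T.skew_self[OF f_even]) simp_all
    moreover have "n = 0" using n False by simp
    ultimately show ?thesis by (simp only:)
  qed
qed

lemma sl2_mode_relations:
  assumes t1: "t = 1" and even: "\<omega> \<in> part X False"
    and \<omega>: "\<And>n. n \<ge> 1 \<Longrightarrow> nprod X \<omega> n \<omega> = (if n = 1 then scl X 2 \<omega> else if n = 3 then scl X (c / 2) (vac X) else 0)"
    and c: "(k + 2)\<^sup>2 * (c / 2) + (3 * k ^ 3 + 23 / 2 * k\<^sup>2 + 13 * k + 4) = 0"
  shows "mode_relations (odd_elt sl2) (affine_bracket sl2 k) T (sl2_map \<omega> k)"
proof (rule T.affine_mode_relationsI)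
  note f_even = sl2_f_even[OF even, of k]
  show "sl2_map \<omega> k a \<in> part T (odd_elt sl2 a)" for a
    using f_even \<iota>_even by (cases a) (auto simp: sl2_def)
  have he: "nprod T (\<iota> (h_vec k)) n (\<iota> (e 1)) = (if n = 0 then scl T 2 (\<iota> (e 1)) else 0)" if "n \<ge> 0" for n
    using h_e[OF that, of k 1] t1 by (simp add: \<iota>_mode)
  have hh: "nprod T (\<iota> (h_vec k)) n (\<iota> (h_vec k)) = (if n = 1 then scl T (2 * k) (vac T) else 0)" if "n \<ge> 0" for n
    using h_h[OF that, of k] by (simp add: \<iota>_mode vac_T)
  have ee: "nprod T (\<iota> (e 1)) n (\<iota> (e 1)) = 0" if "n \<ge> 0" for n
    using e_nonneg[OF that] by (simp add: \<iota>_mode)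
  have eh: "nprod T (\<iota> (e 1)) n (\<iota> (h_vec k)) = (if n = 0 then - scl T 2 (\<iota> (e 1)) else 0)" if "n \<ge> 0" for n
    using T.affine_skew[OF \<iota>_even \<iota>_even _ that, of "h_vec k" "e 1" "scl T 2 (\<iota> (e 1))" 0] he by simp
  have fh: "nprod T (sl2_f \<omega> k) n (\<iota> (h_vec k)) = (if n = 0 then scl T 2 (sl2_f \<omega> k) else 0)" if "n \<ge> 0" for n
    using T.affine_skew[OF \<iota>_even f_even _ that, of "h_vec k" "scl T (- 2) (sl2_f \<omega> k)" 0] h_f[OF t1] by simp
  have fe: "nprod T (sl2_f \<omega> k) n (\<iota> (e 1)) = (if n = 0 then - \<iota> (h_vec k) else if n = 1 then scl T k (vac T) else 0)" if "n \<ge> 0" for n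
    using T.affine_skew[OF \<iota>_even f_even _ that, of "e 1" "\<iota> (h_vec k)" k] e_f[OF t1] by simp
  show "nprod T (sl2_map \<omega> k a) n (sl2_map \<omega> k b) =
      (if n = 0 then lin_ext (scl T) (sl2_map \<omega> k) (bracket sl2 a b)
       else if n = 1 then scl T (form sl2 a b * k) (vac T) else 0)" if n: "n \<ge> 0" for a b n
    by (cases a; cases b)
      (simp_all add: sl2_def lin_ext_single T.vector_space_axioms ee[OF n] he[OF n] hh[OF n] e_f[OF t1 n] h_f[OF t1 n]
        f_f[OF t1 even \<omega> c n] eh[OF n] fh[OF n] fe[OF n])
qed

text \<open>Once \<open>u\<close> is reduced to \<open>v \<otimes> e r\<close>, the top mode of
  \<open>e (- 1)\<close> on \<open>e r\<close> is the mode -1, so the modes of \<open>f\<close>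
  expose those of \<omega> on \<open>v\<close> one at a time, from above.\<close>

lemma sl2_singular:
  assumes k: "k + 2 \<noteq> 0" "\<And>r::int. k + 1 \<noteq> of_int r"
    and simple: "\<And>v l. (\<And>n. n \<ge> 2 \<Longrightarrow> nprod X \<omega> n v = 0) \<Longrightarrow> nprod X \<omega> 1 v = scl X l v \<Longrightarrow> v \<in> X.span {vac X}"
    and w: "\<And>a n. n \<ge> 1 \<Longrightarrow> nprod T (sl2_map \<omega> k a) n u = 0" "nprod T (sl2_map \<omega> k sE) 0 u = 0"
      "nprod T (sl2_map \<omega> k sH) 0 u = scl T q u"
  shows "\<exists>z. u = scl T z (vac T)"
proof -
  have e: "nprod T (\<iota> (e 1)) n u = 0" if "n \<ge> 0" for n
    using w(1)[of n sE] w(2) that by (cases "n = 0") auto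
  have S0: "u \<in> T.span {\<beta> v (e j) | v j. True}"
    by (rule vacuum_space_e[of 1 u k]) (use e w(1)[of _ sH] in auto)
  have "nprod T (\<iota> (J hD)) 0 u = scl T q u"
    using w(3) T_c_zero[of u] by (simp add: h_vec_def)
  from charge_component[OF S0 this] obtain v r where u: "u = \<beta> v (e r)" by blast
  have f: "nprod T (sl2_f \<omega> k) n u = 0" if "n \<ge> 1" for n using w(1)[OF that, of sF] by simp
  have \<omega>e: "nprod T (\<beta> \<omega> (e (- 1))) n u = \<beta> (nprod X \<omega> n v) (e (r - 1))"
    if "\<And>m. m > n \<Longrightarrow> nprod X \<omega> m v = 0" for n
  proof -
    have "nprod X \<omega> i v = 0 \<or> nprod P (e (- 1)) (n - 1 - i) (e r) = 0" if "i \<notin> {n}" for i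
      using that \<open>\<And>m. m > n \<Longrightarrow> nprod X \<omega> m v = 0\<close> e_nonneg[of "n - 1 - i" "- 1" r] by (cases "i > n") auto
    then show ?thesis unfolding u by (subst nprod_tensor[of "{n}"]) (auto simp: e_minus_one)
  qed
  obtain N where N: "\<forall>n \<ge> N. nprod X \<omega> n v = 0" using X.truncation by blast
  \<comment> \<open>The lattice part \<open>p_vec\<close> contributes to \<open>f_(n)\<close> on
    \<open>e r\<close> only at order 1, so for \<open>n \<ge> 2\<close> the Virasoro mode stands
    alone.\<close>
  have \<omega>2: "nprod X \<omega> n v = 0" if "n \<ge> 2" for n
    using N _ that
  proof (rule int_descend)
    fix n assume n: "(n::int) \<ge> 2" "\<And>m. m > n \<Longrightarrow> nprod X \<omega> m v = 0"
    have "nprod T (sl2_f \<omega> k) n u = scl T (k + 2) (\<beta> (nprod X \<omega> n v) (e (r - 1)))"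
      using n p_e[of n k r] by (simp add: sl2_f_def \<omega>e) (simp add: u \<iota>_mode)
    then have "\<beta> (nprod X \<omega> n v) (e (r - 1)) = 0" using f[of n] n k(1) by simp
    then show "nprod X \<omega> n v = 0" using beta_eq_zero e_nonzero by blast
  qed
  \<comment> \<open>The relation \<open>f_(1) u = 0\<close> fixes the Virasoro weight of
    \<open>v\<close> as \<open>r (r - k - 1) / (k + 2)\<close>; since \<open>v\<close> is a multiple
    of the vacuum, this weight must be 0.\<close>
  define \<rho> where "\<rho> = - of_int r * (of_int r - k - 1)"
  have "nprod T (sl2_f \<omega> k) 1 u = \<beta> (scl X (k + 2) (nprod X \<omega> 1 v) + scl X \<rho> v) (e (r - 1))"
  proof -
    have "nprod P (p_vec k) 1 (e r) = scl P \<rho> (e (r - 1))" using p_e[of 1 k r] by (simp add: \<rho>_def)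
    then show ?thesis using \<omega>2 by (simp add: sl2_f_def \<omega>e) (simp add: u \<iota>_mode)
  qed
  then have "\<beta> (scl X (k + 2) (nprod X \<omega> 1 v) + scl X \<rho> v) (e (r - 1)) = 0"
    using f[of 1] by (simp only: order_refl)
  then have "scl X (k + 2) (nprod X \<omega> 1 v) + scl X \<rho> v = 0"
    using beta_eq_zero e_nonzero by blast
  then have "scl X (1 / (k + 2)) (scl X (k + 2) (nprod X \<omega> 1 v) + scl X \<rho> v) = 0" by simp
  then have L0: "nprod X \<omega> 1 v = scl X (- (\<rho> / (k + 2))) v"
    using k(1) by (simp add: X.scale_right_distrib eq_neg_iff_add_eq_0)
  from simple[OF \<omega>2 L0] obtain z where z: "v = scl X z (vac X)" by (auto simp: X.span_singleton)
  show ?thesis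
  proof (cases "z = 0 \<or> vac X = 0")
    case True
    then have "u = scl T 0 (vac T)" using z u by auto
    then show ?thesis by blast
  next
    case False
    then have "\<rho> = 0" using L0 k(1) by (simp add: z X.creation)
    then have "of_int r = (0::complex) \<or> of_int r - k - 1 = 0"
      unfolding \<rho>_def by (simp only: mult_eq_0_iff neg_equal_0_iff_equal)
    then have "of_int r = (0::complex) \<or> of_int r = k + 1" by (auto simp: algebra_simps)
    then have "r = 0" using k(2)[of r] by auto
    then have "u = scl T z (vac T)" using u z by (simp add: vac_T vac_P)
    then show ?thesis by blast
  qed
qed

end

lemma lattice_type_locale:
  assumes "lattice_type_va t P" "t \<noteq> 0"
  obtains J e where "lattice_type P t J e"
proof -
  from assms(1) obtain J e where *: "vertex_superalgebra P" "part P True = {0}" "vac P = e (0::int)"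
    "presents (scl P) (\<lambda>(w, j). act P J w (e j))
         (induced_relators (\<lambda>_. False) heis_bracket
            (\<lambda>(a, n) j. if n = 0 then of_int j * t * heis_form a hC else 0))"
    "\<forall>j j' w n. (\<forall>x \<in> set w. snd x < 0) \<longrightarrow>
          nprod P (e j) n (act P J w (e j')) =
          Sum_any (\<lambda>s::nat. if n + 1 \<le> int s
            then exp_coeff (scl P)
                   (\<lambda>i v. scl P (of_int j * t) (nprod P (J hC) (- int i) v)) (nat (int s - n - 1))
                   (exp_coeff (scl P)
                     (\<lambda>i v. scl P (- (of_int j * t)) (nprod P (J hC) (int i) v)) s
                     (act P J w (e (j + j'))))
            else 0)"
    unfolding lattice_type_va_def by blast
  have "lattice_type P t J e"
    unfolding lattice_type_def lattice_type_axioms_def using assms(2) * by blast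
  then show ?thesis by (rule that)
qed

lemma (in vertex_superalgebra) zero_mode_charge:
  assumes rel: "mode_relations (odd_elt g) (affine_bracket g k) V K" and "\<not> odd_elt g h"
    and "lin_ext (scl V) K (bracket g h a) = scl V q (K a)"
  shows "nprod V (K h) 0 (nprod V (K a) n b) = nprod V (K a) n (nprod V (K h) 0 b) + scl V q (nprod V (K a) n b)"
  using zero_mode[of "K h" "K a" "odd_elt g a" n b] mode_relationsD(1)[OF rel, of h] mode_relationsD(1)[OF rel, of a]
  by (simp add: affine_ope[OF rel] assms)

theorem sl2_homomorphism:
  fixes Uaff :: "'a1::ab_group_add vsa" and Vk :: "'a2::ab_group_add vsa"
    and Uvir :: "'a3::ab_group_add vsa" and Lvir :: "'a4::ab_group_add vsa"
    and P :: "'a5::ab_group_add vsa" and T :: "'a6::ab_group_add vsa"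
  assumes pp: "p \<ge> 2" "p' \<ge> 2" "gcd p p' = 1" "k + 2 = of_int p / of_int p'"
    and U: "universal_affine sl2 k Uaff" "simple_quotient Uaff Vk"
    and L: "universal_virasoro (d_charge p p') Uvir" "simple_quotient Uvir Lvir"
    and P: "Pi0 P" and T: "tensor_vsa Lvir P T"
  shows "\<exists>\<Phi>. vsa_hom Vk T \<Phi> \<and> nontrivial_hom T \<Phi>"
proof -
  obtain \<omega> where \<omega>: "\<omega> \<in> part Lvir False"
    "\<And>n. n \<ge> 1 \<Longrightarrow> nprod Lvir \<omega> n \<omega> = (if n = 1 then scl Lvir 2 \<omega> else if n = 3 then scl Lvir (d_charge p p' / 2) (vac Lvir) else 0)"
    "\<And>v l. (\<And>n. n \<ge> 2 \<Longrightarrow> nprod Lvir \<omega> n v = 0) \<Longrightarrow> nprod Lvir \<omega> 1 v = scl Lvir l v \<Longrightarrow>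
      v \<in> module.span (scl Lvir) {vac Lvir}"
    using virasoro_quotient[OF L] by blast
  have vsaL: "vertex_superalgebra Lvir" and vacL: "vac Lvir \<noteq> 0"
    using L(2) by (auto simp: simple_quotient_def simple_vsa_def)
  have vsaV: "vertex_superalgebra Vk" and vacV: "vac Vk \<noteq> 0"
    using U(2) by (auto simp: simple_quotient_def simple_vsa_def)
  obtain J e where "lattice_type P 1 J e" using lattice_type_locale[OF P] by auto
  then interpret lattice_type P 1 J e .
  obtain \<beta> where "tensor_product Lvir P T \<beta>" using tensor_vsa_locale[OF vsaL P.vertex_superalgebra_axioms T] .
  then interpret lattice_tensor Lvir P T \<beta> 1 J e
    using \<open>lattice_type P 1 J e\<close> by (simp add: lattice_tensor_def)
  define K where "K = sl2_map \<omega> k"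
  have pp0: "of_int p \<noteq> (0::complex)" "of_int p' \<noteq> (0::complex)" using pp by auto
  have k2: "k + 2 \<noteq> 0" using pp(4) pp0 by simp
  \<comment> \<open>If \<open>k + 1\<close> were an integer, \<open>p'\<close> would divide
    \<open>p\<close>, contradicting coprimality because \<open>p' \<ge> 2\<close>.\<close>
  have kr: "k + 1 \<noteq> of_int r" for r
  proof
    assume "k + 1 = of_int r"
    then have "of_int (r + 1) = k + 1 + 1" by (simp only: of_int_add of_int_1)
    also have "\<dots> = of_int p / of_int p'" using pp(4) by (simp add: add.assoc)
    finally have "of_int p / of_int p' = (of_int (r + 1) :: complex)" by simp
    then have "of_int p = (of_int ((r + 1) * p') :: complex)" using pp0 by (simp add: field_simps)
    then have "p = (r + 1) * p'" by (simp only: of_int_eq_iff)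
    then have "gcd p p' = \<bar>p'\<bar>" by simp
    then show False using pp by simp
  qed
  \<comment> \<open>This is \<open>d_charge p p' = 1 - 6 (k + 1)^2 / (k + 2)\<close> with the
    polynomial from \<open>p_p\<close>.\<close>
  have c: "(k + 2)\<^sup>2 * (d_charge p p' / 2) + (3 * k ^ 3 + 23 / 2 * k\<^sup>2 + 13 * k + 4) = 0"
  proof -
    have k: "k = of_int p / of_int p' - 2" using pp(4) by (simp add: algebra_simps)
    show ?thesis
      unfolding d_charge_def k using pp0 by (simp add: field_simps power2_eq_square power3_eq_cube)
  qed
  have relT: "mode_relations (odd_elt sl2) (affine_bracket sl2 k) T K"
    unfolding K_def by (rule sl2_mode_relations[OF refl \<omega>(1,2) c])
  from U(1) obtain I where vsaU: "vertex_superalgebra Uaff" and I: "\<And>a. I a \<in> part Uaff (odd_elt sl2 a)"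
    and prU: "presents (scl Uaff) (\<lambda>(w, j::unit). act Uaff I w (vac Uaff))
      (induced_relators (odd_elt sl2) (affine_bracket sl2 k) (\<lambda>x j. 0))"
    unfolding universal_affine_def vacuum_vsa_def by blast
  interpret U: vertex_superalgebra Uaff by fact
  note relU = U.induced_relations[where g = "\<lambda>_. vac Uaff", OF prU I]
  have genU: "v \<in> U.span {act Uaff I w (vac Uaff) | w. True}" for v
    using relU(3)[of v] by simp
  obtain \<Phi> where \<Phi>: "vsa_hom Uaff T \<Phi>" and \<Phi>I: "\<And>a. \<Phi> (I a) = K a"
    using vacuum_hom[OF vsaU T.vertex_superalgebra_axioms prU I relT] by blast
  obtain f where f: "vsa_hom Uaff Vk f" "surj f" using U(2) by (auto simp: simple_quotient_def)
  obtain \<delta> where \<delta>: "\<And>a n b. nprod Uaff \<delta> 1 (nprod Uaff (I a) n b) =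
      nprod Uaff (I a) n (nprod Uaff \<delta> 1 b) + scl Uaff (- of_int n) (nprod Uaff (I a) n b)"
    using U.sugawara_sl2[OF relU(1) k2] by blast
  have len: "length w \<le> 1" if "w \<in> Poly_Mapping.keys (affine_bracket sl2 k x y)" for w x y
    by (rule affine_bracket_length) (use that in simp)
  define chg where "chg a = (case a of sE \<Rightarrow> 2 | sF \<Rightarrow> - 2 | sH \<Rightarrow> (0::int))" for a
  have "\<exists>\<Psi>. vsa_hom Vk T \<Psi> \<and> (\<forall>u. \<Psi> (f u) = \<Phi> u)"
  proof (rule hom_factors_through_quotient[where J = I and \<delta> = \<delta> and \<eta> = "I sH" and chg = chg and \<rho> = sE])
    show "v \<in> module.span (scl Uaff) {act Uaff I w (vac Uaff) | w. set w \<subseteq> creation_modes}" for v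
      by (rule U.vacuum_span[OF relU(1) len genU])
    show "nprod Uaff (I sH) 0 (nprod Uaff (I a) n b) =
      nprod Uaff (I a) n (nprod Uaff (I sH) 0 b) + scl Uaff (of_int (chg a)) (nprod Uaff (I a) n b)" for a n b
      by (rule U.zero_mode_charge[OF relU(1)]; cases a)
        (simp_all add: sl2_def chg_def lin_ext_single U.vector_space_axioms)
    show "\<exists>z. \<Phi> i = scl T z (vac T)"
      if "\<And>a n. n \<ge> 1 \<Longrightarrow> nprod T (\<Phi> (I a)) n (\<Phi> i) = 0" "nprod T (\<Phi> (I sE)) 0 (\<Phi> i) = 0"
        "nprod T (\<Phi> (I sH)) 0 (\<Phi> i) = scl T (of_int q) (\<Phi> i)" for i q
      by (rule sl2_singular[OF k2 kr \<omega>(3)]) (use that in \<open>auto simp: \<Phi>I K_def\<close>)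
  qed (use vsaU vsaV vacV T.vertex_superalgebra_axioms \<Phi> f \<delta> in \<open>auto simp: chg_def split: sl2_basis.splits\<close>)
  then obtain \<Psi> where \<Psi>: "vsa_hom Vk T \<Psi>" "\<And>u. \<Psi> (f u) = \<Phi> u" by blast
  \<comment> \<open>The image of \<open>e\<close> has charge 2 under \<open>d(0)\<close>, whereas
    multiples of the vacuum have charge 0.\<close>
  have "\<iota> (e 1) \<noteq> scl T z (vac T)" for z
  proof
    assume *: "\<iota> (e 1) = scl T z (vac T)"
    have "nprod T (\<iota> (J hD)) 0 (\<iota> (e 1)) = scl T 2 (\<iota> (e 1))" by (simp add: \<iota>_mode heis_e)
    moreover have "nprod T (\<iota> (J hD)) 0 (\<iota> (e 1)) = 0" unfolding * by (simp add: T.creation)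
    ultimately show False using beta_eq_zero vacL e_nonzero by fastforce
  qed
  then have "\<Psi> (f (I sE)) \<noteq> scl T z (vac T)" for z by (simp add: \<Psi>(2) \<Phi>I K_def)
  then have "nontrivial_hom T \<Psi>" unfolding nontrivial_hom_def by blast
  then show ?thesis using \<Psi>(1) by blast
qed

section \<open>Tensoring with the fermion\<close>

locale fermion_tensor = tensor_product L F X \<gamma>
  for L :: "'l::ab_group_add vsa" and F :: "'f::ab_group_add vsa" and X :: "'x::ab_group_add vsa" and \<gamma> +
  fixes \<psi> :: "unit \<Rightarrow> 'f"
  assumes \<psi>: "\<psi> a \<in> part F True"
    and presents_F: "Defs.presents (scl F) (\<lambda>(w, j::unit). act F \<psi> w (vac F))
      (induced_relators (\<lambda>_. True) fermion_bracket (\<lambda>x j. 0))"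
begin

definition \<Psi> :: 'x where "\<Psi> = \<gamma> (vac L) (\<psi> ())"

lemma vac_F_nonzero: "vac F \<noteq> 0"
  using fermion_vac_nonzero[OF P.vertex_superalgebra_axioms presents_F] .

lemmas relations_F = P.induced_relations[where g = "\<lambda>_. vac F", OF presents_F \<psi>]

lemma \<psi>_anticommute: "nprod F (\<psi> a) m (nprod F (\<psi> b) n v) =
    - nprod F (\<psi> b) n (nprod F (\<psi> a) m v) + scl F (if m + n + 1 = 0 then 1 else 0) v"
  using mode_relationsD(2)[OF relations_F(1), of a m b n v]
  by (simp add: lin_ext_single P.vector_space_axioms)

lemma \<Psi>_odd: "\<Psi> \<in> part X True"
  using part_T[OF X.vac_even \<psi>] by (simp add: \<Psi>_def)

lemma \<Psi>_mode: "u \<in> part L p \<Longrightarrow> nprod X \<Psi> n (\<gamma> u b) = scl X (ksign True p) (\<gamma> u (nprod F (\<psi> ()) n b))"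
  unfolding \<Psi>_def by (rule nprod_right_factor[OF \<psi>])

lemma \<Psi>_ope: "n \<ge> 0 \<Longrightarrow> nprod X \<Psi> n \<Psi> = (if n = 0 then vac X else 0)"
proof -
  assume "n \<ge> 0"
  have "nprod F (\<psi> ()) n (nprod F (\<psi> ()) (- 1) (vac F)) = scl F (if n = 0 then 1 else 0) (vac F)"
    using \<psi>_anticommute[of "()" n "()" "- 1" "vac F"] \<open>n \<ge> 0\<close> by (simp add: P.creation)
  then show ?thesis
    using \<Psi>_mode[OF X.vac_even, of n "\<psi> ()"] by (simp add: P.creation \<Psi>_def vac_T)
qed

lemma \<Psi>_anticommute: "nprod X \<Psi> m (nprod X \<Psi> n v) =
    - nprod X \<Psi> n (nprod X \<Psi> m v) + scl X (if m + n + 1 = 0 then 1 else 0) v"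
  using T.commutator[OF \<Psi>_odd \<Psi>_odd, of 1 m n v] by (simp add: \<Psi>_ope T.vacuum)

lemma left_factor_part: "a \<in> part L p \<Longrightarrow> \<gamma> a (vac F) \<in> part X p"
  using part_T[OF _ P.vac_even, of a p] by simp

lemma left_\<Psi>_commute:
  assumes "a \<in> part L p"
  shows "nprod X (\<gamma> a (vac F)) m (nprod X \<Psi> n v) = scl X (ksign p True) (nprod X \<Psi> n (nprod X (\<gamma> a (vac F)) m v))"
  by (rule T.supercommute[OF left_factor_part[OF assms] \<Psi>_odd]) (simp add: \<Psi>_def nprod_left_factor X.creation)

text \<open>The conformal vector of the fermion, of central charge 1/2, placed in the tensor
  product; it measures the fermionic factor only.\<close>

definition \<theta> :: 'x where "\<theta> = scl X (1 / 2) (nprod X \<Psi> (- 2) \<Psi>)"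

lemma \<theta>_even: "\<theta> \<in> part X False"
  using T.parity_odd[OF \<Psi>_odd \<Psi>_odd] by (simp add: \<theta>_def)

lemma \<theta>_mode:
  assumes "\<And>j. j \<ge> 2 \<Longrightarrow> nprod X \<Psi> (int j) v = 0" "\<And>j. j \<ge> 2 \<Longrightarrow> nprod X \<Psi> (n + int j) v = 0"
  shows "nprod X \<theta> n v = scl X (1 / 2)
    (nprod X \<Psi> (- 2) (nprod X \<Psi> n v) + nprod X \<Psi> (n - 2) (nprod X \<Psi> 0 v) +
     scl X 2 (nprod X \<Psi> (- 3) (nprod X \<Psi> (n + 1) v) + nprod X \<Psi> (n - 3) (nprod X \<Psi> 1 v)))"
  unfolding \<theta>_def using T.normal_product_deriv[OF \<Psi>_odd \<Psi>_odd assms] by (simp add: numeral_2_eq_2)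

lemma \<theta>_\<Psi>: "nprod X \<theta> 0 \<Psi> = nprod X \<Psi> (- 2) (vac X)" "nprod X \<theta> 1 \<Psi> = scl X (1 / 2) \<Psi>"
  by (subst \<theta>_mode; simp add: \<Psi>_ope T.creation flip: T.scale_two)+

lemma \<theta>_grading: "nprod X \<theta> 1 (nprod X \<Psi> n v) =
     nprod X \<Psi> n (nprod X \<theta> 1 v) + scl X (- of_int n - 1 / 2) (nprod X \<Psi> n v)"
  using T.grading[OF \<theta>_even \<Psi>_odd \<theta>_\<Psi>, of n v] by (simp add: algebra_simps)

lemma \<theta>_annihilates: "(\<And>n. n \<ge> 0 \<Longrightarrow> nprod X \<Psi> n v = 0) \<Longrightarrow> nprod X \<theta> 1 v = 0"
  by (subst \<theta>_mode) auto

definition fermion_level :: "complex \<Rightarrow> 'x set" where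
  "fermion_level m = {act X (\<lambda>_. \<Psi>) w (\<gamma> u (vac F)) | (w :: unit word) u.
     set w \<subseteq> creation_modes \<and> word_sum (\<lambda>x. - of_int (snd x) - 1 / 2) w = m}"

lemma \<Psi>_vacuum: "n \<ge> 0 \<Longrightarrow> nprod X \<Psi> n (\<gamma> u (vac F)) = 0"
proof -
  assume n: "n \<ge> 0"
  obtain a b where u: "u = a + b" "a \<in> part L False" "b \<in> part L True" using X.part_sum by blast
  show ?thesis using n by (simp add: u(1) \<Psi>_mode[OF u(2)] \<Psi>_mode[OF u(3)] P.creation)
qed

lemma fermion_level_eigen: "x \<in> fermion_level m \<Longrightarrow> nprod X \<theta> 1 x = scl X m x"
  using T.act_eigen[where w = \<theta> and k = 1 and J = "\<lambda>_::unit. \<Psi>" and \<gamma> = "\<lambda>x. - of_int (snd x) - 1 / 2" and c = 0] \<theta>_grading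
  by (auto simp: fermion_level_def \<theta>_annihilates \<Psi>_vacuum)

lemma fermion_level_zero: "fermion_level 0 \<subseteq> range (\<lambda>u. \<gamma> u (vac F))"
proof
  fix x assume "x \<in> fermion_level 0"
  then obtain w :: "unit word" and u where x: "x = act X (\<lambda>_. \<Psi>) w (\<gamma> u (vac F))" "set w \<subseteq> creation_modes"
    "word_sum (\<lambda>x. - of_int (snd x) - 1 / 2) w = (0::complex)"
    by (auto simp: fermion_level_def)
  have sum: "word_sum (\<lambda>x. - of_int (snd x) - 1 / 2) w = (of_real (word_sum (\<lambda>x. - of_int (snd x) - 1 / 2) w) :: complex)"
    for w :: "unit word" by (induction w) auto
  have pos: "word_sum (\<lambda>x. - of_int (snd x) - 1 / 2) w > (0::real)" if "set w \<subseteq> creation_modes" "w \<noteq> []" for w :: "unit word"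
    using that
  proof (induction w)
    case (Cons x w)
    then have "snd x \<le> - 1" by auto
    then have "of_int (snd x) \<le> (- 1 :: real)" by linarith
    then show ?case using Cons by (cases "w = []") auto
  qed simp
  have "w = []" using x(2,3) pos[of w] unfolding sum by (cases "w = []") auto
  then show "x \<in> range (\<lambda>u. \<gamma> u (vac F))" using x(1) by simp
qed

lemma fermion_span: "v \<in> T.span (\<Union>m. fermion_level m)"
proof -
  let ?W = "\<lambda>w. act F \<psi> w (vac F)"
  have word: "\<gamma> u (?W w) \<in> T.span (\<Union>m. fermion_level m)" if w: "set w \<subseteq> creation_modes" and u: "u \<in> part L p" for u p w
  proof -
    \<comment> \<open>Moving \<Psi> past \<open>u\<close> produces a sign depending on the parity of
      \<open>u\<close>. That it squares to 1 suffices to invert the relation.\<close>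
    have "\<exists>z. act X (\<lambda>_. \<Psi>) w (\<gamma> u (vac F)) = scl X z (\<gamma> u (?W w)) \<and> z * z = 1" for w
    proof (induction w)
      case Nil
      show ?case by (rule exI[of _ 1]) simp
    next
      case (Cons x w)
      then obtain z where "act X (\<lambda>_. \<Psi>) w (\<gamma> u (vac F)) = scl X z (\<gamma> u (?W w))" "z * z = 1" by blast
      then show ?case
        by (intro exI[of _ "z * ksign True p"]) (simp add: \<Psi>_mode[OF u] mult.assoc mult.left_commute)
    qed
    then obtain z where z: "act X (\<lambda>_. \<Psi>) w (\<gamma> u (vac F)) = scl X z (\<gamma> u (?W w))" "z * z = 1" by blast
    then have "\<gamma> u (?W w) = scl X z (act X (\<lambda>_. \<Psi>) w (\<gamma> u (vac F)))" by simp
    also have "\<dots> \<in> T.span (\<Union>m. fermion_level m)"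
      using w by (intro T.span_scale T.span_base) (auto simp: fermion_level_def)
    finally show ?thesis .
  qed
  have spanF: "b \<in> P.span {?W w | w. set w \<subseteq> creation_modes}" for b
  proof (rule P.vacuum_span[OF relations_F(1)])
    show "length w \<le> 1" if "w \<in> Poly_Mapping.keys (fermion_bracket x y)" for x y w
      using that by (cases x; cases y) (auto split: if_splits)
    show "b \<in> P.span {?W w | w. True}" using relations_F(3)[of b] by simp
  qed
  have "\<gamma> u b \<in> T.span (\<Union>m. fermion_level m)" for u b
    using spanF[of b]
  proof (induction rule: P.span_induct_alt)
    case (step z x y)
    then obtain w where w: "x = ?W w" "set w \<subseteq> creation_modes" by blast
    obtain a b where u: "u = a + b" "a \<in> part L False" "b \<in> part L True" using X.part_sum by blast
    have "\<gamma> u x \<in> T.span (\<Union>m. fermion_level m)"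
      using word[OF w(2) u(2)] word[OF w(2) u(3)] by (simp add: w(1) u(1) T.span_add)
    then show ?case using step by (simp add: T.span_add T.span_scale)
  qed (simp add: T.span_zero)
  then show ?thesis
    using T_span[of v] T.span_minimal[OF _ T.subspace_span, of "{\<gamma> a b | a b. True}"] by blast
qed

text \<open>The annihilating modes of \<Psi> make the fermionic level operator kill
  \<open>v\<close>, and level 0 contains only tensors with the fermionic vacuum.\<close>

lemma fermion_vacuum_space:
  assumes "\<And>n. n \<ge> 0 \<Longrightarrow> nprod X \<Psi> n v = 0"
  obtains u where "v = \<gamma> u (vac F)"
proof -
  have "nprod X \<theta> 1 v = scl X 0 v" by (simp add: \<theta>_annihilates assms)
  with fermion_level_eigen fermion_span have "v \<in> T.span (fermion_level 0)" by (rule T.eigen_span)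
  moreover have "T.subspace (range (\<lambda>u. \<gamma> u (vac F)))"
    by (auto simp: T.subspace_def image_iff simp flip: beta_linear) (metis beta_zero(1))
  ultimately have "v \<in> range (\<lambda>u. \<gamma> u (vac F))"
    using T.span_minimal[OF fermion_level_zero] by blast
  then show ?thesis using that by blast
qed

end

text \<open>Merges the Neveu-Schwarz and fermionic factors: \<tau> and \<Psi> anticommute as odd
  elements of different factors. For a singular vector, \<Psi> first strips the fermionic factor,
  and simplicity of \<open>L\<close> treats the rest.\<close>

lemma ns_fermion:
  assumes U: "universal_ns c U" "simple_quotient U L" and F: "fermion_vsa F" and X: "tensor_vsa L F X"
  obtains \<omega> \<tau> \<Psi> where "\<omega> \<in> part X False" "\<tau> \<in> part X True" "\<Psi> \<in> part X True"
    "\<And>m n v. nprod X \<tau> m (nprod X \<tau> n v) = - nprod X \<tau> n (nprod X \<tau> m v) +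
      scl X 2 (nprod X \<omega> (m + n) v) +
      scl X (if m + n = 1 then c / 3 * ((of_int m - 1 / 2) ^ 2 - 1 / 4) else 0) v"
    "\<And>m n v. nprod X \<omega> m (nprod X \<tau> n v) = nprod X \<tau> n (nprod X \<omega> m v) +
     scl X ((of_int m - 1) / 2 - (of_int n - 1 / 2)) (nprod X \<tau> (m + n - 1) v)"
    "\<And>m n v. nprod X \<Psi> m (nprod X \<Psi> n v) =
      - nprod X \<Psi> n (nprod X \<Psi> m v) + scl X (if m + n + 1 = 0 then 1 else 0) v"
    "\<And>m n v. nprod X \<tau> m (nprod X \<Psi> n v) = - nprod X \<Psi> n (nprod X \<tau> m v)"
    "\<And>m n v. nprod X \<omega> m (nprod X \<Psi> n v) = nprod X \<Psi> n (nprod X \<omega> m v)"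
    "\<And>v l. (\<And>n. n \<ge> 0 \<Longrightarrow> nprod X \<Psi> n v = 0) \<Longrightarrow> (\<And>n. n \<ge> 1 \<Longrightarrow> nprod X \<tau> n v = 0) \<Longrightarrow>
      nprod X \<omega> 1 v = scl X l v \<Longrightarrow> v \<in> module.span (scl X) {vac X}"
    "vac X \<noteq> 0"
proof -
  obtain \<omega> \<tau> where L: "\<omega> \<in> part L False" "\<tau> \<in> part L True"
    "\<And>m n v. nprod L \<tau> m (nprod L \<tau> n v) = - nprod L \<tau> n (nprod L \<tau> m v) +
      scl L 2 (nprod L \<omega> (m + n) v) +
      scl L (if m + n = 1 then c / 3 * ((of_int m - 1 / 2) ^ 2 - 1 / 4) else 0) v"
    "\<And>m n v. nprod L \<omega> m (nprod L \<tau> n v) = nprod L \<tau> n (nprod L \<omega> m v) +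
     scl L ((of_int m - 1) / 2 - (of_int n - 1 / 2)) (nprod L \<tau> (m + n - 1) v)"
    "\<And>v l. (\<And>n. n \<ge> 1 \<Longrightarrow> nprod L \<tau> n v = 0) \<Longrightarrow> nprod L \<omega> 1 v = scl L l v \<Longrightarrow>
      v \<in> module.span (scl L) {vac L}"
    using ns_quotient[OF U] by blast
  have vsaL: "vertex_superalgebra L" and vacL: "vac L \<noteq> 0"
    using U(2) by (auto simp: simple_quotient_def simple_vsa_def)
  from F obtain \<psi> where F': "vertex_superalgebra F" "\<And>a. \<psi> a \<in> part F True"
    "presents (scl F) (\<lambda>(w, j::unit). act F \<psi> w (vac F)) (induced_relators (\<lambda>_. True) fermion_bracket (\<lambda>x j. 0))"
    unfolding fermion_vsa_def vacuum_vsa_def by blast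
  obtain \<gamma> where "tensor_product L F X \<gamma>" using tensor_vsa_locale[OF vsaL F'(1) X] .
  then interpret fermion_tensor L F X \<gamma> \<psi>
    using F' by (simp add: fermion_tensor_def fermion_tensor_axioms_def)
  let ?\<omega> = "\<gamma> \<omega> (vac F)" and ?\<tau> = "\<gamma> \<tau> (vac F)"
  show ?thesis
  proof (rule that[of ?\<omega> ?\<tau> \<Psi>])
    show "?\<omega> \<in> part X False" "?\<tau> \<in> part X True" "\<Psi> \<in> part X True"
      using left_factor_part L \<Psi>_odd by auto
    show "nprod X ?\<tau> m (nprod X ?\<tau> n v) = - nprod X ?\<tau> n (nprod X ?\<tau> m v) +
      scl X 2 (nprod X ?\<omega> (m + n) v) +
      scl X (if m + n = 1 then c / 3 * ((of_int m - 1 / 2) ^ 2 - 1 / 4) else 0) v" for m n v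
      using T_span[of v]
    proof (induction rule: T.span_induct_alt)
      case (step z x y)
      then obtain u b where "x = \<gamma> u b" by blast
      then have "nprod X ?\<tau> m (nprod X ?\<tau> n x) = - nprod X ?\<tau> n (nprod X ?\<tau> m x) +
        scl X 2 (nprod X ?\<omega> (m + n) x) +
        scl X (if m + n = 1 then c / 3 * ((of_int m - 1 / 2) ^ 2 - 1 / 4) else 0) x"
        using arg_cong[OF L(3)[of m n u], of "\<lambda>w. \<gamma> w b"] by (simp only: nprod_left_factor beta_linear beta_minus)
      then show ?case using step by (simp only: T.nprod_right T.scale_right_distrib T.scale_minus_right T.scale_left_commute[of _ z] minus_add_distrib)
          (simp add: algebra_simps)
    qed simp
    show "nprod X ?\<omega> m (nprod X ?\<tau> n v) = nprod X ?\<tau> n (nprod X ?\<omega> m v) +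
     scl X ((of_int m - 1) / 2 - (of_int n - 1 / 2)) (nprod X ?\<tau> (m + n - 1) v)" for m n v
      using T_span[of v]
    proof (induction rule: T.span_induct_alt)
      case (step z x y)
      then obtain u b where "x = \<gamma> u b" by blast
      then have "nprod X ?\<omega> m (nprod X ?\<tau> n x) = nprod X ?\<tau> n (nprod X ?\<omega> m x) +
        scl X ((of_int m - 1) / 2 - (of_int n - 1 / 2)) (nprod X ?\<tau> (m + n - 1) x)"
        using arg_cong[OF L(4)[of m n u], of "\<lambda>w. \<gamma> w b"] by (simp only: nprod_left_factor beta_linear beta_minus)
      then show ?case using step by (simp only: T.nprod_right T.scale_right_distrib T.scale_left_commute[of _ z])
          (simp only: ac_simps)
    qed simp
    show "nprod X \<Psi> m (nprod X \<Psi> n v) =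
      - nprod X \<Psi> n (nprod X \<Psi> m v) + scl X (if m + n + 1 = 0 then 1 else 0) v" for m n v
      by (rule \<Psi>_anticommute)
    show "nprod X ?\<tau> m (nprod X \<Psi> n v) = - nprod X \<Psi> n (nprod X ?\<tau> m v)" for m n v
      using left_\<Psi>_commute[OF L(2)] by simp
    show "nprod X ?\<omega> m (nprod X \<Psi> n v) = nprod X \<Psi> n (nprod X ?\<omega> m v)" for m n v
      using left_\<Psi>_commute[OF L(1)] by simp
    show "v \<in> T.span {vac X}" if v: "\<And>n. n \<ge> 0 \<Longrightarrow> nprod X \<Psi> n v = 0" "\<And>n. n \<ge> 1 \<Longrightarrow> nprod X ?\<tau> n v = 0"
      "nprod X ?\<omega> 1 v = scl X l v" for v l
    proof -
      obtain u where u: "v = \<gamma> u (vac F)" using fermion_vacuum_space[OF v(1)] .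
      have "u \<in> X.span {vac L}"
      proof (rule L(5)[of u l])
        show "nprod L \<tau> n u = 0" if "n \<ge> 1" for n
          using v(2)[OF that] beta_eq_zero vac_F_nonzero by (auto simp: u nprod_left_factor)
        have "\<gamma> (nprod L \<omega> 1 u - scl L l u) (vac F) = 0"
          using v(3) by (simp add: u nprod_left_factor)
        then show "nprod L \<omega> 1 u = scl L l u" using beta_eq_zero vac_F_nonzero by fastforce
      qed
      then obtain z where "u = scl L z (vac L)" by (auto simp: X.span_singleton)
      then show ?thesis by (simp add: u vac_T[symmetric] T.span_scale T.span_base)
    qed
    show "vac X \<noteq> 0" using beta_eq_zero[of "vac L" "vac F"] vac_T vacL vac_F_nonzero by auto
  qed
qed

section \<open>The relations of osp(1,2) in terms of its odd generators\<close>

context vertex_superalgebra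
begin

fun osp_map :: "'v \<Rightarrow> 'v \<Rightarrow> 'v \<Rightarrow> 'v \<Rightarrow> 'v \<Rightarrow> osp_basis \<Rightarrow> 'v" where
  "osp_map e f h x y oE = e"
| "osp_map e f h x y oF = f"
| "osp_map e f h x y oH = h"
| "osp_map e f h x y oX = x"
| "osp_map e f h x y oY = y"

text \<open>
  Since \<open>e\<close> and \<open>f\<close> are quadratic in the odd generators, the operator products among \<open>h\<close>, \<open>x\<close>, \<open>y\<close>
  and the vanishing of those of \<open>e\<close> with \<open>x\<close> and of \<open>f\<close> with \<open>y\<close> determine all others.  The latter
  do not follow from the Jacobi identity.
\<close>

lemma osp_mode_relations:
  assumes p: "e \<in> part V False" "f \<in> part V False" "h \<in> part V False" "x \<in> part V True" "y \<in> part V True"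
    and xx: "\<And>n. n \<ge> 0 \<Longrightarrow> nprod V x n x = (if n = 0 then scl V 2 e else 0)"
    and yy: "\<And>n. n \<ge> 0 \<Longrightarrow> nprod V y n y = (if n = 0 then scl V (- 2) f else 0)"
    and xy: "\<And>n. n \<ge> 0 \<Longrightarrow> nprod V x n y = (if n = 0 then h else if n = 1 then scl V (2 * k) (vac V) else 0)"
    and hx: "\<And>n. n \<ge> 0 \<Longrightarrow> nprod V h n x = (if n = 0 then x else 0)"
    and hy: "\<And>n. n \<ge> 0 \<Longrightarrow> nprod V h n y = (if n = 0 then - y else 0)"
    and hh: "\<And>n. n \<ge> 0 \<Longrightarrow> nprod V h n h = (if n = 1 then scl V (2 * k) (vac V) else 0)"
    and ex: "\<And>n. n \<ge> 0 \<Longrightarrow> nprod V e n x = 0"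
    and fy: "\<And>n. n \<ge> 0 \<Longrightarrow> nprod V f n y = 0"
  shows "mode_relations (odd_elt osp12) (affine_bracket osp12 k) V (osp_map e f h x y)"
proof -
  have half: "u = v" if "scl V 2 u = scl V 2 v" for u v
    using that by simp
  have half': "u = v" if "scl V (- 2) u = scl V (- 2) v" for u v
    using that by (simp only: scale_cancel_left) simp
  have cxx: "nprod V x m (nprod V x n v) + nprod V x n (nprod V x m v) = scl V 2 (nprod V e (m + n) v)" for m n v
    using commutator[OF p(4,4), of 1 m n v] by (simp add: xx)
  have cyy: "nprod V y m (nprod V y n v) + nprod V y n (nprod V y m v) = scl V (- 2) (nprod V f (m + n) v)" for m n v
    using commutator[OF p(5,5), of 1 m n v] by (simp add: yy)
  have chx: "nprod V h m (nprod V x n v) = nprod V x n (nprod V h m v) + nprod V x (m + n) v" for m n v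
    using commutator[OF p(3,4), of 1 m n v] by (simp add: hx)
  have chy: "nprod V h m (nprod V y n v) = nprod V y n (nprod V h m v) - nprod V y (m + n) v" for m n v
    using commutator[OF p(3,5), of 1 m n v] by (simp add: hy)
  have xh: "nprod V x n h = (if n = 0 then - x else 0)" if "n \<ge> 0" for n
    using affine_skew[OF p(3,4) _ that, of x 0] hx by simp
  have yh: "nprod V y n h = (if n = 0 then y else 0)" if "n \<ge> 0" for n
    using affine_skew[OF p(3,5) _ that, of "- y" 0] hy by simp
  have yx: "nprod V y n x = (if n = 0 then h else if n = 1 then - scl V (2 * k) (vac V) else 0)" if "n \<ge> 0" for n
    using affine_skew[OF p(4,5) xy that] by simp
  \<comment> \<open>Since \<open>2 e = x_(0) x\<close>, the product \<open>e_(n) y\<close> is read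
    off from the anticommutator of \<open>x_(0)\<close> and \<open>x_(n)\<close> on
    \<open>y\<close>. The remaining products with \<open>e\<close> and \<open>f\<close> are reduced
    to squares of \<open>x\<close> and \<open>y\<close> in the same manner.\<close>
  have ey: "nprod V e n y = (if n = 0 then - x else 0)" if n: "n \<ge> 0" for n
  proof (rule half)
    show "scl V 2 (nprod V e n y) = scl V 2 (if n = 0 then - x else 0)"
      using cxx[of 0 n y] n by (auto simp: xy[OF n] xy xh[OF n] xh creation scale_two split: if_splits)
  qed
  have fx: "nprod V f n x = (if n = 0 then - y else 0)" if n: "n \<ge> 0" for n
  proof (rule half')
    show "scl V (- 2) (nprod V f n x) = scl V (- 2) (if n = 0 then - y else 0)"
      using cyy[of 0 n x] n by (auto simp: yx[OF n] yx yh[OF n] yh creation scale_two split: if_splits)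
  qed
  have he: "nprod V h n e = (if n = 0 then scl V 2 e else 0)" if n: "n \<ge> 0" for n
  proof (rule half)
    have "nprod V h n (nprod V x 0 x) = scl V 2 (if n = 0 then scl V 2 e else 0)"
      unfolding chx using n by (auto simp: hx[OF n] xx[OF n] xx scale_two scale_multiples)
    then show "scl V 2 (nprod V h n e) = scl V 2 (if n = 0 then scl V 2 e else 0)" by (simp add: xx)
  qed
  have hf: "nprod V h n f = (if n = 0 then scl V (- 2) f else 0)" if n: "n \<ge> 0" for n
  proof (rule half')
    have "nprod V h n (nprod V y 0 y) = scl V (- 2) (if n = 0 then scl V (- 2) f else 0)"
      unfolding chy using n by (auto simp: hy[OF n] yy[OF n] yy scale_two scale_multiples)
    then show "scl V (- 2) (nprod V h n f) = scl V (- 2) (if n = 0 then scl V (- 2) f else 0)" by (simp add: yy)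
  qed
  have cex: "nprod V e m (nprod V x n v) = nprod V x n (nprod V e m v)" for m n v
    using supercommute[OF p(1,4) ex] by simp
  have cfy: "nprod V f m (nprod V y n v) = nprod V y n (nprod V f m v)" for m n v
    using supercommute[OF p(2,5) fy] by simp
  have cey: "nprod V e m (nprod V y n v) = nprod V y n (nprod V e m v) - nprod V x (m + n) v" for m n v
    using commutator[OF p(1,5), of 1 m n v] by (simp add: ey)
  have ee: "nprod V e n e = 0" if n: "n \<ge> 0" for n
  proof (rule half)
    have "nprod V e n (nprod V x 0 x) = 0" unfolding cex using ex[OF n] by simp
    then show "scl V 2 (nprod V e n e) = scl V 2 0" by (simp add: xx)
  qed
  have ff: "nprod V f n f = 0" if n: "n \<ge> 0" for n
  proof (rule half')
    have "nprod V f n (nprod V y 0 y) = 0" unfolding cfy using fy[OF n] by simp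
    then show "scl V (- 2) (nprod V f n f) = scl V (- 2) 0" by (simp add: yy)
  qed
  have ef: "nprod V e n f = (if n = 0 then h else if n = 1 then scl V k (vac V) else 0)" if n: "n \<ge> 0" for n
  proof (rule half')
    have "nprod V e n (nprod V y 0 y) = scl V (- 2) (if n = 0 then h else if n = 1 then scl V k (vac V) else 0)"
      unfolding cey using n by (auto simp: ey[OF n] yx[OF n] yx xy[OF n] xy scale_multiples)
    then show "scl V (- 2) (nprod V e n f) = scl V (- 2) (if n = 0 then h else if n = 1 then scl V k (vac V) else 0)"
      by (simp add: yy)
  qed
  have xe: "nprod V x n e = 0" if "n \<ge> 0" for n
    using affine_skew[OF p(1,4) _ that, of 0 0] ex by simp
  have yf: "nprod V y n f = 0" if "n \<ge> 0" for n
    using affine_skew[OF p(2,5) _ that, of 0 0] fy by simp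
  have ye: "nprod V y n e = (if n = 0 then x else 0)" if "n \<ge> 0" for n
    using affine_skew[OF p(1,5) _ that, of "- x" 0] ey by simp
  have xf: "nprod V x n f = (if n = 0 then y else 0)" if "n \<ge> 0" for n
    using affine_skew[OF p(2,4) _ that, of "- y" 0] fx by simp
  have eh: "nprod V e n h = (if n = 0 then - scl V 2 e else 0)" if "n \<ge> 0" for n
    using affine_skew[OF p(3,1) _ that, of "scl V 2 e" 0] he by simp
  have fh: "nprod V f n h = (if n = 0 then scl V 2 f else 0)" if "n \<ge> 0" for n
    using affine_skew[OF p(3,2) _ that, of "scl V (- 2) f" 0] hf by simp
  have fe: "nprod V f n e = (if n = 0 then - h else if n = 1 then scl V k (vac V) else 0)" if "n \<ge> 0" for n
    using affine_skew[OF p(1,2) ef that] by simp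
  show ?thesis
  proof (rule affine_mode_relationsI)
    show "osp_map e f h x y a \<in> part V (odd_elt osp12 a)" for a
      using p by (cases a) (auto simp: osp12_def)
    show "nprod V (osp_map e f h x y a) n (osp_map e f h x y b) =
      (if n = 0 then lin_ext (scl V) (osp_map e f h x y) (bracket osp12 a b)
       else if n = 1 then scl V (form osp12 a b * k) (vac V) else 0)" if n: "n \<ge> 0" for a b n
      by (cases a; cases b)
        (simp_all add: osp12_def lin_ext_single vector_space_axioms xx[OF n] yy[OF n] xy[OF n] yx[OF n]
          hx[OF n] hy[OF n] hh[OF n] xh[OF n] yh[OF n] ex[OF n] ey[OF n] fx[OF n] fy[OF n] xe[OF n] ye[OF n] xf[OF n] yf[OF n]
          he[OF n] hf[OF n] eh[OF n] fh[OF n] ee[OF n] ff[OF n] ef[OF n] fe[OF n])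
  qed
qed

end

context lattice_tensor
begin

lemma nprod_tensor_single:
  assumes "\<And>i. i \<noteq> l \<Longrightarrow> nprod X a i a' = 0 \<or> nprod P b (n - 1 - i) b' = 0"
  shows "nprod T (\<beta> a b) n (\<beta> a' b') = \<beta> (nprod X a l a') (nprod P b (n - 1 - l) b')"
  using nprod_tensor[of "{l}" a a' b n b'] assms by simp

lemma nprod_tensor_zero:
  assumes "\<And>i. nprod X a i a' = 0 \<or> nprod P b (n - 1 - i) b' = 0"
  shows "nprod T (\<beta> a b) n (\<beta> a' b') = 0"
  using nprod_tensor[of "{}" a a' b n b'] assms by simp

lemma nprod_tensor_two:
  assumes "l \<noteq> l'" "\<And>i. i \<noteq> l \<Longrightarrow> i \<noteq> l' \<Longrightarrow> nprod X a i a' = 0 \<or> nprod P b (n - 1 - i) b' = 0"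
  shows "nprod T (\<beta> a b) n (\<beta> a' b') = \<beta> (nprod X a l a') (nprod P b (n - 1 - l) b') +
    \<beta> (nprod X a l' a') (nprod P b (n - 1 - l') b')"
  using nprod_tensor[of "{l, l'}" a a' b n b'] assms by simp

end

section \<open>The realization of affine osp(1,2)\<close>

text \<open>Collects what is used of the factor \<open>X\<close>. Given the first condition on
  \<open>A\<close>, the second states that
  \<open>c = - (3/2) (2 k + 1) (4 k + 5) / (2 k + 3)\<close>, the value of
  \<open>c_charge p q\<close> at this level.\<close>

locale osp_realization = lattice_tensor X P T \<beta> "1 / 2" J e
  for X :: "'x::ab_group_add vsa" and P :: "'p::ab_group_add vsa" and T :: "'t::ab_group_add vsa"
    and \<beta> J e +
  fixes \<omega> \<tau> \<Psi> :: 'x and c k A :: complex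
  assumes X_part: "\<omega> \<in> part X False" "\<tau> \<in> part X True" "\<Psi> \<in> part X True"
    and \<tau>\<tau>: "\<And>m n v. nprod X \<tau> m (nprod X \<tau> n v) = - nprod X \<tau> n (nprod X \<tau> m v) +
      scl X 2 (nprod X \<omega> (m + n) v) +
      scl X (if m + n = 1 then c / 3 * ((of_int m - 1 / 2) ^ 2 - 1 / 4) else 0) v"
    and \<omega>\<tau>: "\<And>m n v. nprod X \<omega> m (nprod X \<tau> n v) = nprod X \<tau> n (nprod X \<omega> m v) +
     scl X ((of_int m - 1) / 2 - (of_int n - 1 / 2)) (nprod X \<tau> (m + n - 1) v)"
    and \<Psi>\<Psi>: "\<And>m n v. nprod X \<Psi> m (nprod X \<Psi> n v) =
      - nprod X \<Psi> n (nprod X \<Psi> m v) + scl X (if m + n + 1 = 0 then 1 else 0) v"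
    and \<tau>\<Psi>: "\<And>m n v. nprod X \<tau> m (nprod X \<Psi> n v) = - nprod X \<Psi> n (nprod X \<tau> m v)"
    and \<omega>\<Psi>: "\<And>m n v. nprod X \<omega> m (nprod X \<Psi> n v) = nprod X \<Psi> n (nprod X \<omega> m v)"
    and vacX: "vac X \<noteq> 0"
    and A: "A * A = - (2 * k + 3)" "A * A * (2 * c / 3) = (2 * k + 1) * (4 * k + 5)" "A \<noteq> 0"
begin

abbreviation \<Psi>' :: 'x where "\<Psi>' \<equiv> nprod X \<Psi> (- 2) (vac X)"

text \<open>Forced by \<open>x_(1) y = 2 k vac\<close>: the term \<open>\<Psi> \<otimes> q1\<close>
  contributes -1 and the term with the derivative of \<Psi> contributes \<open>B\<close>.\<close>

definition B :: complex where "B = 2 * k + 1"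

abbreviation E :: 'p where "E \<equiv> e (- 1)"

definition x_vec :: 't where "x_vec = \<beta> \<Psi> (e 1)"

definition y_vec :: 't where "y_vec = scl T A (\<beta> \<tau> E) + \<beta> \<Psi> (q1 k) + scl T B (\<beta> \<Psi>' E)"

abbreviation h_el :: 't where "h_el \<equiv> \<iota> (h_vec k)"

lemma \<Psi>'_mode: "nprod X \<Psi>' n v = scl X (- of_int n) (nprod X \<Psi> (n - 1) v)"
  by (rule X.translate_mode)

lemma \<Psi>_ope: "n \<ge> 0 \<Longrightarrow> nprod X \<Psi> n \<Psi> = (if n = 0 then vac X else 0)"
  using \<Psi>\<Psi>[of n "- 1" "vac X"] by (simp add: X.creation)

lemma \<Psi>_\<Psi>': "n \<ge> 0 \<Longrightarrow> nprod X \<Psi> n \<Psi>' = (if n = 1 then vac X else 0)"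
  using \<Psi>\<Psi>[of n "- 2" "vac X"] by (simp add: X.creation)

lemma \<Psi>_sq: "nprod X \<Psi> (- 1) \<Psi> = 0"
proof -
  have "scl X 2 (nprod X \<Psi> (- 1) (nprod X \<Psi> (- 1) (vac X))) = 0"
    using \<Psi>\<Psi>[of "- 1" "- 1" "vac X"] by (simp add: X.scale_two eq_neg_iff_add_eq_0)
  then show ?thesis by (simp add: X.creation)
qed

lemma \<Psi>_m1_\<Psi>': "nprod X \<Psi> (- 1) \<Psi>' = - nprod X \<Psi> (- 2) \<Psi>"
  using \<Psi>\<Psi>[of "- 1" "- 2" "vac X"] by (simp add: X.creation)

lemma \<tau>_\<Psi>_ope: "n \<ge> 0 \<Longrightarrow> nprod X \<tau> n (nprod X \<Psi> m (vac X)) = 0" "n \<ge> 0 \<Longrightarrow> nprod X \<tau> n \<Psi> = 0"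
  using \<tau>\<Psi>[of n m "vac X"] \<tau>\<Psi>[of n "- 1" "vac X"] by (simp_all add: X.creation)

lemma \<Psi>_\<tau>_ope: "n \<ge> 0 \<Longrightarrow> nprod X \<Psi> n \<tau> = 0"
  using \<tau>\<Psi>[of "- 1" n "vac X"] by (simp add: X.creation)

lemma \<Psi>_m1_\<tau>: "nprod X \<Psi> (- 1) \<tau> = - nprod X \<tau> (- 1) \<Psi>"
  using \<tau>\<Psi>[of "- 1" "- 1" "vac X"] by (simp add: X.creation)

lemma \<tau>_ope: "n \<ge> 0 \<Longrightarrow> nprod X \<tau> n \<tau> = (if n = 0 then scl X 2 \<omega> else if n = 2 then scl X (2 * c / 3) (vac X) else 0)"
  using \<tau>\<tau>[of n "- 1" "vac X"] by (auto simp: X.creation power2_eq_square)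

lemma \<tau>_\<omega>: "n \<ge> 1 \<Longrightarrow> nprod X \<tau> n \<omega> = (if n = 1 then scl X (3 / 2) \<tau> else 0)"
proof -
  assume n: "n \<ge> 1"
  have "nprod X \<omega> (- 1) (nprod X \<tau> n (vac X)) = nprod X \<tau> n (nprod X \<omega> (- 1) (vac X)) +
     scl X ((of_int (- 1) - 1) / 2 - (of_int n - 1 / 2)) (nprod X \<tau> (- 1 + n - 1) (vac X))"
    by (rule \<omega>\<tau>)
  then have "nprod X \<tau> n \<omega> = scl X (of_int n + 1 / 2) (nprod X \<tau> (n - 2) (vac X))"
    using n by (simp add: X.creation algebra_simps eq_neg_iff_add_eq_0)
  then show ?thesis using n by (auto simp: X.creation)
qed

lemma \<Psi>_\<omega>: "n \<ge> 0 \<Longrightarrow> nprod X \<Psi> n \<omega> = 0"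
  using \<omega>\<Psi>[of "- 1" n "vac X"] by (simp add: X.creation)

lemma parts: "x_vec \<in> part T True" "y_vec \<in> part T True" "h_el \<in> part T False"
proof -
  have \<Psi>': "\<Psi>' \<in> part X True" using X.parity_odd[OF X_part(3) X.vac_even] by simp
  show "x_vec \<in> part T True" "y_vec \<in> part T True" "h_el \<in> part T False"
    using part_T[OF X_part(3) P_even] part_T[OF X_part(2) P_even] part_T[OF \<Psi>' P_even] \<iota>_even
    by (auto simp: x_vec_def y_vec_def)
qed

lemma q1_q1': "n \<ge> 1 \<Longrightarrow> nprod P (q1 k) n (q1 k) = (if n = 1 then scl P (- B) (e (- 2)) else 0)"
  using q1_q1[of n k] by (simp add: power2_eq_square add.commute B_def)

lemma x_x: "n \<ge> 0 \<Longrightarrow> nprod T x_vec n x_vec = (if n = 0 then \<iota> (e 2) else 0)"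
proof -
  assume n: "n \<ge> 0"
  have "nprod X \<Psi> i \<Psi> = 0 \<or> nprod P (e 1) (n - 1 - i) (e 1) = 0" if "i \<noteq> 0" for i
    using that n \<Psi>_ope[of i] e_nonneg[of "n - 1 - i" 1 1] by (cases "i \<ge> 0") auto
  then show ?thesis
    unfolding x_vec_def using n e_nonneg[of "n - 1" 1 1]
    by (subst nprod_tensor_single[of 0]) (auto simp: \<Psi>_ope e_minus_one)
qed

lemma h_x: "n \<ge> 0 \<Longrightarrow> nprod T h_el n x_vec = (if n = 0 then x_vec else 0)"
  using h_e[of n k 1] by (simp add: x_vec_def \<iota>_mode)

lemma h_y: "n \<ge> 0 \<Longrightarrow> nprod T h_el n y_vec = (if n = 0 then - y_vec else 0)"
  using h_e[of n k "- 1"] h_q(1)[of n] by (simp add: y_vec_def \<iota>_mode)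

lemma h_h': "n \<ge> 0 \<Longrightarrow> nprod T h_el n h_el = (if n = 1 then scl T (2 * k) (vac T) else 0)"
  using h_h[of n k] by (simp add: \<iota>_mode vac_T)

lemma x_y: 
  assumes n: "n \<ge> 0"
  shows "nprod T x_vec n y_vec = (if n = 0 then h_el else if n = 1 then scl T (2 * k) (vac T) else 0)"
proof -
  have 1: "nprod T (\<beta> \<Psi> (e 1)) n (\<beta> \<tau> E) = 0"
  proof (rule nprod_tensor_zero)
    show "nprod X \<Psi> i \<tau> = 0 \<or> nprod P (e 1) (n - 1 - i) E = 0" for i
      using n \<Psi>_\<tau>_ope[of i] e_nonneg[of "n - 1 - i" 1 "- 1"] by (cases "i \<ge> 0") auto
  qed
  have 2: "nprod T (\<beta> \<Psi> (e 1)) n (\<beta> \<Psi> (q1 k)) = \<iota> (nprod P (e 1) (n - 1) (q1 k))"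
  proof (subst nprod_tensor_single[of 0])
    show "nprod X \<Psi> i \<Psi> = 0 \<or> nprod P (e 1) (n - 1 - i) (q1 k) = 0" if "i \<noteq> 0" for i
      using that n \<Psi>_ope[of i] \<Psi>_sq e1_q1(2)[of "n - 1 - i" k] by (cases "i \<ge> - 1"; cases "i = - 1") auto
  qed (simp add: \<Psi>_ope)
  have 3: "nprod T (\<beta> \<Psi> (e 1)) n (\<beta> \<Psi>' E) = \<iota> (nprod P (e 1) (n - 2) E)"
  proof (subst nprod_tensor_single[of 1])
    show "nprod X \<Psi> i \<Psi>' = 0 \<or> nprod P (e 1) (n - 1 - i) E = 0" if "i \<noteq> 1" for i
      using that n \<Psi>_\<Psi>'[of i] e_nonneg[of "n - 1 - i" 1 "- 1"] by (cases "i \<ge> 0") auto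
  qed (simp add: \<Psi>_\<Psi>')
  have "nprod T x_vec n y_vec = \<iota> (nprod P (e 1) (n - 1) (q1 k)) + scl T B (\<iota> (nprod P (e 1) (n - 2) E))"
    unfolding y_vec_def x_vec_def by (simp only: T.nprod_right 1 2 3) simp
  note xy = this
  have hv: "\<nu> k - scl P (1 / 2) (J hC) + scl P B (scl P (1 / 2) (J hC)) = h_vec k"
  proof -
    have "B * (1 / 2) = k / 2 + k / 2 + 1 / 2" by (simp add: B_def)
    then show ?thesis by (simp only: \<nu>_def h_vec_def P.scale_scale P.scale_left_distrib) simp
  qed
  consider "n = 0" | "n = 1" | "n \<ge> 2" using n by linarith
  then show ?thesis
  proof cases
    case 1
    have "nprod T x_vec n y_vec = \<iota> (\<nu> k - scl P (1 / 2) (J hC) + scl P B (scl P (1 / 2) (J hC)))"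
      unfolding xy beta_linear beta_diff using 1 by (simp add: e1_q1(1) e1_E)
    then show ?thesis unfolding hv using 1 by simp
  next
    case 2
    have "nprod T x_vec n y_vec = scl T B (vac T) - vac T"
      unfolding xy using 2 by (simp add: e1_q1(2) e1_E vac_T)
    then show ?thesis using 2 by (simp add: T.scale_left_distrib B_def)
  next
    case 3
    then show ?thesis unfolding xy by (simp add: e1_q1(2) e_nonneg)
  qed
qed

lemma y_mode: "nprod T y_vec n w = scl T A (nprod T (\<beta> \<tau> E) n w) + nprod T (\<beta> \<Psi> (q1 k)) n w +
    scl T B (nprod T (\<beta> \<Psi>' E) n w)"
  by (simp only: y_vec_def T.nprod_left)

text \<open>At \<open>n = 2\<close> the coefficient of \<open>e (- 2)\<close> is
  \<open>A^2 (2 c / 3) - B (2 B + 3)\<close>, and \<open>2 B + 3 = 4 k + 5\<close>; this is where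
  the central charge enters.\<close>

lemma y_y_two: 
  assumes n: "n \<ge> 2"
  shows "nprod T y_vec n y_vec = 0"
proof -
  have EE: "nprod P E j E = 0" if "j \<ge> 0" for j using e_nonneg[OF that] .
  have Eq: "nprod P E j (q1 k) = 0" if "j \<ge> 1" for j using E_q(1)[of j k] that by simp
  have qE: "nprod P (q1 k) j E = 0" if "j \<ge> 1" for j using q1_E[of j k] that by simp
  have qq: "nprod P (q1 k) j (q1 k) = 0" if "j \<ge> 2" for j using q1_q1'[of j] that by simp
  have 1: "nprod T (\<beta> \<tau> E) n (\<beta> \<tau> E) = scl T (2 * c / 3) (\<iota> (nprod P E (n - 3) E))"
  proof (subst nprod_tensor_single[of 2])
    show "nprod X \<tau> i \<tau> = 0 \<or> nprod P E (n - 1 - i) E = 0" if "i \<noteq> 2" for i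
      using that n \<tau>_ope[of i] EE[of "n - 1 - i"] by (cases "i \<ge> 1") auto
  qed (simp add: \<tau>_ope)
  have 2: "nprod T (\<beta> \<tau> E) n (\<beta> \<Psi> (q1 k)) = 0"
  proof (rule nprod_tensor_zero)
    show "nprod X \<tau> i \<Psi> = 0 \<or> nprod P E (n - 1 - i) (q1 k) = 0" for i
      using n \<tau>_\<Psi>_ope(2)[of i] Eq[of "n - 1 - i"] by (cases "i \<ge> 0") auto
  qed
  have 3: "nprod T (\<beta> \<tau> E) n (\<beta> \<Psi>' E) = 0"
  proof (rule nprod_tensor_zero)
    show "nprod X \<tau> i \<Psi>' = 0 \<or> nprod P E (n - 1 - i) E = 0" for i
      using n \<tau>_\<Psi>_ope(1)[of i] EE[of "n - 1 - i"] by (cases "i \<ge> 0") auto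
  qed
  have 4: "nprod T (\<beta> \<Psi> (q1 k)) n (\<beta> \<tau> E) = 0"
  proof (rule nprod_tensor_zero)
    show "nprod X \<Psi> i \<tau> = 0 \<or> nprod P (q1 k) (n - 1 - i) E = 0" for i
      using n \<Psi>_\<tau>_ope[of i] qE[of "n - 1 - i"] by (cases "i \<ge> 0") auto
  qed
  have 5: "nprod T (\<beta> \<Psi>' E) n (\<beta> \<tau> E) = 0"
  proof (rule nprod_tensor_zero)
    show "nprod X \<Psi>' i \<tau> = 0 \<or> nprod P E (n - 1 - i) E = 0" for i
      using n \<Psi>_\<tau>_ope[of "i - 1"] EE[of "n - 1 - i"] by (cases "i \<ge> 1") (auto simp: \<Psi>'_mode)
  qed
  have 6: "nprod T (\<beta> \<Psi> (q1 k)) n (\<beta> \<Psi> (q1 k)) = \<iota> (nprod P (q1 k) (n - 1) (q1 k))"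
  proof (subst nprod_tensor_single[of 0])
    show "nprod X \<Psi> i \<Psi> = 0 \<or> nprod P (q1 k) (n - 1 - i) (q1 k) = 0" if "i \<noteq> 0" for i
      using that n \<Psi>_ope[of i] qq[of "n - 1 - i"] by (cases "i \<ge> 0") auto
  qed (simp add: \<Psi>_ope)
  have 7: "nprod T (\<beta> \<Psi> (q1 k)) n (\<beta> \<Psi>' E) = \<iota> (nprod P (q1 k) (n - 2) E)"
  proof (subst nprod_tensor_single[of 1])
    show "nprod X \<Psi> i \<Psi>' = 0 \<or> nprod P (q1 k) (n - 1 - i) E = 0" if "i \<noteq> 1" for i
      using that n \<Psi>_\<Psi>'[of i] qE[of "n - 1 - i"] by (cases "i \<ge> 0") auto
  qed (simp add: \<Psi>_\<Psi>')
  have 8: "nprod T (\<beta> \<Psi>' E) n (\<beta> \<Psi> (q1 k)) = - \<iota> (nprod P E (n - 2) (q1 k))"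
  proof (subst nprod_tensor_single[of 1])
    show "nprod X \<Psi>' i \<Psi> = 0 \<or> nprod P E (n - 1 - i) (q1 k) = 0" if "i \<noteq> 1" for i
      using that n \<Psi>_ope[of "i - 1"] Eq[of "n - 1 - i"] by (cases "i \<ge> 1") (auto simp: \<Psi>'_mode)
  qed (simp add: \<Psi>_ope \<Psi>'_mode)
  have 9: "nprod T (\<beta> \<Psi>' E) n (\<beta> \<Psi>' E) = scl T (- 2) (\<iota> (nprod P E (n - 3) E))"
  proof (subst nprod_tensor_single[of 2])
    show "nprod X \<Psi>' i \<Psi>' = 0 \<or> nprod P E (n - 1 - i) E = 0" if "i \<noteq> 2" for i
      using that n \<Psi>_\<Psi>'[of "i - 1"] EE[of "n - 1 - i"] by (cases "i \<ge> 1") (auto simp: \<Psi>'_mode)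
  qed (simp add: \<Psi>_\<Psi>' \<Psi>'_mode)
  have y: "nprod T y_vec n y_vec = scl T (A * A * (2 * c / 3)) (\<iota> (nprod P E (n - 3) E)) +
     \<iota> (nprod P (q1 k) (n - 1) (q1 k)) + scl T B (\<iota> (nprod P (q1 k) (n - 2) E)) +
     scl T B (- \<iota> (nprod P E (n - 2) (q1 k))) - scl T (B * (2 * B)) (\<iota> (nprod P E (n - 3) E))"
    unfolding y_mode
    by (simp only: y_vec_def T.nprod_right 1 2 3 4 5 6 7 8 9)
      (simp add: T.scale_right_distrib T.scale_right_diff_distrib mult.assoc)
  show ?thesis
  proof (cases "n = 2")
    case True
    have "nprod T y_vec n y_vec = scl T (A * A * (2 * c / 3) - B - B - B - B * (2 * B)) (\<iota> (e (- 2)))"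
      unfolding y using True
      by (simp add: e_minus_one E_q q1_E q1_q1' T.scale_left_diff_distrib)
        (simp add: T.scale_collect del: T.scale_minus_left)
    also have "A * A * (2 * c / 3) - B - B - B - B * (2 * B) = 0" unfolding A(2) by (simp add: B_def algebra_simps)
    finally show ?thesis by simp
  next
    case False
    then show ?thesis
      unfolding y using n EE[of "n - 3"] qq[of "n - 1"] qE[of "n - 2"] Eq[of "n - 2"] by simp
  qed
qed

lemma y_y_one: "n \<ge> 1 \<Longrightarrow> nprod T y_vec n y_vec = 0"
proof -
  assume n: "n \<ge> 1"
  have "nprod T y_vec 1 y_vec = 0"
    by (rule T.skew_self[OF parts(2)]) (use y_y_two in simp_all)
  then show ?thesis using y_y_two n by (cases "n = 1") auto
qed

lemma x_commutator: "nprod T x_vec m (nprod T x_vec n v) + nprod T x_vec n (nprod T x_vec m v) = nprod T (\<iota> (e 2)) (m + n) v"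
  using T.commutator[OF parts(1,1), of 1 m n v] by (simp add: x_x)

text \<open>The anticommutator of \<open>x\<close> with itself supplies the even field
  \<open>e 2\<close>, to which the lattice argument applies. Afterwards the modes of
  \<open>x\<close> expose those of \<Psi> on \<open>v\<close> from above.\<close>

lemma x_singular:
  assumes x: "\<And>n. n \<ge> 0 \<Longrightarrow> nprod T x_vec n w = 0" and h: "\<And>n. n \<ge> 1 \<Longrightarrow> nprod T h_el n w = 0"
    and q: "nprod T h_el 0 w = scl T q w"
  obtains v r where "w = \<beta> v (e r)" "\<And>n. n \<ge> 0 \<Longrightarrow> nprod X \<Psi> n v = 0"
proof -
  have e2: "nprod T (\<iota> (e 2)) n w = 0" if "n \<ge> 0" for n
    using x_commutator[of 0 n w] x that by simp
  have S0: "w \<in> T.span {\<beta> v (e j) | v j. True}"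
    by (rule vacuum_space_e[of 2 w k]) (use e2 h in auto)
  have "nprod T (\<iota> (J hD)) 0 w = scl T q w"
    using q T_c_zero[of w] by (simp add: h_vec_def)
  from charge_component[OF S0 this] obtain v r where w: "w = \<beta> v (e r)" by blast
  obtain N where N: "\<forall>n \<ge> N. nprod X \<Psi> n v = 0" using X.truncation by blast
  have "nprod X \<Psi> n v = 0" if "n \<ge> 0" for n
    using N _ that
  proof (rule int_descend)
    fix n assume n: "(n::int) \<ge> 0" "\<And>m. m > n \<Longrightarrow> nprod X \<Psi> m v = 0"
    have "nprod T x_vec n w = \<beta> (nprod X \<Psi> n v) (nprod P (e 1) (n - 1 - n) (e r))"
      unfolding x_vec_def w
    proof (rule nprod_tensor_single)
      show "nprod X \<Psi> i v = 0 \<or> nprod P (e 1) (n - 1 - i) (e r) = 0" if "i \<noteq> n" for i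
        using that n(2)[of i] e_nonneg[of "n - 1 - i" 1 r] by (cases "i > n") auto
    qed
    then have "\<beta> (nprod X \<Psi> n v) (e (1 + r)) = 0" using x[OF n(1)] by (simp add: e_minus_one)
    then show "nprod X \<Psi> n v = 0" using beta_eq_zero e_nonzero by blast
  qed
  then show ?thesis using w that by blast
qed

text \<open>This is the image of \<open>f\<close> up to the factor -1/2. The pure lattice part is
  kept as a sum of unevaluated products, because later only its products with \<open>E\<close>
  matter.\<close>

lemma y_y_zero:
  "nprod T y_vec 0 y_vec = scl T (2 * (A * A)) (\<beta> \<omega> (e (- 2))) + scl T (2 * A) (\<beta> (nprod X \<tau> (- 1) \<Psi>) (e (- 2))) +
     scl T B (\<beta> (nprod X \<Psi> (- 2) \<Psi>) (e (- 2))) +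
     \<iota> (scl P (A * A * (2 * c / 3) - B * (2 * B)) (nprod P E (- 3) E) + nprod P (q1 k) (- 1) (q1 k) +
       scl P B (nprod P (q1 k) (- 2) E) - scl P B (nprod P E (- 2) (q1 k)))"
proof -
  have EE: "nprod P E j E = 0" if "j \<ge> 0" for j using e_nonneg[OF that] .
  have Eq: "nprod P E j (q1 k) = 0" if "j \<ge> 1" for j using E_q(1)[of j k] that by simp
  have qE: "nprod P (q1 k) j E = 0" if "j \<ge> 1" for j using q1_E[of j k] that by simp
  have qq: "nprod P (q1 k) j (q1 k) = 0" if "j \<ge> 2" for j using q1_q1'[of j] that by simp
  have 1: "nprod T (\<beta> \<tau> E) 0 (\<beta> \<tau> E) = scl T 2 (\<beta> \<omega> (e (- 2))) + scl T (2 * c / 3) (\<iota> (nprod P E (- 3) E))"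
  proof (subst nprod_tensor_two[of 0 2])
    show "nprod X \<tau> i \<tau> = 0 \<or> nprod P E (0 - 1 - i) E = 0" if "i \<noteq> 0" "i \<noteq> 2" for i
      using that \<tau>_ope[of i] EE[of "0 - 1 - i"] by (cases "i \<ge> 0") auto
  qed (simp_all add: \<tau>_ope e_minus_one)
  have 2: "nprod T (\<beta> \<tau> E) 0 (\<beta> \<Psi> (q1 k)) = \<beta> (nprod X \<tau> (- 1) \<Psi>) (e (- 2))"
  proof (subst nprod_tensor_single[of "- 1"])
    show "nprod X \<tau> i \<Psi> = 0 \<or> nprod P E (0 - 1 - i) (q1 k) = 0" if "i \<noteq> - 1" for i
      using that \<tau>_\<Psi>_ope(2)[of i] Eq[of "0 - 1 - i"] by (cases "i \<ge> 0") auto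
  qed (simp add: E_q)
  have 3: "nprod T (\<beta> \<tau> E) 0 (\<beta> \<Psi>' E) = 0"
  proof (rule nprod_tensor_zero)
    show "nprod X \<tau> i \<Psi>' = 0 \<or> nprod P E (0 - 1 - i) E = 0" for i
      using \<tau>_\<Psi>_ope(1)[of i] EE[of "0 - 1 - i"] by (cases "i \<ge> 0") auto
  qed
  have 4: "nprod T (\<beta> \<Psi> (q1 k)) 0 (\<beta> \<tau> E) = \<beta> (nprod X \<tau> (- 1) \<Psi>) (e (- 2))"
  proof (subst nprod_tensor_single[of "- 1"])
    show "nprod X \<Psi> i \<tau> = 0 \<or> nprod P (q1 k) (0 - 1 - i) E = 0" if "i \<noteq> - 1" for i
      using that \<Psi>_\<tau>_ope[of i] qE[of "0 - 1 - i"] by (cases "i \<ge> 0") auto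
  qed (simp add: q1_E \<Psi>_m1_\<tau>)
  have 5: "nprod T (\<beta> \<Psi>' E) 0 (\<beta> \<tau> E) = 0"
  proof (rule nprod_tensor_zero)
    show "nprod X \<Psi>' i \<tau> = 0 \<or> nprod P E (0 - 1 - i) E = 0" for i
      using \<Psi>_\<tau>_ope[of "i - 1"] EE[of "0 - 1 - i"] by (cases "i \<ge> 1"; cases "i = 0") (auto simp: \<Psi>'_mode)
  qed
  have 6: "nprod T (\<beta> \<Psi> (q1 k)) 0 (\<beta> \<Psi> (q1 k)) =
    \<iota> (nprod P (q1 k) (- 1) (q1 k)) - scl T B (\<beta> (nprod X \<Psi> (- 2) \<Psi>) (e (- 2)))"
  proof (subst nprod_tensor_two[of 0 "- 2"])
    show "nprod X \<Psi> i \<Psi> = 0 \<or> nprod P (q1 k) (0 - 1 - i) (q1 k) = 0" if "i \<noteq> 0" "i \<noteq> - 2" for i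
      using that \<Psi>_ope[of i] \<Psi>_sq qq[of "0 - 1 - i"] by (cases "i \<ge> 0"; cases "i = - 1") auto
  qed (simp_all add: \<Psi>_ope q1_q1')
  have 7: "nprod T (\<beta> \<Psi> (q1 k)) 0 (\<beta> \<Psi>' E) =
    \<iota> (nprod P (q1 k) (- 2) E) + \<beta> (nprod X \<Psi> (- 2) \<Psi>) (e (- 2))"
  proof (subst nprod_tensor_two[of 1 "- 1"])
    show "nprod X \<Psi> i \<Psi>' = 0 \<or> nprod P (q1 k) (0 - 1 - i) E = 0" if "i \<noteq> 1" "i \<noteq> - 1" for i
      using that \<Psi>_\<Psi>'[of i] qE[of "0 - 1 - i"] by (cases "i \<ge> 0") auto
  qed (simp_all add: \<Psi>_\<Psi>' \<Psi>_m1_\<Psi>' q1_E)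
  have 8: "nprod T (\<beta> \<Psi>' E) 0 (\<beta> \<Psi> (q1 k)) =
    \<beta> (nprod X \<Psi> (- 2) \<Psi>) (e (- 2)) - \<iota> (nprod P E (- 2) (q1 k))"
  proof (subst nprod_tensor_two[of 1 "- 1"])
    show "nprod X \<Psi>' i \<Psi> = 0 \<or> nprod P E (0 - 1 - i) (q1 k) = 0" if "i \<noteq> 1" "i \<noteq> - 1" for i
      using that \<Psi>_ope[of "i - 1"] Eq[of "0 - 1 - i"] by (cases "i \<ge> 1"; cases "i = 0") (auto simp: \<Psi>'_mode)
  qed (simp_all add: \<Psi>_ope \<Psi>'_mode E_q)
  have 9: "nprod T (\<beta> \<Psi>' E) 0 (\<beta> \<Psi>' E) = scl T (- 2) (\<iota> (nprod P E (- 3) E))"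
  proof (subst nprod_tensor_single[of 2])
    show "nprod X \<Psi>' i \<Psi>' = 0 \<or> nprod P E (0 - 1 - i) E = 0" if "i \<noteq> 2" for i
      using that \<Psi>_\<Psi>'[of "i - 1"] EE[of "0 - 1 - i"] by (cases "i \<ge> 1"; cases "i = 0") (auto simp: \<Psi>'_mode)
  qed (simp add: \<Psi>_\<Psi>' \<Psi>'_mode)
  have double: "scl T (a * (b * 2)) z = scl T (a * b) z + scl T (a * b) z" for a b z
    by (simp flip: T.scale_left_distrib)
  show ?thesis
    unfolding y_mode
    by (simp only: y_vec_def T.nprod_right 1 2 3 4 5 6 7 8 9)
      (simp add: double T.scale_right_distrib T.scale_right_diff_distrib T.scale_left_diff_distrib T.scale_multiples algebra_simps)
qed


text \<open>The vectors of first order in \<Psi>, with arbitrary lattice part. They absorb all terms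
  of \<open>y_(1) y_(0) y\<close> that need not be computed.\<close>

definition fermion_forms :: "'t set" where
  "fermion_forms = T.span {\<beta> (nprod X \<Psi> i (vac X)) b | i b. i < 0}"

lemma fermion_formsI:
  "\<beta> (nprod X \<Psi> i (vac X)) b \<in> fermion_forms" "\<beta> \<Psi> b \<in> fermion_forms"
proof -
  show "\<beta> (nprod X \<Psi> i (vac X)) b \<in> fermion_forms" for i
  proof (cases "i < 0")
    case True
    then show ?thesis by (auto simp: fermion_forms_def intro!: T.span_base)
  qed (simp add: X.creation fermion_forms_def T.span_zero)
  from this[of "- 1"] show "\<beta> \<Psi> b \<in> fermion_forms" by (simp add: X.creation)
qed

text \<open>The mode \<open>-1 - i\<close> of \<Psi> sends \<open>\<Psi>_(i) vac\<close> to the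
  vacuum and kills the other generators, so the annihilating modes read off every
  coefficient.\<close>

lemma fermion_forms_zero:
  assumes w: "w \<in> fermion_forms" and ann: "\<And>n. n \<ge> 0 \<Longrightarrow> nprod T (\<beta> \<Psi> (vac P)) n w = 0"
  shows "w = 0"
proof -
  define S where "S i = (if i < 0 then range (\<lambda>b. \<beta> (nprod X \<Psi> i (vac X)) b) else {0})" for i :: int
  have S: "T.span (S i) = S i" for i
  proof -
    have "T.subspace (range (\<lambda>b. \<beta> a b))" for a
      unfolding T.subspace_def by (auto simp: image_iff) (metis beta_zero(2), metis beta_linear(2), metis beta_linear(4))
    then show ?thesis by (simp add: S_def)
  qed
  have "{\<beta> (nprod X \<Psi> i (vac X)) b | i b. i < 0} \<subseteq> (\<Union>i. S i)"
    by (auto simp: S_def)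
  then have "w \<in> T.span (\<Union>i. S i)" using w T.span_mono unfolding fermion_forms_def by blast
  from T.span_Union_decomposition[OF this] obtain M u where M: "finite M" "w = (\<Sum>i\<in>M. u i)" "\<And>i. u i \<in> S i"
    by (auto simp: S)
  have "u i = 0" if i: "i \<in> M" for i
  proof (cases "i < 0")
    case True
    have "nprod T (\<beta> \<Psi> (vac P)) (- 1 - i) (u l) = 0" if "l \<noteq> i" for l
    proof (cases "l < 0")
      case l: True
      then obtain b where "u l = \<beta> (nprod X \<Psi> l (vac X)) b" using M(3)[of l] by (auto simp: S_def)
      moreover have "nprod X \<Psi> (- 1 - i) (nprod X \<Psi> l (vac X)) = 0"
        using \<Psi>\<Psi>[of "- 1 - i" l "vac X"] that True by (simp add: X.creation)
      ultimately show ?thesis by (simp add: nprod_left_factor)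
    next
      case False
      then show ?thesis using M(3)[of l] by (simp add: S_def)
    qed
    then have "nprod T (\<beta> \<Psi> (vac P)) (- 1 - i) w = nprod T (\<beta> \<Psi> (vac P)) (- 1 - i) (u i)"
      unfolding M(2) T.nprod_sum_right using M(1) i by (subst sum.remove[of _ i]) auto
    moreover obtain b where b: "u i = \<beta> (nprod X \<Psi> i (vac X)) b" using M(3)[of i] True by (auto simp: S_def)
    moreover have "nprod X \<Psi> (- 1 - i) (nprod X \<Psi> i (vac X)) = vac X"
      using \<Psi>\<Psi>[of "- 1 - i" i "vac X"] True by (simp add: X.creation)
    ultimately have "\<beta> (vac X) b = 0" using ann[of "- 1 - i"] True by (simp add: nprod_left_factor)
    then have "b = 0" using beta_eq_zero vacX by blast
    then show ?thesis by (simp add: b)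
  next
    case False
    then show ?thesis using M(3)[of i] by (simp add: S_def)
  qed
  then show ?thesis using M(2) by simp
qed

lemma y_commutator: "nprod T y_vec m (nprod T y_vec n v) + nprod T y_vec n (nprod T y_vec m v) =
    nprod T (nprod T y_vec 0 y_vec) (m + n) v"
  using T.commutator[OF parts(2,2), of 1 m n v] y_y_one by simp

lemma x_y_commutator: "nprod T x_vec m (nprod T y_vec n v) + nprod T y_vec n (nprod T x_vec m v) =
    nprod T h_el (m + n) v + scl T (if m + n = 0 then of_int m * (2 * k) else 0) v"
proof -
  have "nprod T x_vec m (nprod T y_vec n v) = scl T (ksign True True) (nprod T y_vec n (nprod T x_vec m v)) +
    (\<Sum>j<2. scl T (of_int m gchoose j) (nprod T (nprod T x_vec (int j) y_vec) (m + n - int j) v))"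
    by (rule T.commutator[OF parts(1,2)]) (simp add: x_y)
  then show ?thesis by (simp add: x_y numeral_2_eq_2 T.vacuum)
qed

lemma h_y_commutator: "nprod T h_el m (nprod T y_vec n v) = nprod T y_vec n (nprod T h_el m v) - nprod T y_vec (m + n) v"
  using T.commutator[OF parts(3,2), of 1 m n v] by (simp add: h_y)

lemma y_h: "n \<ge> 0 \<Longrightarrow> nprod T y_vec n h_el = (if n = 0 then y_vec else 0)"
  using T.affine_skew[OF parts(3,2), of "- y_vec" 0 n] h_y by simp

text \<open>
  The component of \<open>y\<^sub>(\<^sub>1\<^sub>) y\<^sub>(\<^sub>0\<^sub>) y\<close> free of \<open>\<Psi>\<close> is a multiple of \<open>\<tau> \<otimes> e\<^sup>-\<^sup>3\<^sup>\<gamma>\<close>; its coefficient is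
  \<open>3 A (A\<^sup>2 + 2 + B) = 0\<close>.
\<close>

lemma y_one_square: "nprod T y_vec 1 (nprod T y_vec 0 y_vec) \<in> fermion_forms"
proof -
  let ?e2 = "e (- 2)" and ?\<tau>e = "\<beta> \<tau> (e (- 3))"
  have sub: "T.subspace fermion_forms" by (simp add: fermion_forms_def)
  note FF = T.subspace_add[OF sub] T.subspace_diff[OF sub] T.subspace_scale[OF sub] T.subspace_neg[OF sub] T.subspace_0[OF sub]
  have Ee: "nprod P E j ?e2 = 0" if "j \<ge> 0" for j using e_nonneg[OF that] .
  have qe: "nprod P (q1 k) j ?e2 = 0" if "j \<ge> 1" for j using q1_e[of j k "- 2"] that by simp
  have a: "nprod T (\<beta> \<tau> E) 1 (\<beta> \<omega> ?e2) = scl T (3 / 2) ?\<tau>e"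
  proof (subst nprod_tensor_single[of 1])
    show "nprod X \<tau> i \<omega> = 0 \<or> nprod P E (1 - 1 - i) ?e2 = 0" if "i \<noteq> 1" for i
      using that \<tau>_\<omega>[of i] Ee[of "1 - 1 - i"] by (cases "i \<ge> 1") auto
  qed (simp add: \<tau>_\<omega> e_minus_one)
  have \<omega>\<Psi>0: "nprod X \<omega> n \<Psi> = 0" if "n \<ge> 0" for n
    using \<omega>\<Psi>[of n "- 1" "vac X"] that by (simp add: X.creation)
  have \<tau>\<tau>\<Psi>: "nprod X \<tau> i (nprod X \<tau> (- 1) \<Psi>) = (if i = 2 then scl X (2 * c / 3) \<Psi> else 0)" if "i \<ge> 1" for i
    using \<tau>\<tau>[of i "- 1" \<Psi>] that \<omega>\<Psi>0[of "i - 1"] \<tau>_\<Psi>_ope(2)[of i] by (auto simp: power2_eq_square)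
  have b: "nprod T (\<beta> \<tau> E) 1 (\<beta> (nprod X \<tau> (- 1) \<Psi>) ?e2) \<in> fermion_forms"
  proof (subst nprod_tensor_single[of 2])
    show "nprod X \<tau> i (nprod X \<tau> (- 1) \<Psi>) = 0 \<or> nprod P E (1 - 1 - i) ?e2 = 0" if "i \<noteq> 2" for i
      using that \<tau>\<tau>\<Psi>[of i] Ee[of "1 - 1 - i"] by (cases "i \<ge> 1") auto
  qed (simp add: \<tau>\<tau>\<Psi> FF fermion_formsI)
  have c: "nprod T (\<beta> \<tau> E) 1 (\<beta> (nprod X \<Psi> (- 2) \<Psi>) ?e2) = 0"
  proof (rule nprod_tensor_zero)
    show "nprod X \<tau> i (nprod X \<Psi> (- 2) \<Psi>) = 0 \<or> nprod P E (1 - 1 - i) ?e2 = 0" for i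
      using \<tau>\<Psi>[of i "- 2" \<Psi>] \<tau>_\<Psi>_ope(2)[of i] Ee[of "1 - 1 - i"] by (cases "i \<ge> 1") auto
  qed
  let ?b = "scl P (A * A * (2 * c / 3) - B * (2 * B)) (nprod P E (- 3) E) + nprod P (q1 k) (- 1) (q1 k) +
       scl P B (nprod P (q1 k) (- 2) E) - scl P B (nprod P E (- 2) (q1 k))"
  \<comment> \<open>Since \<open>\<tau>_(i) vac\<close> vanishes for \<open>i \<ge> 0\<close>, the
    lattice part enters the \<tau>-component only through its products with \<open>E\<close> of
    order at least 1.\<close>
  have Eb: "nprod P E n ?b = (if n = 1 then scl P (2 + B) (e (- 3)) else 0)" if n: "n \<ge> 1" for n
  proof -
    have EE: "nprod P E m (nprod P E l v) = nprod P E l (nprod P E m v)" for m l v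
      using P.supercommute[OF P_even P_even, of E E m l v] e_nonneg by simp
    have Eq: "nprod P E m (nprod P (q1 k) l v) = nprod P (q1 k) l (nprod P E m v) + nprod P ?e2 (m + l) v" for m l v
      using P.commutator[OF P_even P_even, of 1 E "q1 k" m l v] E_q(1) by simp
    have e2q: "nprod P ?e2 j (q1 k) = (if j = 0 then scl P 2 (e (- 3)) else 0)" if "j \<ge> 0" for j
      unfolding q1_def using that by (auto simp: e_\<nu> e_nonneg e_minus_one)
    have "nprod P E n (nprod P E (- 3) E) = 0" "nprod P E n (nprod P E (- 2) (q1 k)) = 0"
      unfolding EE[of n] using n E_q(1)[of n k] e_nonneg[of n "- 1" "- 1"] by simp_all
    moreover have "nprod P E n (nprod P (q1 k) (- 1) (q1 k)) = (if n = 1 then scl P 2 (e (- 3)) else 0)"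
      unfolding Eq using n E_q(1)[of n k] e2q[of "n - 1"] by simp
    moreover have "nprod P E n (nprod P (q1 k) (- 2) E) = (if n = 1 then e (- 3) else 0)"
      unfolding Eq using n e_nonneg[of n "- 1" "- 1"] e_nonneg[of "n - 2" "- 2" "- 1"] by (auto simp: e_minus_one)
    ultimately show ?thesis by (auto simp: P.scale_left_distrib)
  qed
  have d: "nprod T (\<beta> \<tau> E) 1 (\<iota> ?b) = scl T (2 + B) ?\<tau>e"
  proof (subst nprod_tensor_single[of "- 1"])
    show "nprod X \<tau> i (vac X) = 0 \<or> nprod P E (1 - 1 - i) ?b = 0" if "i \<noteq> - 1" for i
      using that X.creation(2)[of i \<tau>] Eb[of "1 - 1 - i"] by (cases "i \<ge> 0") auto
    show "\<beta> (nprod X \<tau> (- 1) (vac X)) (nprod P E (1 - 1 - - 1) ?b) = scl T (2 + B) ?\<tau>e"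
      using Eb[of 1] by (simp add: X.creation del: P.nprod_right P.nprod_diff)
  qed
  have e': "nprod T (\<beta> \<Psi> (q1 k)) 1 (\<beta> \<omega> ?e2) = 0"
  proof (rule nprod_tensor_zero)
    show "nprod X \<Psi> i \<omega> = 0 \<or> nprod P (q1 k) (1 - 1 - i) ?e2 = 0" for i
      using \<Psi>_\<omega>[of i] qe[of "1 - 1 - i"] by (cases "i \<ge> 0") auto
  qed
  have \<Psi>\<tau>\<Psi>: "nprod X \<Psi> i (nprod X \<tau> (- 1) \<Psi>) = (if i = 0 then - \<tau> else 0)" if "i \<ge> 0" for i
  proof -
    have "nprod X \<Psi> i (nprod X \<tau> (- 1) \<Psi>) = - nprod X \<tau> (- 1) (nprod X \<Psi> i \<Psi>)" by (simp add: \<tau>\<Psi>)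
    then show ?thesis using \<Psi>_ope[OF that] by (simp add: X.creation)
  qed
  have f: "nprod T (\<beta> \<Psi> (q1 k)) 1 (\<beta> (nprod X \<tau> (- 1) \<Psi>) ?e2) = scl T 2 ?\<tau>e"
  proof (subst nprod_tensor_single[of 0])
    show "nprod X \<Psi> i (nprod X \<tau> (- 1) \<Psi>) = 0 \<or> nprod P (q1 k) (1 - 1 - i) ?e2 = 0" if "i \<noteq> 0" for i
      using that \<Psi>\<tau>\<Psi>[of i] qe[of "1 - 1 - i"] by (cases "i \<ge> 0") auto
  qed (simp add: \<Psi>\<tau>\<Psi> q1_e)
  have \<Psi>3: "nprod X \<Psi> i (nprod X \<Psi> (- 2) \<Psi>) = (if i = 0 then - \<Psi>' else if i = 1 then \<Psi> else 0)" if "i \<ge> 0" for i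
    using \<Psi>\<Psi>[of i "- 2" \<Psi>] \<Psi>_ope[OF that] that by auto
  have g: "nprod T (\<beta> \<Psi> (q1 k)) 1 (\<beta> (nprod X \<Psi> (- 2) \<Psi>) ?e2) \<in> fermion_forms"
  proof (subst nprod_tensor_two[of 0 1])
    show "nprod X \<Psi> i (nprod X \<Psi> (- 2) \<Psi>) = 0 \<or> nprod P (q1 k) (1 - 1 - i) ?e2 = 0" if "i \<noteq> 0" "i \<noteq> 1" for i
      using that \<Psi>3[of i] qe[of "1 - 1 - i"] by (cases "i \<ge> 0") auto
  qed (simp_all add: \<Psi>3 FF fermion_formsI)
  \<comment> \<open>On \<open>\<iota> b2\<close> the fermionic factor acts on the vacuum, so the
    result is of first order in \<Psi> for every \<open>b2\<close>.\<close>
  have forms: "nprod T (\<beta> \<Psi> b1) n (\<iota> b2) \<in> fermion_forms" "nprod T (\<beta> \<Psi>' b1) n (\<iota> b2) \<in> fermion_forms" for b1 b2 n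
  proof -
    obtain N where N: "\<forall>j \<ge> N. nprod P b1 j b2 = 0" using P.truncation by blast
    have "nprod T (\<beta> \<Psi> b1) n (\<iota> b2) =
      (\<Sum>i\<in>{n - 1 - N..0}. \<beta> (nprod X \<Psi> i (vac X)) (nprod P b1 (n - 1 - i) b2))"
      by (rule nprod_tensor) (use N X.creation(2)[of _ \<Psi>] in force)+
    then show "nprod T (\<beta> \<Psi> b1) n (\<iota> b2) \<in> fermion_forms"
      by (simp only:) (intro T.subspace_sum[OF sub] fermion_formsI)
    have "nprod T (\<beta> \<Psi>' b1) n (\<iota> b2) =
      (\<Sum>i\<in>{n - 1 - N..0}. \<beta> (nprod X \<Psi>' i (vac X)) (nprod P b1 (n - 1 - i) b2))"
      by (rule nprod_tensor) (use N X.creation(2)[of _ \<Psi>'] in force)+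
    then show "nprod T (\<beta> \<Psi>' b1) n (\<iota> b2) \<in> fermion_forms"
      by (simp only: \<Psi>'_mode beta_linear) (intro T.subspace_sum[OF sub] T.subspace_scale[OF sub] fermion_formsI)
  qed
  have i: "nprod T (\<beta> \<Psi>' E) 1 (\<beta> \<omega> ?e2) = 0"
  proof (rule nprod_tensor_zero)
    show "nprod X \<Psi>' i \<omega> = 0 \<or> nprod P E (1 - 1 - i) ?e2 = 0" for i
      using \<Psi>_\<omega>[of "i - 1"] Ee[of "1 - 1 - i"] by (cases "i \<ge> 1") (auto simp: \<Psi>'_mode)
  qed
  have j: "nprod T (\<beta> \<Psi>' E) 1 (\<beta> (nprod X \<tau> (- 1) \<Psi>) ?e2) = ?\<tau>e"
  proof (subst nprod_tensor_single[of 1])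
    show "nprod X \<Psi>' i (nprod X \<tau> (- 1) \<Psi>) = 0 \<or> nprod P E (1 - 1 - i) ?e2 = 0" if "i \<noteq> 1" for i
      using that \<Psi>\<tau>\<Psi>[of "i - 1"] Ee[of "1 - 1 - i"] by (cases "i \<ge> 1") (auto simp: \<Psi>'_mode)
  qed (simp add: \<Psi>'_mode \<Psi>\<tau>\<Psi> e_minus_one)
  have l: "nprod T (\<beta> \<Psi>' E) 1 (\<beta> (nprod X \<Psi> (- 2) \<Psi>) ?e2) \<in> fermion_forms"
  proof (subst nprod_tensor_two[of 1 2])
    show "nprod X \<Psi>' i (nprod X \<Psi> (- 2) \<Psi>) = 0 \<or> nprod P E (1 - 1 - i) ?e2 = 0" if "i \<noteq> 1" "i \<noteq> 2" for i
      using that \<Psi>3[of "i - 1"] Ee[of "1 - 1 - i"] by (cases "i \<ge> 1") (auto simp: \<Psi>'_mode)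
  qed (simp_all add: \<Psi>'_mode \<Psi>3 FF fermion_formsI)
  have split: "nprod T y_vec 1 (nprod T y_vec 0 y_vec) =
      scl T (A * (2 * (A * A)) * (3 / 2) + (A * 2 + A * B) + 2 * A * 2 + B * (2 * A)) ?\<tau>e +
      (scl T (A * (2 * A)) (nprod T (\<beta> \<tau> E) 1 (\<beta> (nprod X \<tau> (- 1) \<Psi>) ?e2)) +
       scl T B (nprod T (\<beta> \<Psi> (q1 k)) 1 (\<beta> (nprod X \<Psi> (- 2) \<Psi>) ?e2)) +
       scl T (B * B) (nprod T (\<beta> \<Psi>' E) 1 (\<beta> (nprod X \<Psi> (- 2) \<Psi>) ?e2)) +
       nprod T (\<beta> \<Psi> (q1 k)) 1 (\<iota> ?b) + scl T B (nprod T (\<beta> \<Psi>' E) 1 (\<iota> ?b)))"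
    unfolding y_y_zero
    unfolding y_mode
    by (simp only: T.nprod_add_right T.nprod_scale_right a c d e' f i j T.scale_right_distrib T.scale_scale
        T.scale_left_distrib T.scale_zero_right add_0_left add_0_right) (simp only: ac_simps)
  have "A * (2 * (A * A)) * (3 / 2) + (A * 2 + A * B) + 2 * A * 2 + B * (2 * A) = 3 * A * (A * A + 2 + B)"
    by (simp add: algebra_simps)
  also have "\<dots> = 0" unfolding A(1) B_def by simp
  finally have zero: "A * (2 * (A * A)) * (3 / 2) + (A * 2 + A * B) + 2 * A * 2 + B * (2 * A) = 0" .
  show ?thesis
    unfolding split zero T.scale_zero_left add_0_left
    by (intro FF b g l forms)
qed

text \<open>Orders at least 2 follow from the anticommutator of \<open>y\<close>. At order 1 the
  product is killed by the modes of \<open>x\<close>, hence of the form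
  \<open>v \<otimes> e r\<close> with \<open>v\<close> killed by \<Psi>; being also of first order
  in \<Psi>, it is zero. Order 0 is the super-Jacobi identity.\<close>

lemma square_annihilates_y:
  assumes n: "n \<ge> 0"
  shows "nprod T (nprod T y_vec 0 y_vec) n y_vec = 0"
proof -
  let ?g = "nprod T y_vec 0 y_vec"
  have g2: "nprod T ?g n y_vec = 0" if "n \<ge> 2" for n
    using y_commutator[of 1 "n - 1" y_vec] y_y_one[of 1] y_y_one[of "n - 1"] that by simp
  let ?u = "nprod T y_vec 1 ?g"
  have hg: "nprod T h_el m ?g = (if m = 0 then scl T (- 2) ?g else 0)" if "m \<ge> 0" for m
    using h_y_commutator[of m 0 y_vec] h_y[OF that] y_y_one[of m] that by (auto simp: T.scale_two)
  have xg: "nprod T x_vec m ?g = (if m = 0 then scl T (- 2) y_vec else 0)" if "m \<ge> 0" for m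
    using x_y_commutator[of m 0 y_vec] h_y[OF that] x_y[OF that] that
    by (cases "m = 0"; cases "m = 1")
      (auto simp: y_h T.creation T.nprod_scale_right T.scale_two algebra_simps eq_neg_iff_add_eq_0)
  have gy1: "nprod T ?g 1 y_vec = ?u"
    using y_commutator[of 1 0 y_vec] y_y_one[of 1] by simp
  have "?u = 0"
  proof -
    have xu: "nprod T x_vec m ?u = 0" if "m \<ge> 0" for m
      using x_y_commutator[of m 1 ?g] that hg[of "m + 1"] xg[OF that] y_y_one[of 1] by (simp split: if_splits)
    have hu: "nprod T h_el m ?u = 0" if "m \<ge> 1" for m
    proof -
      have "nprod T y_vec (m + 1) ?g = 0"
        using y_commutator[of "m + 1" 0 y_vec] y_y_one[of "m + 1"] g2[of "m + 1"] that by simp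
      then show ?thesis using h_y_commutator[of m 1 ?g] hg[of m] that by simp
    qed
    have qu: "nprod T h_el 0 ?u = scl T (- 3) ?u"
      using h_y_commutator[of 0 1 ?g] hg[of 0] by (simp add: T.scale_two T.scale_three)
    show "?u = 0"
    proof (rule x_singular[of ?u "- 3"])
      fix v r assume v: "?u = \<beta> v (e r)" "\<And>n. n \<ge> 0 \<Longrightarrow> nprod X \<Psi> n v = 0"
      show "?u = 0"
        by (rule fermion_forms_zero[OF y_one_square]) (simp add: v nprod_left_factor)
    qed (simp_all only: xu hu qu)
  qed
  then have g1: "nprod T ?g n y_vec = 0" if "n \<ge> 1" for n
    using gy1 g2 that by (cases "n = 1") auto
  have g_even: "?g \<in> part T False" using T.parity_odd[OF parts(2,2)] by simp
  define u where "u = nprod T ?g 0 y_vec"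
  have "nprod T ?g n y_vec = (if n = 0 then u else if n = 1 then scl T 0 (vac T) else 0)" if "n \<ge> 0" for n
    using g1 that by (cases "n = 0") (auto simp: u_def)
  from T.affine_skew[OF g_even parts(2) this order_refl]
  have "nprod T y_vec 0 ?g = - u" by simp
  \<comment> \<open>Skew symmetry gives \<open>y_(0) g = - u\<close>, while the anticommutator gives
    \<open>2 y_(0) g = u\<close>; together \<open>3 u = 0\<close>.\<close>
  moreover have "nprod T y_vec 0 ?g + nprod T y_vec 0 ?g = u"
    unfolding u_def y_commutator by simp
  ultimately have "u + (u + u) = (- u + - u) + (u + u)" by simp
  also have "\<dots> = 0" by (simp add: algebra_simps)
  finally have "scl T 3 u = 0" by (simp only: T.scale_three)
  then have "nprod T ?g 0 y_vec = 0" by (simp add: u_def)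
  then show ?thesis using g1 n by (cases "n = 0") auto
qed

definition e_vec :: 't where "e_vec = scl T (1 / 2) (\<iota> (e 2))"

definition f_vec :: 't where "f_vec = scl T (- 1 / 2) (nprod T y_vec 0 y_vec)"

abbreviation osp_images :: "osp_basis \<Rightarrow> 't" where
  "osp_images \<equiv> T.osp_map e_vec f_vec h_el x_vec y_vec"

lemma osp_relations: "mode_relations (odd_elt osp12) (affine_bracket osp12 k) T osp_images"
proof (rule T.osp_mode_relations)
  show "e_vec \<in> part T False" using \<iota>_even by (simp add: e_vec_def)
  show "f_vec \<in> part T False" using T.parity_odd[OF parts(2,2)] by (simp add: f_vec_def)
  show "nprod T x_vec n x_vec = (if n = 0 then scl T 2 e_vec else 0)" if "n \<ge> 0" for n
    using x_x[OF that] by (simp add: e_vec_def)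
  show "nprod T y_vec n y_vec = (if n = 0 then scl T (- 2) f_vec else 0)" if "n \<ge> 0" for n
    using y_y_one[of n] that by (simp add: f_vec_def)
  show "nprod T e_vec n x_vec = 0" if "n \<ge> 0" for n
    using e_nonneg[OF that] by (simp add: e_vec_def x_vec_def \<iota>_mode)
  show "nprod T f_vec n y_vec = 0" if "n \<ge> 0" for n
    using square_annihilates_y[OF that] by (simp add: f_vec_def)
qed (use parts x_y h_x h_y h_h' in auto)

text \<open>The positive modes of \<open>y\<close> make \<open>v\<close> singular for \<tau>. The
  weight relation needs a quadratic expression: as \<open>f\<close> is a multiple of
  \<open>y_(0) y\<close>, the vanishing of \<open>f_(1) w\<close> amounts to
  \<open>y_(1) y_(0) w = 0\<close>.\<close>

lemma osp_singular:
  assumes kr: "\<And>r::int. even r \<Longrightarrow> of_int r \<noteq> 2 * k + 2"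
    and simple: "\<And>v l. (\<And>n. n \<ge> 0 \<Longrightarrow> nprod X \<Psi> n v = 0) \<Longrightarrow> (\<And>n. n \<ge> 1 \<Longrightarrow> nprod X \<tau> n v = 0) \<Longrightarrow>
      nprod X \<omega> 1 v = scl X l v \<Longrightarrow> v \<in> X.span {vac X}"
    and w: "\<And>a n. n \<ge> 1 \<Longrightarrow> nprod T (osp_images a) n w = 0" "nprod T x_vec 0 w = 0"
      "nprod T h_el 0 w = scl T (of_int q) w" "w \<in> part T (odd q)"
  shows "\<exists>z. w = scl T z (vac T)"
proof -
  have xw: "nprod T x_vec n w = 0" if "n \<ge> 0" for n
    using w(1)[of n oX] w(2) that by (cases "n = 0") auto
  have hw: "nprod T h_el n w = 0" if "n \<ge> 1" for n using w(1)[OF that, of oH] by simp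
  have yw: "nprod T y_vec n w = 0" if "n \<ge> 1" for n using w(1)[OF that, of oY] by simp
  from x_singular[OF xw hw w(3)] obtain v r where v: "w = \<beta> v (e r)" "\<And>n. n \<ge> 0 \<Longrightarrow> nprod X \<Psi> n v = 0" by metis
  have Ee: "nprod P E j (e s) = 0" if "j \<ge> 0" for j s using e_nonneg[OF that] .
  have qe: "nprod P (q1 k) j (e s) = 0" if "j \<ge> 1" for j s using q1_e[of j k s] that by simp
  obtain N where N: "\<forall>n \<ge> N. nprod X \<tau> n v = 0" using X.truncation by blast
  have \<tau>v: "nprod X \<tau> n v = 0" if "n \<ge> 1" for n
    using N _ that
  proof (rule int_descend)
    fix n assume n: "(n::int) \<ge> 1" "\<And>m. m > n \<Longrightarrow> nprod X \<tau> m v = 0"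
    have 1: "nprod T (\<beta> \<tau> E) n w = \<beta> (nprod X \<tau> n v) (e (r - 1))"
      unfolding v(1)
    proof (subst nprod_tensor_single[of n])
      show "nprod X \<tau> i v = 0 \<or> nprod P E (n - 1 - i) (e r) = 0" if "i \<noteq> n" for i
        using that n(2)[of i] Ee[of "n - 1 - i"] by (cases "i > n") auto
    qed (simp add: e_minus_one)
    have 2: "nprod T (\<beta> \<Psi> (q1 k)) n w = 0"
      unfolding v(1)
    proof (rule nprod_tensor_zero)
      show "nprod X \<Psi> i v = 0 \<or> nprod P (q1 k) (n - 1 - i) (e r) = 0" for i
        using n(1) v(2)[of i] qe[of "n - 1 - i"] by (cases "i \<ge> 0") auto
    qed
    have 3: "nprod T (\<beta> \<Psi>' E) n w = 0"
      unfolding v(1)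
    proof (rule nprod_tensor_zero)
      show "nprod X \<Psi>' i v = 0 \<or> nprod P E (n - 1 - i) (e r) = 0" for i
        using n(1) v(2)[of "i - 1"] Ee[of "n - 1 - i"] by (cases "i \<ge> 1") (auto simp: \<Psi>'_mode)
    qed
    have "\<beta> (nprod X \<tau> n v) (e (r - 1)) = 0"
      using yw[OF n(1)] A(3) by (simp add: y_mode 1 2 3)
    then show "nprod X \<tau> n v = 0" using beta_eq_zero e_nonzero by blast
  qed
  have \<omega>v: "nprod X \<omega> n v = 0" if "n \<ge> 2" for n
    using \<tau>\<tau>[of "n - 1" 1 v] \<tau>v[of 1] \<tau>v[of "n - 1"] that by simp
  \<comment> \<open>The \<open>X\<close>-component of \<open>y_(0) w\<close>, to which
    \<open>y_(1)\<close> is applied next.\<close>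
  define v' where "v' = scl X A (nprod X \<tau> 0 v) + scl X (of_int r) (nprod X \<Psi> (- 1) v)"
  have y0: "nprod T y_vec 0 w = \<beta> v' (e (r - 1))"
  proof -
    have 1: "nprod T (\<beta> \<tau> E) 0 w = \<beta> (nprod X \<tau> 0 v) (e (r - 1))"
      unfolding v(1)
    proof (subst nprod_tensor_single[of 0])
      show "nprod X \<tau> i v = 0 \<or> nprod P E (0 - 1 - i) (e r) = 0" if "i \<noteq> 0" for i
        using that \<tau>v[of i] Ee[of "0 - 1 - i"] by (cases "i \<ge> 0") auto
    qed (simp add: e_minus_one)
    have 2: "nprod T (\<beta> \<Psi> (q1 k)) 0 w = scl T (of_int r) (\<beta> (nprod X \<Psi> (- 1) v) (e (r - 1)))"
      unfolding v(1)
    proof (subst nprod_tensor_single[of "- 1"])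
      show "nprod X \<Psi> i v = 0 \<or> nprod P (q1 k) (0 - 1 - i) (e r) = 0" if "i \<noteq> - 1" for i
        using that v(2)[of i] qe[of "0 - 1 - i"] by (cases "i \<ge> 0") auto
    qed (simp add: q1_e)
    have 3: "nprod T (\<beta> \<Psi>' E) 0 w = 0"
      unfolding v(1)
    proof (rule nprod_tensor_zero)
      show "nprod X \<Psi>' i v = 0 \<or> nprod P E (0 - 1 - i) (e r) = 0" for i
        using v(2)[of "i - 1"] Ee[of "0 - 1 - i"] by (cases "i \<ge> 1"; cases "i = 0") (auto simp: \<Psi>'_mode)
    qed
    show ?thesis by (simp add: y_mode 1 2 3 v'_def)
  qed
  have \<tau>v': "nprod X \<tau> n v' = (if n = 1 then scl X (2 * A) (nprod X \<omega> 1 v) else 0)" if "n \<ge> 1" for n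
    using \<tau>\<tau>[of n 0 v] \<tau>v[OF that] \<tau>\<Psi>[of n "- 1" v] \<omega>v[of n] that
    by (auto simp: v'_def power2_eq_square mult.commute)
  have \<Psi>v': "nprod X \<Psi> n v' = (if n = 0 then scl X (of_int r) v else 0)" if "n \<ge> 0" for n
  proof -
    have "nprod X \<Psi> n (nprod X \<tau> 0 v) = - nprod X \<tau> 0 (nprod X \<Psi> n v)" by (simp add: \<tau>\<Psi>)
    then show ?thesis
      using \<Psi>\<Psi>[of n "- 1" v] v(2)[OF that] by (simp add: v'_def)
  qed
  \<comment> \<open>The scalar is \<open>r (r - 1)\<close> from \<open>\<Psi> \<otimes> q1\<close>
    minus \<open>B r\<close> from the derivative of \<Psi>. It forces the weight
    \<open>r (r - 2 k - 2) / (2 (2 k + 3))\<close> on \<open>v\<close>.\<close>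
  have y1: "nprod T y_vec 1 (\<beta> v' (e (r - 1))) =
    \<beta> (scl X (2 * (A * A)) (nprod X \<omega> 1 v) + scl X (of_int r * (of_int r - 2 * k - 2)) v) (e (r - 2))"
  proof -
    have 1: "nprod T (\<beta> \<tau> E) 1 (\<beta> v' (e (r - 1))) = scl T (2 * A) (\<beta> (nprod X \<omega> 1 v) (e (r - 2)))"
    proof (subst nprod_tensor_single[of 1])
      show "nprod X \<tau> i v' = 0 \<or> nprod P E (1 - 1 - i) (e (r - 1)) = 0" if "i \<noteq> 1" for i
        using that \<tau>v'[of i] Ee[of "1 - 1 - i"] by (cases "i \<ge> 1") auto
    qed (simp add: e_minus_one \<tau>v')
    have 2: "nprod T (\<beta> \<Psi> (q1 k)) 1 (\<beta> v' (e (r - 1))) = scl T (of_int r * (of_int r - 1)) (\<beta> v (e (r - 2)))"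
    proof (subst nprod_tensor_single[of 0])
      show "nprod X \<Psi> i v' = 0 \<or> nprod P (q1 k) (1 - 1 - i) (e (r - 1)) = 0" if "i \<noteq> 0" for i
        using that \<Psi>v'[of i] qe[of "1 - 1 - i"] by (cases "i \<ge> 0") auto
    qed (simp add: q1_e \<Psi>v' mult.commute)
    have 3: "nprod T (\<beta> \<Psi>' E) 1 (\<beta> v' (e (r - 1))) = scl T (- of_int r) (\<beta> v (e (r - 2)))"
    proof (subst nprod_tensor_single[of 1])
      show "nprod X \<Psi>' i v' = 0 \<or> nprod P E (1 - 1 - i) (e (r - 1)) = 0" if "i \<noteq> 1" for i
        using that \<Psi>v'[of "i - 1"] Ee[of "1 - 1 - i"] by (cases "i \<ge> 1") (auto simp: \<Psi>'_mode)
    qed (simp add: e_minus_one \<Psi>'_mode \<Psi>v')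
    have "nprod T y_vec 1 (\<beta> v' (e (r - 1))) = scl T (A * (2 * A)) (\<beta> (nprod X \<omega> 1 v) (e (r - 2))) +
      scl T (of_int r * (of_int r - 1) + B * (- of_int r)) (\<beta> v (e (r - 2)))"
      unfolding y_mode by (simp only: 1 2 3 T.scale_scale T.scale_left_distrib add.assoc)
    also have "A * (2 * A) = 2 * (A * A)" by simp
    also have "of_int r * (of_int r - 1) + B * (- of_int r) = of_int r * (of_int r - 2 * k - 2)"
      by (simp add: B_def algebra_simps)
    finally show ?thesis by simp
  qed
  have "nprod T y_vec 1 (nprod T y_vec 0 w) = 0"
  proof -
    have "nprod T (nprod T y_vec 0 y_vec) 1 w = 0"
      using w(1)[of 1 oF] by (simp add: f_vec_def)
    then show ?thesis using y_commutator[of 1 0 w] yw[of 1] by simp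
  qed
  then have "scl X (2 * (A * A)) (nprod X \<omega> 1 v) + scl X (of_int r * (of_int r - 2 * k - 2)) v = 0"
    unfolding y0 y1 using beta_eq_zero e_nonzero by blast
  moreover define \<rho> where "\<rho> = of_int r * (of_int r - 2 * k - 2)"
  moreover define a where "a = 2 * (A * A)"
  ultimately have eq: "scl X a (nprod X \<omega> 1 v) + scl X \<rho> v = 0" by simp
  have a0: "a \<noteq> 0" using A(3) by (simp add: a_def)
  have "scl X (1 / a) (scl X a (nprod X \<omega> 1 v) + scl X \<rho> v) = 0" using eq by simp
  then have L0: "nprod X \<omega> 1 v = scl X (- (\<rho> / a)) v"
    using a0 by (simp add: X.scale_right_distrib eq_neg_iff_add_eq_0)
  from simple[OF v(2) \<tau>v L0] obtain z where z: "v = scl X z (vac X)" by (auto simp: X.span_singleton)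
  show ?thesis
  proof (cases "z = 0")
    case True
    then have "w = scl T 0 (vac T)" using z v by simp
    then show ?thesis by blast
  next
    case False
    have w_nz: "w \<noteq> 0" using z v(1) False vacX beta_eq_zero[of "vac X" "e r"] e_nonzero by auto
    have "\<rho> = 0" using L0 a0 False vacX by (simp add: z X.creation)
    then have r: "of_int r = (0::complex) \<or> of_int r - 2 * k - 2 = 0" unfolding \<rho>_def by (simp only: mult_eq_0_iff)
    have "nprod T h_el 0 w = scl T (of_int r) w"
      by (simp add: v(1) \<iota>_mode h_e)
    then have "scl T (of_int q) w = scl T (of_int r) w" using w(3) by simp
    then have qr: "q = r" using w_nz by simp
    \<comment> \<open>Charge and parity agree on \<open>w\<close> by hypothesis, and
      \<open>w\<close> is even because \<open>v\<close> is a multiple of the vacuum.\<close>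
    have "even r"
    proof (rule ccontr)
      assume "odd r"
      then have "w \<in> part T True" using w(4) qr by simp
      moreover have "w \<in> part T False"
        using v(1) z part_T[OF X.vac_even P_even, of "e r"] by simp
      ultimately have "w \<in> part T False \<inter> part T True" by blast
      then show False using T.part_Int w_nz by auto
    qed
    then have "r = 0" using r kr[of r] by (auto simp: algebra_simps)
    then have "w = scl T z (vac T)" using v(1) z by (simp add: vac_T vac_P)
    then show ?thesis by blast
  qed
qed

end

theorem osp12_homomorphism:
  fixes Uaff :: "'b1::ab_group_add vsa" and Vk :: "'b2::ab_group_add vsa"
    and Uns :: "'b3::ab_group_add vsa" and Lns :: "'b4::ab_group_add vsa"
    and F :: "'b5::ab_group_add vsa" and P :: "'b6::ab_group_add vsa"
    and LF :: "'b7::ab_group_add vsa" and T :: "'b8::ab_group_add vsa"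
  assumes pq: "p \<ge> 2" "q \<ge> 2" "even (p - q)" "gcd ((p - q) div 2) q = 1"
      "k + 3 / 2 = of_int p / (2 * of_int q)"
    and U: "universal_affine osp12 k Uaff" "simple_quotient Uaff Vk"
    and L: "universal_ns (c_charge p q) Uns" "simple_quotient Uns Lns"
    and F: "fermion_vsa F" and P: "Pi_half0 P"
    and LF: "tensor_vsa Lns F LF" and T: "tensor_vsa LF P T"
  shows "\<exists>\<Phi>. vsa_hom Vk T \<Phi> \<and> nontrivial_hom T \<Phi>"
proof -
  have pq0: "of_int p \<noteq> (0::complex)" "of_int q \<noteq> (0::complex)" using pq by auto
  have k: "k = of_int p / (2 * of_int q) - 3 / 2" using pq(5) by (simp add: algebra_simps)
  then have k3: "2 * k + 3 = of_int p / of_int q" using pq0 by (simp add: field_simps)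
  then have k3_nz: "2 * k + 3 \<noteq> 0" using pq0 by simp
  \<comment> \<open>For even \<open>r\<close> the equality would give \<open>p = (r + 1) q\<close>,
    so \<open>(p - q) / 2\<close> would be a multiple of \<open>q\<close>, contradicting the gcd
    condition because \<open>q \<ge> 2\<close>. For odd \<open>r\<close> this conclusion would fail,
    hence the restriction to even charge.\<close>
  have kr: "of_int r \<noteq> 2 * k + 2" if r: "even r" for r :: int
  proof
    assume "of_int r = 2 * k + 2"
    then have "of_int (r + 1) = 2 * k + 3" by simp
    then have "of_int p = (of_int ((r + 1) * q) :: complex)" using k3 pq0 by (simp add: field_simps)
    then have p: "p = (r + 1) * q" by (simp only: of_int_eq_iff)
    obtain s where "r = 2 * s" using r by auto
    then have "(p - q) div 2 = s * q" by (simp add: p algebra_simps)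
    then have "gcd ((p - q) div 2) q = \<bar>q\<bar>" by simp
    then show False using pq by simp
  qed
  \<comment> \<open>A complex root, since \<open>2 k + 3 = p / q\<close> is positive.\<close>
  define A where "A = csqrt (- (2 * k + 3))"
  have AA: "A * A = - (2 * k + 3)" unfolding A_def by (metis power2_csqrt power2_eq_square)
  have A: "A \<noteq> 0" using AA k3_nz by (metis mult_zero_left neg_equal_0_iff_equal)
  have c: "A * A * (2 * c_charge p q / 3) = (2 * k + 1) * (4 * k + 5)"
    unfolding AA c_charge_def k using pq0 by (simp add: field_simps power2_eq_square)
  have vsaX: "vertex_superalgebra LF" using LF by (simp add: tensor_vsa_def)
  interpret X: vertex_superalgebra LF by fact
  have vsaV: "vertex_superalgebra Vk" and vacV: "vac Vk \<noteq> 0"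
    using U(2) by (auto simp: simple_quotient_def simple_vsa_def)
  obtain J e where lattice: "lattice_type P (1 / 2) J e" using lattice_type_locale[OF P] by auto
  then interpret lattice_type P "1 / 2" J e .
  obtain \<beta> where "tensor_product LF P T \<beta>" using tensor_vsa_locale[OF vsaX P.vertex_superalgebra_axioms T] .
  then interpret lattice_tensor LF P T \<beta> "1 / 2" J e
    using lattice by (simp add: lattice_tensor_def)
  obtain \<omega> \<tau> \<Psi> where osp: "osp_realization LF P T \<beta> J e \<omega> \<tau> \<Psi> (c_charge p q) k A"
    and simple: "\<And>v l. (\<And>n. n \<ge> 0 \<Longrightarrow> nprod LF \<Psi> n v = 0) \<Longrightarrow> (\<And>n. n \<ge> 1 \<Longrightarrow> nprod LF \<tau> n v = 0) \<Longrightarrow>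
      nprod LF \<omega> 1 v = scl LF l v \<Longrightarrow> v \<in> X.span {vac LF}"
  proof (rule ns_fermion[OF L F LF])
    fix \<omega> \<tau> \<Psi>
    assume *: "\<omega> \<in> part LF False" "\<tau> \<in> part LF True" "\<Psi> \<in> part LF True"
      "\<And>m n v. nprod LF \<tau> m (nprod LF \<tau> n v) = - nprod LF \<tau> n (nprod LF \<tau> m v) +
        scl LF 2 (nprod LF \<omega> (m + n) v) +
        scl LF (if m + n = 1 then c_charge p q / 3 * ((of_int m - 1 / 2) ^ 2 - 1 / 4) else 0) v"
      "\<And>m n v. nprod LF \<omega> m (nprod LF \<tau> n v) = nprod LF \<tau> n (nprod LF \<omega> m v) +
       scl LF ((of_int m - 1) / 2 - (of_int n - 1 / 2)) (nprod LF \<tau> (m + n - 1) v)"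
      "\<And>m n v. nprod LF \<Psi> m (nprod LF \<Psi> n v) =
        - nprod LF \<Psi> n (nprod LF \<Psi> m v) + scl LF (if m + n + 1 = 0 then 1 else 0) v"
      "\<And>m n v. nprod LF \<tau> m (nprod LF \<Psi> n v) = - nprod LF \<Psi> n (nprod LF \<tau> m v)"
      "\<And>m n v. nprod LF \<omega> m (nprod LF \<Psi> n v) = nprod LF \<Psi> n (nprod LF \<omega> m v)"
      "\<And>v l. (\<And>n. n \<ge> 0 \<Longrightarrow> nprod LF \<Psi> n v = 0) \<Longrightarrow> (\<And>n. n \<ge> 1 \<Longrightarrow> nprod LF \<tau> n v = 0) \<Longrightarrow>
        nprod LF \<omega> 1 v = scl LF l v \<Longrightarrow> v \<in> X.span {vac LF}"
      "vac LF \<noteq> 0"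
    have "osp_realization LF P T \<beta> J e \<omega> \<tau> \<Psi> (c_charge p q) k A"
      by unfold_locales (fact *(1-8) *(10) AA A c)+
    from this *(9) show thesis by (rule that)
  qed
  interpret O: osp_realization LF P T \<beta> J e \<omega> \<tau> \<Psi> "c_charge p q" k A by (rule osp)
  note relT = O.osp_relations
  from U(1) obtain I where vsaU: "vertex_superalgebra Uaff" and I: "\<And>a. I a \<in> part Uaff (odd_elt osp12 a)"
    and prU: "presents (scl Uaff) (\<lambda>(w, j::unit). act Uaff I w (vac Uaff))
      (induced_relators (odd_elt osp12) (affine_bracket osp12 k) (\<lambda>x j. 0))"
    unfolding universal_affine_def vacuum_vsa_def by blast
  interpret U: vertex_superalgebra Uaff by fact
  note relU = U.induced_relations[where g = "\<lambda>_. vac Uaff", OF prU I]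
  have genU: "v \<in> U.span {act Uaff I w (vac Uaff) | w. True}" for v
    using relU(3)[of v] by simp
  obtain \<Phi> where \<Phi>: "vsa_hom Uaff T \<Phi>" and \<Phi>I: "\<And>a. \<Phi> (I a) = O.osp_images a"
    using vacuum_hom[OF vsaU T.vertex_superalgebra_axioms prU I relT] by blast
  obtain f where f: "vsa_hom Uaff Vk f" "surj f" using U(2) by (auto simp: simple_quotient_def)
  obtain \<delta> where \<delta>: "\<And>a n b. nprod Uaff \<delta> 1 (nprod Uaff (I a) n b) =
      nprod Uaff (I a) n (nprod Uaff \<delta> 1 b) + scl Uaff (- of_int n) (nprod Uaff (I a) n b)"
    using U.sugawara_osp12[OF relU(1) k3_nz] by blast
  have len: "length w \<le> 1" if "w \<in> Poly_Mapping.keys (affine_bracket osp12 k x y)" for w x y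
    by (rule affine_bracket_length) (use that in simp)
  define chg where "chg a = (case a of oE \<Rightarrow> 2 | oF \<Rightarrow> - 2 | oH \<Rightarrow> (0::int) | oX \<Rightarrow> 1 | oY \<Rightarrow> - 1)" for a
  \<comment> \<open>The odd generators are exactly those of odd charge, so a vector of charge
    \<open>q\<close> has the parity of \<open>q\<close>.\<close>
  have parity: "word_parity (odd_elt osp12) w \<longleftrightarrow> odd (word_sum (chg \<circ> fst) w)" for w :: "osp_basis word"
  proof (induction w)
    case (Cons x w)
    have "odd_elt osp12 (fst x) \<longleftrightarrow> odd (chg (fst x))"
      by (cases "fst x") (simp_all add: osp12_def chg_def)
    then show ?case using Cons by auto
  qed simp
  have "\<exists>\<Theta>. vsa_hom Vk T \<Theta> \<and> (\<forall>u. \<Theta> (f u) = \<Phi> u)"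
  proof (rule hom_factors_through_quotient[where J = I and \<delta> = \<delta> and \<eta> = "I oH" and chg = chg and \<rho> = oX])
    show "v \<in> module.span (scl Uaff) {act Uaff I w (vac Uaff) | w. set w \<subseteq> creation_modes}" for v
      by (rule U.vacuum_span[OF relU(1) len genU])
    show "nprod Uaff (I oH) 0 (nprod Uaff (I a) n b) =
      nprod Uaff (I a) n (nprod Uaff (I oH) 0 b) + scl Uaff (of_int (chg a)) (nprod Uaff (I a) n b)" for a n b
      by (rule U.zero_mode_charge[OF relU(1)]; cases a)
        (simp_all add: osp12_def chg_def lin_ext_single U.vector_space_axioms)
    show "\<exists>z. \<Phi> i = scl T z (vac T)"
      if i: "i \<in> U.span {act Uaff I w (vac Uaff) | w. word_sum (chg \<circ> fst) w = q}" and
        sing: "\<And>a n. n \<ge> 1 \<Longrightarrow> nprod T (\<Phi> (I a)) n (\<Phi> i) = 0" "nprod T (\<Phi> (I oX)) 0 (\<Phi> i) = 0"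
        "nprod T (\<Phi> (I oH)) 0 (\<Phi> i) = scl T (of_int q) (\<Phi> i)" for i q
    proof (rule O.osp_singular[OF kr simple])
      have "{act Uaff I w (vac Uaff) | w. word_sum (chg \<circ> fst) w = q} \<subseteq> part Uaff (odd q)"
        using U.act_parity[of I "odd_elt osp12", OF I U.vac_even] by (auto simp: parity)
      then have "i \<in> part Uaff (odd q)"
        using i U.span_minimal[OF _ U.part_subspace] by blast
      then show "\<Phi> i \<in> part T (odd q)" by (rule vsa_homD(7)[OF \<Phi>])
    qed (use sing in \<open>auto simp: \<Phi>I\<close>)
  qed (use vsaU vsaV vacV T.vertex_superalgebra_axioms \<Phi> f \<delta> in \<open>auto simp: chg_def split: osp_basis.splits\<close>)
  then obtain \<Theta> where \<Theta>: "vsa_hom Vk T \<Theta>" "\<And>u. \<Theta> (f u) = \<Phi> u" by blast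
  \<comment> \<open>The image of \<open>x\<close> is nonzero of charge 1 under \<open>h\<close>,
    whereas multiples of the vacuum have charge 0.\<close>
  have "O.x_vec \<noteq> scl T z (vac T)" for z
  proof
    assume *: "O.x_vec = scl T z (vac T)"
    have "nprod T O.h_el 0 O.x_vec = 0" unfolding * by (simp add: T.creation)
    then have "O.x_vec = 0" by (simp add: O.h_x)
    then have "\<Psi> = 0" unfolding O.x_vec_def using beta_eq_zero e_nonzero by blast
    then show False using O.\<Psi>_ope[of 0] O.vacX by simp
  qed
  then have "\<Theta> (f (I oX)) \<noteq> scl T z (vac T)" for z by (simp add: \<Theta>(2) \<Phi>I)
  then have "nontrivial_hom T \<Theta>" unfolding nontrivial_hom_def by blast
  then show ?thesis using \<Theta>(1) by blast
qed

theorem theorem1p1: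
  shows
    "(\<forall>(k::complex) (p::int) (p'::int)
        (Uaff :: 'a1::ab_group_add vsa) (Vk :: 'a2::ab_group_add vsa)
        (Uvir :: 'a3::ab_group_add vsa) (Lvir :: 'a4::ab_group_add vsa)
        (P :: 'a5::ab_group_add vsa) (T :: 'a6::ab_group_add vsa).
        p \<ge> 2 \<and> p' \<ge> 2 \<and> gcd p p' = 1 \<and> k + 2 = of_int p / of_int p' \<and>
        universal_affine sl2 k Uaff \<and> simple_quotient Uaff Vk \<and>
        universal_virasoro (d_charge p p') Uvir \<and> simple_quotient Uvir Lvir \<and>
        Pi0 P \<and> tensor_vsa Lvir P T \<longrightarrow>
        (\<exists>\<Phi>. vsa_hom Vk T \<Phi> \<and> nontrivial_hom T \<Phi>)) \<and>
     (\<forall>(k::complex) (p::int) (q::int)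
        (Uaff :: 'b1::ab_group_add vsa) (Vk :: 'b2::ab_group_add vsa)
        (Uns :: 'b3::ab_group_add vsa) (Lns :: 'b4::ab_group_add vsa)
        (F :: 'b5::ab_group_add vsa) (P :: 'b6::ab_group_add vsa)
        (LF :: 'b7::ab_group_add vsa) (T :: 'b8::ab_group_add vsa).
        p \<ge> 2 \<and> q \<ge> 2 \<and> even (p - q) \<and> gcd ((p - q) div 2) q = 1 \<and>
        k + 3 / 2 = of_int p / (2 * of_int q) \<and>
        universal_affine osp12 k Uaff \<and> simple_quotient Uaff Vk \<and>
        universal_ns (c_charge p q) Uns \<and> simple_quotient Uns Lns \<and>
        fermion_vsa F \<and> Pi_half0 P \<and>
        tensor_vsa Lns F LF \<and> tensor_vsa LF P T \<longrightarrow>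
        (\<exists>\<Phi>. vsa_hom Vk T \<Phi> \<and> nontrivial_hom T \<Phi>))"
  by (intro conjI allI impI; elim conjE) (rule sl2_homomorphism osp12_homomorphism; assumption)+

end
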